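(* Let $p>3$ be a prime and let $G$ be a finite group with $\mathrm{rk}_p(G)=2$. Then $G$ involves $\mathrm{Qd}(p)$ if and only if $G$ $p'$-involves $\mathrm{Qd}(p)$.
   Context: All groups are finite and $p$ is a prime. A $p$-group has rank $k$ if the largest possible order of an elementary abelian subgroup of it is $p^k$. The $p$-rank $\mathrm{rk}_p(G)$ of a finite group $G$ is the rank of a Sylow $p$-subgroup of $G$. The group $\mathrm{Qd}(p)$ is the semidirect product $(\mathbb{Z}/p\times\mathbb{Z}/p)\rtimes SL(2,p)$, where $SL(2,p)$ acts on $\mathbb{Z}/p\times\mathbb{Z}/p$ by the usual action of $2\times 2$ matrices on a two-dimensional vector space over the field with $p$ elements. A group $G$ involves $\mathrm{Qd}(p)$ if there exist subgroups $K\lhd H\leq G$ such that $H/K\cong \mathrm{Qd}(p)$. A group $G$ $p'$-involves $\mathrm{Qd}(p)$ if there exist subgroups $K\lhd H\leq G$ such that $K$ has order coprime to $p$ and $H/K\cong\mathrm{Qd}(p)$. *)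

theory Defs
  imports "HOL-Algebra.Algebra" "HOL-Number_Theory.Residues"
begin

hide_const (open) Divisibility.prime

definition elementary_abelian :: "nat \<Rightarrow> ('a, 'b) monoid_scheme \<Rightarrow> bool" where
  "elementary_abelian p E \<longleftrightarrow>
     comm_group E \<and> (\<forall>x \<in> carrier E. x [^]\<^bsub>E\<^esub> p = \<one>\<^bsub>E\<^esub>)"

definition elementary_abelian_orders :: "nat \<Rightarrow> ('a, 'b) monoid_scheme \<Rightarrow> nat set" where
  "elementary_abelian_orders p P =
     {card E | E. subgroup E P \<and> elementary_abelian p (P\<lparr>carrier := E\<rparr>)}"

definition p_group_rank :: "nat \<Rightarrow> ('a, 'b) monoid_scheme \<Rightarrow> nat" where
  "p_group_rank p P = (THE k. Max (elementary_abelian_orders p P) = p ^ k)"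

definition sylow_subgroup :: "nat \<Rightarrow> 'a set \<Rightarrow> ('a, 'b) monoid_scheme \<Rightarrow> bool" where
  "sylow_subgroup p P G \<longleftrightarrow> subgroup P G \<and> card P = p ^ multiplicity p (order G)"

text \<open>All Sylow \<open>p\<close>-subgroups of a finite group are conjugate, so the rank does not
  depend on the one chosen here.\<close>

definition p_rank :: "nat \<Rightarrow> ('a, 'b) monoid_scheme \<Rightarrow> nat" where
  "p_rank p G = p_group_rank p (G\<lparr>carrier := SOME P. sylow_subgroup p P G\<rparr>)"

lemma ex_sylow_subgroup:
  fixes G (structure)
  assumes "group G" "finite (carrier G)" "prime p"
  shows "\<exists>P. sylow_subgroup p P G"
proof -
  interpret group G by fact
  have "order G \<noteq> 0"
    using assms(2) order_gt_0_iff_finite by simp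
  then obtain m where "order G = p ^ multiplicity p (order G) * m"
    using multiplicity_dvd[of p "order G"] by (auto elim: dvdE)
  from sylow_thm[OF assms(3,1) this assms(2)] show ?thesis
    by (auto simp: sylow_subgroup_def)
qed

lemma Max_elementary_abelian_orders:
  fixes P (structure)
  assumes "group P" "prime p" "order P = p ^ n"
  shows "Max (elementary_abelian_orders p P) = p ^ p_group_rank p P"
proof -
  interpret group P by fact
  let ?S = "elementary_abelian_orders p P"
  have p: "p > 1"
    using assms(2) prime_gt_1_nat by blast
  then have "finite (carrier P)"
    using assms(3) order_gt_0_iff_finite by simp
  have pow: "\<exists>k. x = p ^ k" and le: "x \<le> order P" if "x \<in> ?S" for x
  proof -
    obtain E where E: "subgroup E P" "x = card E"
      using \<open>x \<in> ?S\<close> by (auto simp: elementary_abelian_orders_def)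
    then have "x dvd p ^ n"
      using lagrange[OF E(1)] assms(3) by (metis dvd_triv_right)
    then show "\<exists>k. x = p ^ k" "x \<le> order P"
      using assms(2,3) p divides_primepow_nat dvd_imp_le[of x "p ^ n"] by auto
  qed
  have "comm_group (P\<lparr>carrier := {\<one>}\<rparr>)"
    by (rule group.group_comm_groupI[OF subgroup_imp_group[OF triv_subgroup]]) simp
  then have "card {\<one>} \<in> ?S"
    unfolding elementary_abelian_orders_def elementary_abelian_def
    using triv_subgroup nat_pow_consistent[symmetric] by fastforce
  moreover have "finite ?S"
    using le by (meson finite_nat_set_iff_bounded_le)
  ultimately have "Max ?S \<in> ?S"
    by (metis Max_in empty_iff)
  then obtain k where k: "Max ?S = p ^ k"
    using pow by blast
  have "(THE k. Max ?S = p ^ k) = k"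
    by (rule the_equality) (use k p in auto)
  with k show ?thesis
    by (simp add: p_group_rank_def)
qed

definition semidirect_product ::
    "('n, 'c) monoid_scheme \<Rightarrow> ('h, 'd) monoid_scheme \<Rightarrow> ('h \<Rightarrow> 'n \<Rightarrow> 'n) \<Rightarrow> ('n \<times> 'h) monoid"
  where
  "semidirect_product N H act =
     \<lparr>carrier = carrier N \<times> carrier H,
      monoid.mult = (\<lambda>(n, h) (n', h'). (n \<otimes>\<^bsub>N\<^esub> act h n', h \<otimes>\<^bsub>H\<^esub> h')),
      one = (\<one>\<^bsub>N\<^esub>, \<one>\<^bsub>H\<^esub>)\<rparr>"

text \<open>A \<open>2 \<times> 2\<close> matrix is the pair of its rows.\<close>

type_synonym 'a mat2 = "('a \<times> 'a) \<times> ('a \<times> 'a)"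

definition det2 :: "('a, 'b) ring_scheme \<Rightarrow> 'a mat2 \<Rightarrow> 'a" where
  "det2 R = (\<lambda>((a, b), (c, d)). (a \<otimes>\<^bsub>R\<^esub> d) \<ominus>\<^bsub>R\<^esub> (b \<otimes>\<^bsub>R\<^esub> c))"

definition mat2_mult :: "('a, 'b) ring_scheme \<Rightarrow> 'a mat2 \<Rightarrow> 'a mat2 \<Rightarrow> 'a mat2" where
  "mat2_mult R = (\<lambda>((a, b), (c, d)) ((a', b'), (c', d')).
     ((a \<otimes>\<^bsub>R\<^esub> a' \<oplus>\<^bsub>R\<^esub> b \<otimes>\<^bsub>R\<^esub> c', a \<otimes>\<^bsub>R\<^esub> b' \<oplus>\<^bsub>R\<^esub> b \<otimes>\<^bsub>R\<^esub> d'),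
      (c \<otimes>\<^bsub>R\<^esub> a' \<oplus>\<^bsub>R\<^esub> d \<otimes>\<^bsub>R\<^esub> c', c \<otimes>\<^bsub>R\<^esub> b' \<oplus>\<^bsub>R\<^esub> d \<otimes>\<^bsub>R\<^esub> d')))"

definition mat2_vec :: "('a, 'b) ring_scheme \<Rightarrow> 'a mat2 \<Rightarrow> 'a \<times> 'a \<Rightarrow> 'a \<times> 'a" where
  "mat2_vec R = (\<lambda>((a, b), (c, d)) (x, y).
     (a \<otimes>\<^bsub>R\<^esub> x \<oplus>\<^bsub>R\<^esub> b \<otimes>\<^bsub>R\<^esub> y, c \<otimes>\<^bsub>R\<^esub> x \<oplus>\<^bsub>R\<^esub> d \<otimes>\<^bsub>R\<^esub> y))"

definition SL2 :: "('a, 'b) ring_scheme \<Rightarrow> 'a mat2 monoid" where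
  "SL2 R =
     \<lparr>carrier = {A \<in> (carrier R \<times> carrier R) \<times> (carrier R \<times> carrier R). det2 R A = \<one>\<^bsub>R\<^esub>},
      monoid.mult = mat2_mult R,
      one = ((\<one>\<^bsub>R\<^esub>, \<zero>\<^bsub>R\<^esub>), (\<zero>\<^bsub>R\<^esub>, \<one>\<^bsub>R\<^esub>))\<rparr>"

definition Qd :: "nat \<Rightarrow> ((int \<times> int) \<times> int mat2) monoid" where
  "Qd p = (let F = residue_ring (int p) in
     semidirect_product (add_monoid F \<times>\<times> add_monoid F) (SL2 F) (mat2_vec F))"

lemma group_semidirect_product:
  assumes "group N" "group H"
    and hom: "\<And>h. h \<in> carrier H \<Longrightarrow> act h \<in> hom N N"
    and act_one: "\<And>n. n \<in> carrier N \<Longrightarrow> act \<one>\<^bsub>H\<^esub> n = n"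
    and act_mult: "\<And>h h' n. \<lbrakk>h \<in> carrier H; h' \<in> carrier H; n \<in> carrier N\<rbrakk>
      \<Longrightarrow> act (h \<otimes>\<^bsub>H\<^esub> h') n = act h (act h' n)"
  shows "group (semidirect_product N H act)"
proof -
  interpret N: group N by fact
  interpret H: group H by fact
  have closed: "act h n \<in> carrier N" if "h \<in> carrier H" "n \<in> carrier N" for h n
    using hom that by (meson hom_in_carrier)
  have distrib: "act h (n \<otimes>\<^bsub>N\<^esub> n') = act h n \<otimes>\<^bsub>N\<^esub> act h n'"
    if "h \<in> carrier H" "n \<in> carrier N" "n' \<in> carrier N" for h n n'
    using hom that by (meson hom_mult)
  show ?thesis
  proof (rule groupI)
    fix x assume "x \<in> carrier (semidirect_product N H act)"
    then obtain n h where x: "x = (n, h)" "n \<in> carrier N" "h \<in> carrier H"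
      by (auto simp: semidirect_product_def)
    have "act (inv\<^bsub>H\<^esub> h) (inv\<^bsub>N\<^esub> n) \<otimes>\<^bsub>N\<^esub> act (inv\<^bsub>H\<^esub> h) n = act (inv\<^bsub>H\<^esub> h) \<one>\<^bsub>N\<^esub>"
      using x by (simp flip: distrib)
    also have "\<dots> = \<one>\<^bsub>N\<^esub>"
      using hom x(3) assms(1) by (simp add: hom_one)
    finally show "\<exists>y \<in> carrier (semidirect_product N H act).
        y \<otimes>\<^bsub>semidirect_product N H act\<^esub> x = \<one>\<^bsub>semidirect_product N H act\<^esub>"
      using x closed
      by (intro bexI[of _ "(act (inv\<^bsub>H\<^esub> h) (inv\<^bsub>N\<^esub> n), inv\<^bsub>H\<^esub> h)"])
        (auto simp: semidirect_product_def)
  qed (auto simp: semidirect_product_def closed distrib act_one act_mult N.m_assoc H.m_assoc)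
qed

lemma (in cring) dot2_assoc:
  assumes "a \<in> carrier R" "b \<in> carrier R" "p \<in> carrier R" "q \<in> carrier R"
    "r \<in> carrier R" "s \<in> carrier R" "x \<in> carrier R" "y \<in> carrier R"
  shows "(a \<otimes> p \<oplus> b \<otimes> r) \<otimes> x \<oplus> (a \<otimes> q \<oplus> b \<otimes> s) \<otimes> y
    = a \<otimes> (p \<otimes> x \<oplus> q \<otimes> y) \<oplus> b \<otimes> (r \<otimes> x \<oplus> s \<otimes> y)"
  using assms by algebra

lemma (in cring) dot2_add:
  assumes "a \<in> carrier R" "b \<in> carrier R" "x \<in> carrier R" "y \<in> carrier R"
    "x' \<in> carrier R" "y' \<in> carrier R"
  shows "a \<otimes> (x \<oplus> x') \<oplus> b \<otimes> (y \<oplus> y')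
    = (a \<otimes> x \<oplus> b \<otimes> y) \<oplus> (a \<otimes> x' \<oplus> b \<otimes> y')"
  using assms by algebra

lemma (in cring) group_SL2: "group (SL2 R)"
proof (rule groupI)
  fix A assume "A \<in> carrier (SL2 R)"
  then obtain a b c d where A: "A = ((a, b), (c, d))" "a \<in> carrier R" "b \<in> carrier R"
      "c \<in> carrier R" "d \<in> carrier R" "a \<otimes> d \<ominus> b \<otimes> c = \<one>"
    by (auto simp: SL2_def det2_def)
  have "d \<otimes> a \<oplus> \<ominus> b \<otimes> c = \<one>" "\<ominus> c \<otimes> b \<oplus> a \<otimes> d = \<one>" "d \<otimes> a \<ominus> b \<otimes> c = \<one>"
    "d \<otimes> b \<oplus> \<ominus> b \<otimes> d = \<zero>" "\<ominus> c \<otimes> a \<oplus> a \<otimes> c = \<zero>" "d \<otimes> a \<ominus> \<ominus> b \<otimes> \<ominus> c = \<one>"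
    using A by algebra+
  then show "\<exists>B \<in> carrier (SL2 R). B \<otimes>\<^bsub>SL2 R\<^esub> A = \<one>\<^bsub>SL2 R\<^esub>"
    using A by (intro bexI[of _ "((d, \<ominus> b), (\<ominus> c, a))"])
      (auto simp: SL2_def det2_def mat2_mult_def)
next
  fix A B assume "A \<in> carrier (SL2 R)" "B \<in> carrier (SL2 R)"
  then obtain a b c d a' b' c' d' where
    A: "A = ((a, b), (c, d))" "a \<in> carrier R" "b \<in> carrier R"
      "c \<in> carrier R" "d \<in> carrier R" "a \<otimes> d \<ominus> b \<otimes> c = \<one>" and
    B: "B = ((a', b'), (c', d'))" "a' \<in> carrier R" "b' \<in> carrier R"
      "c' \<in> carrier R" "d' \<in> carrier R" "a' \<otimes> d' \<ominus> b' \<otimes> c' = \<one>"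
    by (auto simp: SL2_def det2_def)
  have "(a \<otimes> a' \<oplus> b \<otimes> c') \<otimes> (c \<otimes> b' \<oplus> d \<otimes> d') \<ominus> (a \<otimes> b' \<oplus> b \<otimes> d') \<otimes> (c \<otimes> a' \<oplus> d \<otimes> c')
      = (a \<otimes> d \<ominus> b \<otimes> c) \<otimes> (a' \<otimes> d' \<ominus> b' \<otimes> c')"
    using A(2-5) B(2-5) by algebra
  then show "A \<otimes>\<^bsub>SL2 R\<^esub> B \<in> carrier (SL2 R)"
    using A B by (auto simp: SL2_def det2_def mat2_mult_def)
next
  fix A B C assume "A \<in> carrier (SL2 R)" "B \<in> carrier (SL2 R)" "C \<in> carrier (SL2 R)"
  then show "A \<otimes>\<^bsub>SL2 R\<^esub> B \<otimes>\<^bsub>SL2 R\<^esub> C = A \<otimes>\<^bsub>SL2 R\<^esub> (B \<otimes>\<^bsub>SL2 R\<^esub> C)"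
    by (auto simp: SL2_def mat2_mult_def dot2_assoc)
qed (auto simp: SL2_def det2_def mat2_mult_def a_minus_def)

lemma group_Qd:
  assumes "prime p"
  shows "group (Qd p)"
proof -
  define F where "F = residue_ring (int p)"
  interpret residues "int p" F
    by unfold_locales (use assms prime_gt_1_nat in \<open>auto simp: F_def\<close>)
  have "group (add_monoid F \<times>\<times> add_monoid F)"
    by (intro DirProd_group a_group)
  moreover have "mat2_vec F A \<in> hom (add_monoid F \<times>\<times> add_monoid F) (add_monoid F \<times>\<times> add_monoid F)"
    if "A \<in> carrier (SL2 F)" for A
    using that by (auto simp: hom_def SL2_def mat2_vec_def dot2_add)
  moreover have "mat2_vec F \<one>\<^bsub>SL2 F\<^esub> v = v" if "v \<in> carrier (add_monoid F \<times>\<times> add_monoid F)" for v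
    using that by (auto simp: SL2_def mat2_vec_def)
  moreover have "mat2_vec F (A \<otimes>\<^bsub>SL2 F\<^esub> B) v = mat2_vec F A (mat2_vec F B v)"
    if "A \<in> carrier (SL2 F)" "B \<in> carrier (SL2 F)" "v \<in> carrier (add_monoid F \<times>\<times> add_monoid F)"
    for A B v
    using that by (auto simp: SL2_def mat2_vec_def mat2_mult_def dot2_assoc)
  ultimately show ?thesis
    unfolding Qd_def Let_def F_def[symmetric] by (intro group_semidirect_product group_SL2)
qed

definition involves_Qd :: "nat \<Rightarrow> ('a, 'b) monoid_scheme \<Rightarrow> bool" where
  "involves_Qd p G \<longleftrightarrow>
     (\<exists>H K. subgroup H G \<and> K \<lhd> (G\<lparr>carrier := H\<rparr>) \<and> (G\<lparr>carrier := H\<rparr>) Mod K \<cong> Qd p)"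

definition p'_involves_Qd :: "nat \<Rightarrow> ('a, 'b) monoid_scheme \<Rightarrow> bool" where
  "p'_involves_Qd p G \<longleftrightarrow>
     (\<exists>H K. subgroup H G \<and> K \<lhd> (G\<lparr>carrier := H\<rparr>) \<and> coprime (card K) p \<and>
        (G\<lparr>carrier := H\<rparr>) Mod K \<cong> Qd p)"

end

theory Submission
  imports Defs
begin

text \<open>Let \<open>H\<close> be a subgroup of least order with an epimorphism onto \<open>Qd(p)\<close> and let \<open>K\<close> be the kernel. By
  Frattini's argument \<open>K\<close> is nilpotent; factoring out its \<open>p'\<close>-part we may assume that \<open>K = Q\<close> is a \<open>p\<close>-group.
  If \<open>Q\<close> is nontrivial, an elementary abelian subgroup of order \<open>p\<^sup>3\<close> appears as follows. Let \<open>V\<close> be the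
  preimage of the translations, \<open>t\<close> an involution lifting \<open>-1\<close>, and \<open>D\<close> minimal among the normal subgroups of \<open>H\<close>
  inside \<open>V\<close> not centralized by \<open>t\<close>; then \<open>Z = C\<^sub>D(t)\<close> is central in \<open>D\<close>, and \<open>D / Z\<close> is a chief factor.
  In rank two, if \<open>Z = 1\<close> then \<open>D\<close> contains all elements of order \<open>p\<close> of \<open>V\<close>, so \<open>t\<close> inverts \<open>V\<close>, which is abelian
  with \<open>Q = V\<^sup>p\<close>. A transvection \<open>u\<close> acts on \<open>V\<close> with \<open>(u - 1)\<^sup>2 V \<subseteq> pV\<close> and \<open>u\<^sup>p = 1\<close>, and since \<open>p > 3\<close> the binomial
  expansion of \<open>u\<^sup>p\<close> forces \<open>u\<close> to be trivial on \<open>V / Q\<close>, which is absurd. If \<open>Z \<noteq> 1\<close>, there is \<open>x\<close> of order \<open>p\<close>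
  in \<open>D\<close> inverted by \<open>t\<close> and centralized by \<open>C\<^sub>P(t)\<close>, where \<open>P = V\<langle>u\<rangle>\<close>. By the rank condition all elements of order \<open>p\<close>
  of \<open>C\<^sub>P(t)\<close> lie in a subgroup of order \<open>p\<close> of \<open>Z\<close>, which is centralized by the torus element \<open>diag(2, 1/2)\<close>;
  so this element centralizes \<open>P / V\<close>, although it acts on it as multiplication by \<open>4 \<noteq> 1\<close>.\<close>

section \<open>Actions of \<open>p\<close>-groups\<close>

lemma (in group) inv_cancel_left [simp]:
  "\<lbrakk>x \<in> carrier G; y \<in> carrier G\<rbrakk> \<Longrightarrow> inv x \<otimes> (x \<otimes> y) = y"
  "\<lbrakk>x \<in> carrier G; y \<in> carrier G\<rbrakk> \<Longrightarrow> x \<otimes> (inv x \<otimes> y) = y"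
  by (simp_all flip: m_assoc)

text \<open>Orbit sizes divide the group order, so every orbit that is not a single fixed point
  contributes a multiple of \<open>p\<close>. The action is a bare function \<open>f\<close>, which
  suits both conjugation and translation of cosets.\<close>

lemma (in group) p_group_fixed_points:
  assumes "finite E" "prime p" "order G = p ^ k"
    and closed: "\<And>g x. \<lbrakk>g \<in> carrier G; x \<in> E\<rbrakk> \<Longrightarrow> f g x \<in> E"
    and one: "\<And>x. x \<in> E \<Longrightarrow> f \<one> x = x"
    and mult: "\<And>g h x. \<lbrakk>g \<in> carrier G; h \<in> carrier G; x \<in> E\<rbrakk> \<Longrightarrow> f (g \<otimes> h) x = f g (f h x)"
  shows "[card E = card {x \<in> E. \<forall>g \<in> carrier G. f g x = x}] (mod p)"
proof -
  \<comment> \<open>\<open>Bij E\<close> contains only extensional functions, hence the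
    restriction.\<close>
  define \<phi> where "\<phi> g = restrict (f g) E" for g
  have inv_f: "f (inv g) (f g x) = x" "f g (f (inv g) x) = x" if "g \<in> carrier G" "x \<in> E" for g x
    using that one by (simp_all flip: mult)
  have Bij: "\<phi> g \<in> Bij E" if "g \<in> carrier G" for g
  proof -
    have "bij_betw (f g) E E"
      by (rule bij_betwI[of _ _ _ "f (inv g)"]) (use that inv_f closed in auto)
    then show ?thesis
      by (simp add: Bij_def \<phi>_def)
  qed
  have "\<phi> \<in> hom G (BijGroup E)"
  proof (rule homI)
    fix g h assume gh: "g \<in> carrier G" "h \<in> carrier G"
    show "\<phi> (g \<otimes> h) = \<phi> g \<otimes>\<^bsub>BijGroup E\<^esub> \<phi> h"
      using gh Bij closed mult by (auto simp: BijGroup_def \<phi>_def compose_def fun_eq_iff)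
  qed (use Bij in \<open>simp add: BijGroup_def\<close>)
  then interpret group_action G E \<phi>
    by (simp add: group_action_def group_hom_def group_hom_axioms_def group_BijGroup)
  let ?O = "orbits G E \<phi>" and ?F = "{x \<in> E. \<forall>g \<in> carrier G. f g x = x}"
  have sub: "orb \<subseteq> E" if "orb \<in> ?O" for orb
    using orbits_coverture that by blast
  have fin: "finite ?O"
    using sub assms(1) by (meson finite_Pow_iff PowI finite_subset subsetI)
  have cardX: "card E = (\<Sum>orb\<in>?O. card orb)"
    using disjoint_sum[OF assms(1), of "\<lambda>_. 1::nat"] by simp
  have orbF: "orbit G \<phi> x = {x} \<longleftrightarrow> x \<in> ?F" if x: "x \<in> E" for x
  proof
    assume L: "orbit G \<phi> x = {x}"
    have "f g x \<in> orbit G \<phi> x" if "g \<in> carrier G" for g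
      unfolding orbit_def \<phi>_def using x that by force
    with L x show "x \<in> ?F" by simp
  next
    assume "x \<in> ?F"
    then have "orbit G \<phi> x \<subseteq> {x}"
      by (auto simp: orbit_def \<phi>_def)
    with orbit_refl[OF x] show "orbit G \<phi> x = {x}" by blast
  qed
  have singles: "{orb \<in> ?O. card orb = 1} = (\<lambda>x. {x}) ` ?F"
  proof (intro equalityI subsetI)
    fix orb assume "orb \<in> {orb \<in> ?O. card orb = 1}"
    then obtain x where x: "x \<in> E" "orb = orbit G \<phi> x" "card orb = 1"
      by (auto simp: orbits_def)
    then have "orb = {x}"
      using orbit_refl[OF x(1)] by (metis card_1_singletonE singletonD)
    then show "orb \<in> (\<lambda>x. {x}) ` ?F"
      using orbF x by blast
  next
    fix orb assume "orb \<in> (\<lambda>x. {x}) ` ?F"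
    then obtain x where "x \<in> ?F" "orb = {x}" by blast
    then show "orb \<in> {orb \<in> ?O. card orb = 1}"
      using orbF[of x] by (auto simp: orbits_def)
  qed
  have big: "[card orb = 0] (mod p)" if orb: "orb \<in> ?O" "card orb \<noteq> 1" for orb
  proof -
    obtain x where x: "x \<in> E" "orb = orbit G \<phi> x"
      using orb by (auto simp: orbits_def)
    have "card orb dvd p ^ k"
      using orbit_stabilizer_theorem[OF x(1)] x(2) assms(3) by (metis dvd_triv_left)
    then obtain i where "card orb = p ^ i"
      using divides_primepow_nat[OF assms(2)] by blast
    then show ?thesis
      using orb(2) by (cases i) (auto simp: cong_0_iff)
  qed
  have "card E = (\<Sum>orb | orb \<in> ?O \<and> card orb = 1. card orb) + (\<Sum>orb | orb \<in> ?O \<and> card orb \<noteq> 1. card orb)"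
    unfolding cardX using fin by (subst sum.union_disjoint[symmetric]) (auto intro!: sum.cong)
  also have "(\<Sum>orb | orb \<in> ?O \<and> card orb = 1. card orb) = card {orb \<in> ?O. card orb = 1}"
    by simp
  also have "\<dots> = card ?F"
    unfolding singles by (intro card_image) (auto simp: inj_on_def)
  finally have "card E = card ?F + (\<Sum>orb | orb \<in> ?O \<and> card orb \<noteq> 1. card orb)" .
  moreover have "p dvd (\<Sum>orb | orb \<in> ?O \<and> card orb \<noteq> 1. card orb)"
    using big by (intro dvd_sum) (auto simp: cong_0_iff)
  ultimately show ?thesis
    by (simp add: cong_add_lcancel_0_nat cong_0_iff)
qed

abbreviation (in group) commutator :: "'a \<Rightarrow> 'a \<Rightarrow> 'a" where
  "commutator x y \<equiv> x \<otimes> y \<otimes> inv x \<otimes> inv y"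

lemma (in group) commutator_eq_one_iff:
  "\<lbrakk>x \<in> carrier G; y \<in> carrier G\<rbrakk> \<Longrightarrow> commutator x y = \<one> \<longleftrightarrow> x \<otimes> y = y \<otimes> x"
  by (metis inv_closed inv_equality inv_inv inv_solve_right m_assoc m_closed r_inv l_inv)

text \<open>Conjugation by \<open>P\<close> permutes the cosets of \<open>Z\<close> in
  \<open>D\<close>, and their number is a power of \<open>p\<close> other than 1. Since
  \<open>Z\<close> itself is fixed, a further coset \<open>Z #> d\<close> is fixed too, which is the
  commutator condition on \<open>d\<close>.\<close>

lemma (in group) p_subgroup_fixes_coset:
  assumes fin: "finite (carrier G)" and p: "prime p"
    and P: "subgroup P G" "card P = p ^ k"
    and D: "subgroup D G" "card D = p ^ m"
    and Z: "subgroup Z G" "Z \<subset> D"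
    and PD: "\<And>g d. \<lbrakk>g \<in> P; d \<in> D\<rbrakk> \<Longrightarrow> g \<otimes> d \<otimes> inv g \<in> D"
    and PZ: "\<And>g z. \<lbrakk>g \<in> P; z \<in> Z\<rbrakk> \<Longrightarrow> g \<otimes> z \<otimes> inv g \<in> Z"
  shows "\<exists>d \<in> D - Z. \<forall>g \<in> P. commutator g d \<in> Z"
proof -
  interpret P: subgroup P G by fact
  interpret D: subgroup D G by fact
  interpret Z: subgroup Z G by fact
  let ?E = "(\<lambda>d. Z #> d) ` D"
  define f where "f g C = (\<lambda>x. g \<otimes> x \<otimes> inv g) ` C" for g C
  have finD: "finite D"
    using fin D.subset finite_subset by blast
  have f_coset: "f g (Z #> d) = Z #> (g \<otimes> d \<otimes> inv g)" if g: "g \<in> P" and d: "d \<in> D" for g d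
  proof (intro equalityI subsetI)
    fix y assume "y \<in> f g (Z #> d)"
    then obtain z where z: "z \<in> Z" "y = g \<otimes> (z \<otimes> d) \<otimes> inv g"
      by (auto simp: f_def r_coset_def)
    then have "y = (g \<otimes> z \<otimes> inv g) \<otimes> (g \<otimes> d \<otimes> inv g)"
      using g d by (simp add: m_assoc)
    with PZ[OF g z(1)] show "y \<in> Z #> (g \<otimes> d \<otimes> inv g)"
      by (auto simp: r_coset_def)
  next
    fix y assume "y \<in> Z #> (g \<otimes> d \<otimes> inv g)"
    then obtain z where z: "z \<in> Z" "y = z \<otimes> (g \<otimes> d \<otimes> inv g)"
      by (auto simp: r_coset_def)
    then have "y = g \<otimes> ((inv g \<otimes> z \<otimes> inv (inv g)) \<otimes> d) \<otimes> inv g"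
      using g d by (simp add: m_assoc)
    moreover have "inv g \<otimes> z \<otimes> inv (inv g) \<otimes> d \<in> Z #> d"
      using PZ[of "inv g" z] g z by (auto simp: r_coset_def)
    ultimately show "y \<in> f g (Z #> d)"
      by (simp add: f_def)
  qed
  have "[card ?E = card {C \<in> ?E. \<forall>g \<in> carrier (G\<lparr>carrier := P\<rparr>). f g C = C}] (mod p)"
  proof (rule group.p_group_fixed_points)
    show "group (G\<lparr>carrier := P\<rparr>)"
      using P(1) by (rule subgroup_imp_group)
    show "order (G\<lparr>carrier := P\<rparr>) = p ^ k"
      using P(2) by (simp add: order_def)
    show "f g C \<in> ?E" if "g \<in> carrier (G\<lparr>carrier := P\<rparr>)" "C \<in> ?E" for g C
      using that PD by (auto simp: f_coset)
    show "f \<one>\<^bsub>G\<lparr>carrier := P\<rparr>\<^esub> C = C" if "C \<in> ?E" for C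
      using that by (auto simp: f_coset)
    show "f (g \<otimes>\<^bsub>G\<lparr>carrier := P\<rparr>\<^esub> h) C = f g (f h C)"
      if "g \<in> carrier (G\<lparr>carrier := P\<rparr>)" "h \<in> carrier (G\<lparr>carrier := P\<rparr>)" "C \<in> ?E" for g h C
      using that PD by (auto simp: f_coset inv_mult_group m_assoc)
  qed (use finD p in auto)
  moreover have "p dvd card ?E"
  proof -
    have "rcosets\<^bsub>G\<lparr>carrier := D\<rparr>\<^esub> Z = ?E"
      by (auto simp: RCOSETS_def)
    moreover have "subgroup Z (G\<lparr>carrier := D\<rparr>)"
      using Z D(1) by (intro subgroup_incl) auto
    ultimately have card: "card ?E * card Z = p ^ m"
      using group.lagrange[OF subgroup_imp_group[OF D(1)]] D(2) by (fastforce simp: order_def)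
    moreover have "card Z < p ^ m"
      using psubset_card_mono[OF finD Z(2)] D(2) by simp
    ultimately have "card ?E \<noteq> 1" "card ?E dvd p ^ m"
      by (auto simp flip: card)
    then show ?thesis
      using divides_primepow_nat[OF p] by (metis dvd_power gr0I power_0)
  qed
  ultimately have dvdF: "p dvd card {C \<in> ?E. \<forall>g \<in> P. f g C = C}" (is "_ dvd card ?F")
    using cong_dvd_iff by fastforce
  have "Z \<in> ?F"
    using f_coset[OF _ D.one_closed] by (auto intro!: image_eqI[of _ _ \<one>] simp: Z.subset)
  have "?F \<noteq> {Z}"
    using dvdF p by (auto dest: prime_gt_1_nat)
  then obtain d where d: "d \<in> D" "\<forall>g \<in> P. f g (Z #> d) = Z #> d" "Z #> d \<noteq> Z"
    using \<open>Z \<in> ?F\<close> by blast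
  have "d \<notin> Z"
    using d(3) Z(1) by (metis Z.rcos_const is_group)
  moreover have "commutator g d \<in> Z" if "g \<in> P" for g
  proof -
    have "g \<otimes> d \<otimes> inv g \<in> Z #> d"
      using d that f_coset by (metis D.mem_carrier P.mem_carrier Z(1) inv_closed m_closed rcos_self)
    then show ?thesis
      using Z.rcos_module_imp[OF is_group] d(1) by simp
  qed
  ultimately show ?thesis
    using d(1) by blast
qed

section \<open>Powers of products in nilpotency class two\<close>

lemma (in group) power_swap_class_two:
  assumes "a \<in> carrier G" "b \<in> carrier G" "c \<in> carrier G"
    and "b \<otimes> a = c \<otimes> (a \<otimes> b)" "c \<otimes> b = b \<otimes> c"
  shows "b [^] (k::nat) \<otimes> a = c [^] k \<otimes> (a \<otimes> b [^] k)"
proof (induction k)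
  case (Suc k)
  have "b [^] Suc k \<otimes> a = b [^] k \<otimes> c \<otimes> (a \<otimes> b)"
    using assms(1-4) by (simp add: m_assoc)
  also have "b [^] k \<otimes> c = c \<otimes> b [^] k"
    using assms by (metis group_commutes_pow)
  also have "c \<otimes> b [^] k \<otimes> (a \<otimes> b) = c \<otimes> (b [^] k \<otimes> a) \<otimes> b"
    using assms(1-3) by (simp add: m_assoc)
  also have "\<dots> = (c \<otimes> c [^] k) \<otimes> (a \<otimes> b [^] Suc k)"
    using assms(1-3) by (simp add: Suc.IH m_assoc)
  finally show ?case
    by (simp only: nat_pow_Suc2[OF assms(3)])
qed (use assms in simp)

text \<open>Collecting the factors \<open>a\<close> on the left moves the (i+1)-st \<open>a\<close>
  past i copies of \<open>b\<close> at the price of \<open>c [^] i\<close>; these exponents add up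
  to \<open>n choose 2\<close>.\<close>

lemma (in group) power_mult_class_two:
  assumes "a \<in> carrier G" "b \<in> carrier G" "c \<in> carrier G"
    and "b \<otimes> a = c \<otimes> (a \<otimes> b)" "c \<otimes> a = a \<otimes> c" "c \<otimes> b = b \<otimes> c"
  shows "(a \<otimes> b) [^] (n::nat) = c [^] (n choose 2) \<otimes> (a [^] n \<otimes> b [^] n)"
proof (induction n)
  case (Suc n)
  have ca: "c [^] (k::nat) \<otimes> a [^] (l::nat) = a [^] l \<otimes> c [^] k" for k l
    using assms by (metis group_commutes_pow nat_pow_closed)
  have "(a \<otimes> b) [^] Suc n = c [^] (n choose 2) \<otimes> (a [^] n \<otimes> (b [^] n \<otimes> a) \<otimes> b)"
    using assms(1-3) by (simp add: Suc.IH m_assoc)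
  also have "a [^] n \<otimes> (b [^] n \<otimes> a) = c [^] n \<otimes> (a [^] Suc n \<otimes> b [^] n)"
    using assms(1-3) ca[of n n] by (simp add: power_swap_class_two[OF assms(1-4,6)] m_assoc[symmetric])
  also have "c [^] (n choose 2) \<otimes> (c [^] n \<otimes> (a [^] Suc n \<otimes> b [^] n) \<otimes> b)
      = c [^] (Suc n choose 2) \<otimes> (a [^] Suc n \<otimes> b [^] Suc n)"
    using assms(1-3) by (simp add: m_assoc[symmetric] nat_pow_mult numeral_2_eq_2 add.commute)
  finally show ?case .
qed (simp add: numeral_2_eq_2)

text \<open>Iterating \<open>h\<close> moves \<open>d\<close> to \<open>c\<^sup>i \<otimes> d\<close>, where \<open>c\<close> is the commutator; at \<open>i = ord h\<close> this
  gives \<open>c\<^sup>i = 1\<close>.\<close>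

lemma (in group) coprime_commutator_trivial:
  assumes "h \<in> carrier G" "d \<in> carrier G" "coprime (ord h) p"
    and comm: "h \<otimes> commutator h d = commutator h d \<otimes> h" and pow: "commutator h d [^] (p ^ n :: nat) = \<one>"
  shows "h \<otimes> d = d \<otimes> h"
proof -
  define c where "c = commutator h d"
  have c: "c \<in> carrier G"
    using assms by (simp add: c_def)
  have hd: "h \<otimes> d = c \<otimes> (d \<otimes> h)"
    using assms(1,2) by (simp add: c_def m_assoc)
  have "h [^] (i::nat) \<otimes> d = c [^] i \<otimes> (d \<otimes> h [^] i)" for i
  proof (induction i)
    case (Suc i)
    have "h [^] Suc i \<otimes> d = h \<otimes> (h [^] i \<otimes> d)"
      using assms(1,2) by (simp only: nat_pow_Suc2) (simp add: m_assoc)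
    also have "\<dots> = h \<otimes> c [^] i \<otimes> (d \<otimes> h [^] i)"
      using assms(1,2) c by (simp add: Suc.IH m_assoc)
    also have "h \<otimes> c [^] i = c [^] i \<otimes> h"
      using group_commutes_pow[of c h i] comm c assms(1) by (simp add: c_def)
    also have "c [^] i \<otimes> h \<otimes> (d \<otimes> h [^] i) = c [^] i \<otimes> (h \<otimes> d) \<otimes> h [^] i"
      using assms(1,2) c by (simp add: m_assoc)
    also have "\<dots> = c [^] Suc i \<otimes> (d \<otimes> (h \<otimes> h [^] i))"
      unfolding hd using assms(1,2) c by (simp add: m_assoc)
    finally show ?case
      by (simp only: nat_pow_Suc2[OF assms(1)])
  qed (use assms in simp)
  from this[of "ord h"] have "c [^] ord h = \<one>"
    using assms(1,2) c by simp
  then have "ord c dvd ord h" "ord c dvd p ^ n"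
    using c pow by (simp_all add: pow_eq_id c_def)
  then have "ord c = 1"
    using coprime_divisors[of "ord c" "ord h" "ord c" "p ^ n"] assms(3) by simp
  then show ?thesis
    using c assms(1,2) ord_eq_1 commutator_eq_one_iff by (simp add: c_def)
qed

text \<open>This is the preimage in \<open>D\<close> of the centralizer of the image of
  \<open>S\<close> modulo \<open>Z\<close>. \<open>S\<close> is any conjugation-invariant set, so a
  coset of a normal subgroup can be inserted as well as a normal subgroup.\<close>

lemma (in group) normal_commutator_preimage:
  assumes "D \<lhd> G" "Z \<lhd> G" "S \<subseteq> carrier G"
    and S: "\<And>g s. \<lbrakk>g \<in> carrier G; s \<in> S\<rbrakk> \<Longrightarrow> g \<otimes> s \<otimes> inv g \<in> S"
  shows "{d \<in> D. \<forall>s \<in> S. commutator s d \<in> Z} \<lhd> G" (is "?C \<lhd> G")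
proof -
  interpret D: normal D G by fact
  interpret Z: normal Z G by fact
  have S_carrier: "s \<in> carrier G" if "s \<in> S" for s
    using that assms(3) by blast
  have "subgroup ?C G"
  proof (rule subgroupI)
    fix d e assume d: "d \<in> ?C" and e: "e \<in> ?C"
    have "commutator s (d \<otimes> e) \<in> Z" if "s \<in> S" for s
    proof -
      have "commutator s (d \<otimes> e) = commutator s d \<otimes> (d \<otimes> commutator s e \<otimes> inv d)"
        using d e that S_carrier by (simp add: m_assoc inv_mult_group)
      then show ?thesis
        using d e that Z.inv_op_closed2 by auto
    qed
    with d e show "d \<otimes> e \<in> ?C"
      by auto
  next
    fix d assume d: "d \<in> ?C"
    have "commutator s (inv d) \<in> Z" if "s \<in> S" for s
    proof -
      have "commutator s (inv d) = inv d \<otimes> inv (commutator s d) \<otimes> d"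
        using d that S_carrier by (simp add: m_assoc inv_mult_group)
      then show ?thesis
        using d that Z.inv_op_closed1 by auto
    qed
    with d show "inv d \<in> ?C"
      by auto
  next
    have "\<one> \<in> ?C"
      using S_carrier by simp
    then show "?C \<noteq> {}" by blast
  qed (use D.subset in auto)
  moreover have "g \<otimes> d \<otimes> inv g \<in> ?C" if g: "g \<in> carrier G" and d: "d \<in> ?C" for g d
  proof -
    have "commutator s (g \<otimes> d \<otimes> inv g) \<in> Z" if s: "s \<in> S" for s
    proof -
      have "commutator s (g \<otimes> d \<otimes> inv g) = g \<otimes> commutator (inv g \<otimes> s \<otimes> inv (inv g)) d \<otimes> inv g"
        using d g s S_carrier by (simp add: m_assoc inv_mult_group)
      moreover have "commutator (inv g \<otimes> s \<otimes> inv (inv g)) d \<in> Z"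
        using d S[of "inv g" s] g s by blast
      ultimately show ?thesis
        using g Z.inv_op_closed2 by auto
    qed
    with d g show ?thesis
      using D.inv_op_closed2 by auto
  qed
  ultimately show ?thesis
    by (simp add: normal_inv_iff)
qed

section \<open>Critical pairs for coprime actions\<close>

lemma (in group) card_subgroup_prime_power:
  assumes "finite (carrier G)" "prime p" "subgroup P G" "card P = p ^ n" "subgroup D G" "D \<subseteq> P"
  obtains m where "card D = p ^ m"
proof -
  have "subgroup D (G\<lparr>carrier := P\<rparr>)"
    using assms by (intro subgroup_incl)
  from group.lagrange[OF subgroup_imp_group[OF assms(3)] this]
  have "card (rcosets\<^bsub>G\<lparr>carrier := P\<rparr>\<^esub> D) * card D = card P"
    by (simp add: order_def)
  then have "card D dvd card P"
    by (metis dvd_triv_right)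
  then show ?thesis
    using that assms(2,4) divides_primepow_nat by auto
qed

lemma (in group) subgroup_nat_pow_closed:
  assumes "subgroup H G" "x \<in> H"
  shows "x [^] (n::nat) \<in> H"
  using assms by (induction n) (auto simp: subgroup.one_closed subgroup.m_closed)

lemma (in group) pow_card_subgroup:
  assumes "subgroup P G" "x \<in> P"
  shows "x [^] card P = \<one>"
  using group.pow_order_eq_1[OF subgroup_imp_group[OF assms(1)], of x] assms(2)
  by (simp add: order_def nat_pow_consistent[symmetric])

lemma (in group) conj_nat_pow:
  assumes "g \<in> carrier G" "x \<in> carrier G"
  shows "(g \<otimes> x \<otimes> inv g) [^] (n::nat) = g \<otimes> x [^] n \<otimes> inv g"
  using assms by (induction n) (simp_all add: m_assoc)

text \<open>A minimal normal subgroup \<open>D\<close> of \<open>G\<close> inside \<open>P\<close> not centralized by \<open>h\<close>, with a chief factor \<open>D / Z\<close>. It plays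
  the role of a Thompson critical subgroup; the centrality of \<open>Z\<close> is the three subgroups lemma.\<close>

lemma (in group) coprime_critical_pair:
  assumes fin: "finite (carrier G)" and p: "prime p"
    and P: "P \<lhd> G" "card P = p ^ n"
    and h: "h \<in> carrier G" "coprime (ord h) p"
    and nc: "\<exists>x \<in> P. h \<otimes> x \<noteq> x \<otimes> h"
  shows "\<exists>D Z. D \<lhd> G \<and> Z \<lhd> G \<and> D \<subseteq> P \<and> Z \<subset> D \<and> (\<exists>d \<in> D. h \<otimes> d \<noteq> d \<otimes> h) \<and>
    (\<forall>M. M \<lhd> G \<and> Z \<subseteq> M \<and> M \<subseteq> D \<longrightarrow> M = Z \<or> M = D) \<and>
    (\<forall>M. M \<lhd> G \<and> M \<subset> D \<longrightarrow> (\<forall>z \<in> M. h \<otimes> z = z \<otimes> h)) \<and>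
    (\<forall>z \<in> Z. \<forall>d \<in> D. z \<otimes> d = d \<otimes> z) \<and>
    (\<forall>g \<in> P. \<forall>d \<in> D. commutator g d \<in> Z) \<and>
    (\<forall>d \<in> D. d [^] p \<in> Z)"
proof -
  interpret P: normal P G by fact
  have Psub: "subgroup P G" by unfold_locales
  have finP: "finite P"
    using fin P.subset finite_subset by blast
  define cand where "cand D \<longleftrightarrow> D \<lhd> G \<and> D \<subseteq> P \<and> (\<exists>d \<in> D. h \<otimes> d \<noteq> d \<otimes> h)" for D
  have "cand P"
    using P nc by (simp add: cand_def)
  \<comment> \<open>Least order forces \<open>h\<close> to centralize every normal subgroup of
    \<open>G\<close> properly contained in \<open>D\<close>; this is \<open>min\<close>
    below.\<close>
  then obtain D where D: "cand D" "\<And>M. cand M \<Longrightarrow> card D \<le> card M"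
    using ex_has_least_nat[of cand P card] by blast
  have DP: "D \<lhd> G" "D \<subseteq> P" "\<exists>d \<in> D. h \<otimes> d \<noteq> d \<otimes> h"
    using D(1) by (auto simp: cand_def)
  interpret D: normal D G by (rule DP(1))
  have finD: "finite D"
    using finP DP(2) finite_subset by blast
  have min: "h \<otimes> z = z \<otimes> h" if "M \<lhd> G" "M \<subset> D" "z \<in> M" for M z
  proof (rule ccontr)
    assume "h \<otimes> z \<noteq> z \<otimes> h"
    then have "cand M"
      using that DP(2) by (auto simp: cand_def)
    then show False
      using D(2) psubset_card_mono[OF finD that(2)] by fastforce
  qed
  have comm_D: "commutator h d \<in> D" if "d \<in> D" for d
    using D.inv_op_closed2[OF h(1) that] that by simp
  have powD: "d [^] (p ^ n) = \<one>" if "d \<in> D" for d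
    using that DP(2) pow_card_subgroup[OF Psub, of d] P(2) by auto
  \<comment> \<open>Since \<open>h\<close> centralizes \<open>M\<close>, so does [h, D]. If the
    centralizer of \<open>M\<close> in \<open>D\<close> were proper, \<open>h\<close> would
    centralize [h, D] and, by coprimality, \<open>D\<close> itself.\<close>
  have central: "z \<otimes> d = d \<otimes> z" if M: "M \<lhd> G" "M \<subset> D" and "z \<in> M" "d \<in> D" for M z d
  proof -
    interpret M: normal M G by (rule M(1))
    let ?C = "{d \<in> D. \<forall>s \<in> M. commutator s d \<in> {\<one>}}"
    have C: "?C \<lhd> G"
      using M.inv_op_closed2 by (intro normal_commutator_preimage DP(1) one_is_normal M.subset)
    have comm_C: "commutator h d \<in> ?C" if d: "d \<in> D" for d
    proof -
      have "s \<otimes> commutator h d = commutator h d \<otimes> s" if s: "s \<in> M" for s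
      proof -
        have s': "inv d \<otimes> s \<otimes> d \<in> M"
          using M.inv_op_closed1[of d s] d s by simp
        have carr: "d \<in> carrier G" "s \<in> carrier G"
          using d s by auto
        have "s \<otimes> commutator h d = s \<otimes> h \<otimes> d \<otimes> inv h \<otimes> inv d"
          using carr h(1) by (simp add: m_assoc)
        also have "s \<otimes> h = h \<otimes> s"
          using min[OF M s] by simp
        also have "h \<otimes> s \<otimes> d \<otimes> inv h \<otimes> inv d = h \<otimes> d \<otimes> (inv d \<otimes> s \<otimes> d) \<otimes> inv h \<otimes> inv d"
          using carr h(1) by (simp add: m_assoc)
        also have "\<dots> = h \<otimes> d \<otimes> inv h \<otimes> (h \<otimes> (inv d \<otimes> s \<otimes> d) \<otimes> inv h) \<otimes> inv d"
          using carr h(1) by (simp add: m_assoc)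
        also have "h \<otimes> (inv d \<otimes> s \<otimes> d) \<otimes> inv h = inv d \<otimes> s \<otimes> d"
          unfolding min[OF M s'] using carr h(1) by (simp add: m_assoc)
        finally show ?thesis
          using carr h(1) by (simp add: m_assoc)
      qed
      then have "commutator s (commutator h d) = \<one>" if "s \<in> M" for s
        using that h(1) d commutator_eq_one_iff[of s "commutator h d"] by simp
      then show ?thesis
        using comm_D[OF d] by simp
    qed
    have "?C = D"
    proof (rule ccontr)
      assume "?C \<noteq> D"
      then have "?C \<subset> D" by blast
      have "h \<otimes> d = d \<otimes> h" if d: "d \<in> D" for d
      proof (rule coprime_commutator_trivial[OF h(1) _ h(2)])
        show "h \<otimes> commutator h d = commutator h d \<otimes> h"
          using min[OF C \<open>?C \<subset> D\<close> comm_C[OF d]] .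
        show "commutator h d [^] (p ^ n) = \<one>"
          by (rule powD[OF comm_D[OF d]])
      qed (use d in auto)
      with DP(3) show False by blast
    qed
    with \<open>d \<in> D\<close> \<open>z \<in> M\<close> have "commutator z d = \<one>"
      by blast
    then show ?thesis
      using \<open>d \<in> D\<close> \<open>z \<in> M\<close> commutator_eq_one_iff[of z d] by simp
  qed
  have "\<one> \<in> D" "D \<noteq> {\<one>}"
    using DP(3) h(1) by auto
  then have "{\<one>} \<lhd> G \<and> {\<one>} \<subset> D"
    using one_is_normal by blast
  moreover have "\<forall>M. M \<lhd> G \<and> M \<subset> D \<longrightarrow> card M < card D"
    using psubset_card_mono[OF finD] by blast
  ultimately have "\<exists>Z. (Z \<lhd> G \<and> Z \<subset> D) \<and> (\<forall>M. M \<lhd> G \<and> M \<subset> D \<longrightarrow> card M \<le> card Z)"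
    by (rule ex_has_greatest_nat[where f = card])
  then obtain Z where Z: "Z \<lhd> G" "Z \<subset> D"
    and Zmax: "\<And>M. M \<lhd> G \<and> M \<subset> D \<Longrightarrow> card M \<le> card Z"
    by blast
  interpret Z: normal Z G by (rule Z(1))
  have max: "M = Z \<or> M = D" if "M \<lhd> G" "Z \<subseteq> M" "M \<subseteq> D" for M
  proof (cases "M = D")
    case False
    then show ?thesis
      using that Zmax[of M] card_seteq[of M Z] finD finite_subset by blast
  qed simp
  have PD: "commutator g d \<in> Z" if "g \<in> P" "d \<in> D" for g d
  proof -
    \<comment> \<open>The preimage of the fixed points of \<open>P\<close> on \<open>D / Z\<close>
      is strictly larger than \<open>Z\<close>, hence equal to \<open>D\<close> by the maximality of
      \<open>Z\<close>.\<close>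
    let ?F = "{d \<in> D. \<forall>s \<in> P. commutator s d \<in> Z}"
    have F: "?F \<lhd> G"
      using P.inv_op_closed2 by (intro normal_commutator_preimage DP(1) Z(1) P.subset)
    moreover have "Z \<subseteq> ?F"
    proof
      fix z assume z: "z \<in> Z"
      have "commutator s z \<in> Z" if "s \<in> P" for s
        using Z.inv_op_closed2[of s z] z that by simp
      with z Z(2) show "z \<in> ?F" by blast
    qed
    moreover have "?F \<noteq> Z"
    proof -
      obtain m where m: "card D = p ^ m"
        using card_subgroup_prime_power[OF fin p Psub P(2) D.subgroup_axioms DP(2)] by blast
      have "\<exists>d \<in> D - Z. \<forall>g \<in> P. commutator g d \<in> Z"
        by (rule p_subgroup_fixes_coset[OF fin p Psub P(2) D.subgroup_axioms m Z.subgroup_axioms Z(2)])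
          (simp_all add: D.inv_op_closed2 Z.inv_op_closed2)
      then show ?thesis by blast
    qed
    ultimately have "?F = D"
      using max[of ?F] by blast
    with that show ?thesis by blast
  qed
  have powZ: "d [^] p \<in> Z" if "d \<in> D" for d
  proof -
    \<comment> \<open>The elements of exponent \<open>p\<close> modulo \<open>Z\<close> form a
      subgroup by the class two formula, which exceeds \<open>Z\<close> because \<open>D / Z\<close>
      is a nontrivial \<open>p\<close>-group.\<close>
    let ?E = "{d \<in> D. d [^] p \<in> Z}"
    have "subgroup ?E G"
    proof (rule subgroupI)
      fix a b assume a: "a \<in> ?E" and b: "b \<in> ?E"
      have comm: "commutator b a \<in> Z"
        using PD[of b a] a b DP(2) by blast
      have "(a \<otimes> b) [^] p = commutator b a [^] (p choose 2) \<otimes> (a [^] p \<otimes> b [^] p)"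
      proof (rule power_mult_class_two)
        show "b \<otimes> a = commutator b a \<otimes> (a \<otimes> b)"
          using a b by (simp add: m_assoc)
      qed (use a b central[OF Z comm] in auto)
      moreover have "commutator b a [^] (p choose 2) \<in> Z"
        using comm by (rule subgroup_nat_pow_closed[OF Z.subgroup_axioms])
      ultimately show "a \<otimes> b \<in> ?E"
        using a b by simp
    next
      have "\<one> \<in> ?E" by simp
      then show "?E \<noteq> {}" by blast
    qed (use D.subset in \<open>auto simp: nat_pow_inv\<close>)
    moreover have "g \<otimes> d \<otimes> inv g \<in> ?E" if "g \<in> carrier G" "d \<in> ?E" for g d
      using that D.inv_op_closed2[of g d] Z.inv_op_closed2[of g "d [^] p"] by (simp add: conj_nat_pow)
    ultimately have "?E \<lhd> G"
      by (simp add: normal_inv_iff)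
    moreover have "Z \<subseteq> ?E"
      using Z(2) subgroup_nat_pow_closed[OF Z.subgroup_axioms] by blast
    moreover have "?E \<noteq> Z"
    proof -
      obtain d where d: "d \<in> D" "d \<notin> Z"
        using Z(2) by blast
      define i where "i = (LEAST i. d [^] (p ^ i) \<in> Z)"
      have i: "d [^] (p ^ i) \<in> Z"
        unfolding i_def using powD[OF d(1)] by (intro LeastI[of "\<lambda>i. d [^] (p ^ i) \<in> Z" n]) simp
      have "i \<noteq> 0"
      proof
        assume "i = 0"
        with i d show False by simp
      qed
      then obtain j where j: "i = Suc j"
        using not0_implies_Suc by blast
      then have "d [^] (p ^ j) \<notin> Z"
        using not_less_Least[of j "\<lambda>i. d [^] (p ^ i) \<in> Z"] i_def by simp
      moreover have "(d [^] (p ^ j)) [^] p \<in> Z"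
        using i j d(1) by (simp add: nat_pow_pow mult.commute)
      moreover have "d [^] (p ^ j) \<in> D"
        using d(1) by (rule subgroup_nat_pow_closed[OF D.subgroup_axioms])
      ultimately show ?thesis by blast
    qed
    ultimately have "?E = D"
      using max[of ?E] by blast
    with that show ?thesis by blast
  qed
  have "\<forall>M. M \<lhd> G \<and> Z \<subseteq> M \<and> M \<subseteq> D \<longrightarrow> M = Z \<or> M = D"
    using max by blast
  moreover have "\<forall>M. M \<lhd> G \<and> M \<subset> D \<longrightarrow> (\<forall>z \<in> M. h \<otimes> z = z \<otimes> h)"
    using min by blast
  moreover have "\<forall>z \<in> Z. \<forall>d \<in> D. z \<otimes> d = d \<otimes> z"
    using central[OF Z] by blast
  moreover have "\<forall>g \<in> P. \<forall>d \<in> D. commutator g d \<in> Z" "\<forall>d \<in> D. d [^] p \<in> Z"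
    using PD powZ by blast+
  ultimately show ?thesis
    using DP Z by - (rule exI[of _ D], rule exI[of _ Z], intro conjI)
qed

section \<open>Coprime actions detected on elements of order \<open>p\<close>\<close>

lemma (in group) subgroup_set_stabilizer:
  assumes "subgroup R G"
  defines "N \<equiv> {g \<in> carrier G. (\<lambda>r. g \<otimes> r \<otimes> inv g) ` R = R}"
  shows "subgroup N G" "R \<lhd> G\<lparr>carrier := N\<rparr>"
proof -
  interpret R: subgroup R G by fact
  have RC: "r \<in> carrier G" if "r \<in> R" for r
    using that by auto
  show N: "subgroup N G"
  proof (rule subgroupI)
    fix g h assume g: "g \<in> N" and h: "h \<in> N"
    then have carr: "g \<in> carrier G" "h \<in> carrier G"
      by (auto simp: N_def)
    then have "(\<lambda>r. g \<otimes> h \<otimes> r \<otimes> inv (g \<otimes> h)) ` R = (\<lambda>r. g \<otimes> r \<otimes> inv g) ` (\<lambda>r. h \<otimes> r \<otimes> inv h) ` R"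
      unfolding image_image by (intro image_cong) (simp_all add: m_assoc inv_mult_group)
    with g h carr show "g \<otimes> h \<in> N"
      by (simp add: N_def)
  next
    fix g assume g: "g \<in> N"
    then have "(\<lambda>r. inv g \<otimes> r \<otimes> inv (inv g)) ` (\<lambda>r. g \<otimes> r \<otimes> inv g) ` R = (\<lambda>r. r) ` R"
      unfolding image_image by (intro image_cong) (simp_all add: N_def m_assoc)
    with g show "inv g \<in> N"
      by (simp add: N_def)
  next
    have "(\<lambda>r. \<one> \<otimes> r \<otimes> inv \<one>) ` R = R"
      by simp
    then show "N \<noteq> {}"
      unfolding N_def by blast
  qed (auto simp: N_def)
  have "r \<in> N" if r: "r \<in> R" for r
  proof -
    have "s \<in> (\<lambda>s. r \<otimes> s \<otimes> inv r) ` R" if "s \<in> R" for s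
      using r that by (intro image_eqI[of _ _ "inv r \<otimes> s \<otimes> r"]) (simp_all add: m_assoc)
    then show ?thesis
      using r by (auto simp: N_def)
  qed
  then have "subgroup R (G\<lparr>carrier := N\<rparr>)"
    using N R.subgroup_axioms by (intro subgroup_incl) auto
  moreover have "g \<otimes> r \<otimes> inv g \<in> R" if "g \<in> N" "r \<in> R" for g r
    using that by (auto simp: N_def)
  ultimately show "R \<lhd> G\<lparr>carrier := N\<rparr>"
    using N by (simp add: group.normal_inv_iff[OF subgroup_imp_group[OF N]])
qed

text \<open>In a critical pair, \<open>D\<close> has class at most two and its \<open>p\<close>-th
  powers lie in \<open>Z\<close>, which \<open>h\<close> centralizes. For odd \<open>p\<close> the
  class two formula makes the \<open>p\<close>-th power of [h, d] trivial, so \<open>h\<close>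
  commutes with [h, d] and, by coprimality, with \<open>d\<close>.\<close>

lemma (in group) coprime_centralizes_normal_p_subgroup:
  assumes fin: "finite (carrier G)" and p: "prime p" "p > 2"
    and P: "P \<lhd> G" "card P = p ^ n"
    and h: "h \<in> carrier G" "coprime (ord h) p"
    and om: "\<And>y. \<lbrakk>y \<in> P; y [^] p = \<one>\<rbrakk> \<Longrightarrow> h \<otimes> y = y \<otimes> h"
    and x: "x \<in> P"
  shows "h \<otimes> x = x \<otimes> h"
proof (rule ccontr)
  assume "h \<otimes> x \<noteq> x \<otimes> h"
  with x have "\<exists>x \<in> P. h \<otimes> x \<noteq> x \<otimes> h" by blast
  from coprime_critical_pair[OF fin p(1) P h this] obtain D Z where
    D: "D \<lhd> G" and Z: "Z \<lhd> G" and DP: "D \<subseteq> P" and ZD: "Z \<subset> D"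
    and nc: "\<exists>d \<in> D. h \<otimes> d \<noteq> d \<otimes> h"
    and min: "\<forall>M. M \<lhd> G \<and> M \<subset> D \<longrightarrow> (\<forall>z \<in> M. h \<otimes> z = z \<otimes> h)"
    and central: "\<forall>z \<in> Z. \<forall>d \<in> D. z \<otimes> d = d \<otimes> z"
    and PD: "\<forall>g \<in> P. \<forall>d \<in> D. commutator g d \<in> Z"
    and powZ: "\<forall>d \<in> D. d [^] p \<in> Z"
    by (elim exE conjE) simp
  interpret D: normal D G by (rule D)
  interpret Z: normal Z G by (rule Z)
  have "h \<otimes> d = d \<otimes> h" if d: "d \<in> D" for d
  proof -
    define a where "a = h \<otimes> d \<otimes> inv h"
    define b where "b = inv d"
    define e where "e = commutator b a"
    have ab: "a \<in> D" "b \<in> D"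
      using D.inv_op_closed2[OF h(1) d] d by (auto simp: a_def b_def)
    have carr: "a \<in> carrier G" "b \<in> carrier G" "d \<in> carrier G"
      using ab d by auto
    have e: "e \<in> Z"
      unfolding e_def using PD ab DP by blast
    have eab: "e \<otimes> a = a \<otimes> e" "e \<otimes> b = b \<otimes> e"
      using central e ab by auto
    have ba: "b \<otimes> a = e \<otimes> (a \<otimes> b)"
      using carr by (simp add: e_def m_assoc)
    have e_carr: "e \<in> carrier G"
      using e by simp
    \<comment> \<open>\<open>b [^] p\<close> lies in \<open>Z\<close> and so commutes with
      \<open>a\<close>, which forces \<open>e [^] p = \<one>\<close>. As \<open>p\<close> divides
      \<open>p choose 2\<close>, the correction term in the power formula vanishes.\<close>
    have "e [^] p \<otimes> (a \<otimes> b [^] p) = \<one> \<otimes> (a \<otimes> b [^] p)"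
      using power_swap_class_two[OF carr(1,2) e_carr ba eab(2), of p] central powZ ab carr
      by simp
    then have "e [^] p = \<one>"
      using right_cancel[of "e [^] p" \<one> "a \<otimes> b [^] p"] carr e_carr by simp
    then have "e [^] (p choose 2) = \<one>"
      using dvd_choose_prime[of 2 p] p e_carr pow_eq_id dvd_trans by simp blast
    moreover have "a [^] p = d [^] p"
    proof -
      have "a [^] p = h \<otimes> d [^] p \<otimes> inv h"
        unfolding a_def using h(1) carr by (intro conj_nat_pow)
      also have "h \<otimes> d [^] p = d [^] p \<otimes> h"
        using min Z ZD powZ d by blast
      finally show ?thesis
        using h(1) carr by (simp add: m_assoc)
    qed
    moreover have "b [^] p = inv (d [^] p)"
      using carr by (simp add: b_def nat_pow_inv)
    ultimately have "(a \<otimes> b) [^] p = \<one>"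
      using power_mult_class_two[OF carr(1,2) e_carr ba eab, of p] carr by simp
    moreover have "commutator h d = a \<otimes> b"
      by (simp add: a_def b_def)
    moreover have "a \<otimes> b \<in> P"
      using ab DP by blast
    ultimately show ?thesis
      using om[of "a \<otimes> b"] h carr by (intro coprime_commutator_trivial[of h d p 1]) auto
  qed
  with nc show False by blast
qed

text \<open>Raising \<open>h\<close> to the \<open>p\<close>-part of its order leaves an element of
  order prime to \<open>p\<close> that still centralizes whatever \<open>h\<close> centralizes. The
  coprime case applies to it inside the normalizer of \<open>R\<close>, where \<open>R\<close> is
  normal.\<close>

lemma (in group) power_centralizes_p_subgroup:
  assumes fin: "finite (carrier G)" and p: "prime p" "p > 2"
    and R: "subgroup R G" "card R = p ^ n"
    and h: "h \<in> carrier G"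
    and hR: "\<And>r. r \<in> R \<Longrightarrow> h \<otimes> r \<otimes> inv h \<in> R"
    and om: "\<And>y. \<lbrakk>y \<in> R; y [^] p = \<one>\<rbrakk> \<Longrightarrow> h \<otimes> y = y \<otimes> h"
  shows "\<exists>k. \<forall>r \<in> R. h [^] (p ^ k :: nat) \<otimes> r = r \<otimes> h [^] (p ^ k)"
proof -
  interpret R: subgroup R G by fact
  define N where "N = {g \<in> carrier G. (\<lambda>r. g \<otimes> r \<otimes> inv g) ` R = R}"
  have N: "subgroup N G" "R \<lhd> G\<lparr>carrier := N\<rparr>"
    unfolding N_def using subgroup_set_stabilizer[OF R(1)] by auto
  have "inj_on (\<lambda>r. h \<otimes> r \<otimes> inv h) R"
    using h by (auto intro!: inj_onI)
  moreover have "(\<lambda>r. h \<otimes> r \<otimes> inv h) ` R \<subseteq> R"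
    using hR by blast
  moreover have "finite R"
    using fin R.subset finite_subset by blast
  ultimately have hN: "h \<in> N"
    using h endo_inj_surj unfolding N_def by blast
  have "ord h \<noteq> 0"
    using ord_ge_1[OF fin h] by simp
  then obtain k m where km: "ord h = p ^ k * m" "\<not> p dvd m"
    using prime_power_canonical[OF p(1), of "ord h"] by (auto simp: mult.commute)
  define g where "g = h [^] (p ^ k)"
  have g: "g \<in> carrier G" "g \<in> N"
    using h hN subgroup_nat_pow_closed[OF N(1)] by (auto simp: g_def)
  interpret N: group "G\<lparr>carrier := N\<rparr>"
    using N(1) by (rule subgroup_imp_group)
  have "g [^]\<^bsub>G\<lparr>carrier := N\<rparr>\<^esub> m = \<one>\<^bsub>G\<lparr>carrier := N\<rparr>\<^esub>"
    using h pow_ord_eq_1[OF h] by (simp add: g_def nat_pow_pow km(1) nat_pow_consistent[symmetric])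
  then have "N.ord g dvd m"
    using N.pow_eq_id[of g m] g by simp
  then have cop: "coprime (N.ord g) p"
    using km(2) p(1) by (metis coprime_commute dvd_trans prime_imp_coprime)
  have gy: "g \<otimes> y = y \<otimes> g" if "h \<otimes> y = y \<otimes> h" "y \<in> carrier G" for y
    using that h by (simp add: g_def group_commutes_pow)
  have "g \<otimes>\<^bsub>G\<lparr>carrier := N\<rparr>\<^esub> r = r \<otimes>\<^bsub>G\<lparr>carrier := N\<rparr>\<^esub> g" if "r \<in> R" for r
  proof (rule N.coprime_centralizes_normal_p_subgroup[OF _ p N(2) R(2) _ cop _ that])
    show "finite (carrier (G\<lparr>carrier := N\<rparr>))"
      using fin by (simp add: N_def)
    show "g \<in> carrier (G\<lparr>carrier := N\<rparr>)"
      using g by simp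
    show "g \<otimes>\<^bsub>G\<lparr>carrier := N\<rparr>\<^esub> y = y \<otimes>\<^bsub>G\<lparr>carrier := N\<rparr>\<^esub> g"
      if "y \<in> R" "y [^]\<^bsub>G\<lparr>carrier := N\<rparr>\<^esub> p = \<one>\<^bsub>G\<lparr>carrier := N\<rparr>\<^esub>" for y
    proof -
      have "y [^] p = \<one>"
        using that(2) by (simp add: nat_pow_consistent[symmetric])
      then have "g \<otimes> y = y \<otimes> g"
        using gy om[OF that(1)] that(1) by simp
      then show ?thesis by simp
    qed
  qed
  then show ?thesis
    unfolding g_def by auto
qed

section \<open>Elementary abelian subgroups and unipotent actions\<close>

lemma (in group_hom) card_image_mult_card_kernel:
  assumes "finite (carrier G)"
  shows "card (h ` carrier G) * card (kernel G H h) = order G"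
proof -
  let ?I = "H\<lparr>carrier := h ` carrier G\<rparr>"
  have "group ?I"
    using img_is_subgroup by (rule H.subgroup_imp_group)
  then have "group_hom G ?I h"
    by (simp add: group_hom_def group_hom_axioms_def hom_def)
  then interpret I: group_hom G ?I h .
  have ker: "kernel G ?I h = kernel G H h"
    by (simp add: kernel_def)
  have "G Mod kernel G ?I h \<cong> ?I"
    by (rule I.FactGroup_iso) simp
  then have "card (carrier (G Mod kernel G H h)) = card (h ` carrier G)"
    unfolding ker by (auto dest: iso_same_card)
  then show ?thesis
    using G.lagrange[OF subgroup_kernel] by (simp add: FactGroup_def)
qed

lemma (in group) commutes_inv:
  assumes "x \<in> carrier G" "y \<in> carrier G" "x \<otimes> y = y \<otimes> x"
  shows "x \<otimes> inv y = inv y \<otimes> x"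
proof -
  have "x \<otimes> inv y = inv y \<otimes> (y \<otimes> x) \<otimes> inv y"
    using assms(1,2) by (simp add: m_assoc)
  also have "\<dots> = inv y \<otimes> x"
    unfolding assms(3)[symmetric] using assms(1,2) by (simp add: m_assoc)
  finally show ?thesis .
qed

lemma (in group) commutes_mult:
  assumes "x \<in> carrier G" "y \<in> carrier G" "z \<in> carrier G" "x \<otimes> y = y \<otimes> x" "x \<otimes> z = z \<otimes> x"
  shows "x \<otimes> (y \<otimes> z) = (y \<otimes> z) \<otimes> x"
proof -
  have "x \<otimes> (y \<otimes> z) = (x \<otimes> y) \<otimes> z"
    using assms(1-3) by (simp add: m_assoc)
  also have "\<dots> = y \<otimes> (x \<otimes> z)"
    unfolding assms(4) using assms(1-3) by (simp add: m_assoc)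
  finally show ?thesis
    unfolding assms(5) using assms(1-3) by (simp add: m_assoc)
qed

lemma (in group) commutes_nat_pow:
  "\<lbrakk>x \<in> carrier G; y \<in> carrier G; x \<otimes> y = y \<otimes> x\<rbrakk> \<Longrightarrow> x \<otimes> y [^] (k::nat) = y [^] k \<otimes> x"
  by (metis group_commutes_pow)

lemma (in group) subgroup_centralizer:
  assumes "S \<subseteq> carrier G"
  shows "subgroup {x \<in> carrier G. \<forall>s \<in> S. s \<otimes> x = x \<otimes> s} G" (is "subgroup ?C G")
proof (rule subgroupI)
  have "\<one> \<in> ?C"
    using assms by auto
  then show "?C \<noteq> {}" by blast
next
  fix a assume "a \<in> ?C"
  then show "inv a \<in> ?C"
    using assms commutes_inv[of _ a] by blast
next
  fix a b assume "a \<in> ?C" "b \<in> ?C"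
  then show "a \<otimes> b \<in> ?C"
    using assms commutes_mult[of _ a b] by blast
qed auto

lemma (in group) elementary_abelian_subgroup_iff:
  assumes "subgroup A G"
  shows "elementary_abelian p (G\<lparr>carrier := A\<rparr>) \<longleftrightarrow>
    (\<forall>x \<in> A. \<forall>y \<in> A. x \<otimes> y = y \<otimes> x) \<and> (\<forall>x \<in> A. x [^] p = \<one>)"
proof -
  have "comm_group (G\<lparr>carrier := A\<rparr>) \<longleftrightarrow> (\<forall>x \<in> A. \<forall>y \<in> A. x \<otimes> y = y \<otimes> x)"
    using group.group_comm_groupI[OF subgroup_imp_group[OF assms]] comm_groupE(4)[of "G\<lparr>carrier := A\<rparr>"]
    by fastforce
  then show ?thesis
    by (simp add: elementary_abelian_def nat_pow_consistent[symmetric])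
qed

lemma (in group) ex_power_of_prime_order:
  assumes "x \<in> carrier G" "x \<noteq> \<one>" "x [^] (p ^ n :: nat) = \<one>"
  obtains k :: nat where "x [^] k \<noteq> \<one>" "(x [^] k) [^] p = \<one>"
proof -
  define i where "i = (LEAST i. x [^] (p ^ i) = \<one>)"
  have i: "x [^] (p ^ i) = \<one>"
    unfolding i_def using assms(3) by (intro LeastI[of "\<lambda>i. x [^] (p ^ i) = \<one>" n]) simp
  have "i \<noteq> 0"
  proof
    assume "i = 0"
    with i assms show False by simp
  qed
  then obtain j where j: "i = Suc j"
    using not0_implies_Suc by blast
  then have "x [^] (p ^ j) \<noteq> \<one>"
    using not_less_Least[of j "\<lambda>i. x [^] (p ^ i) = \<one>"] i_def by simp
  moreover have "(x [^] (p ^ j)) [^] p = \<one>"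
    using i j assms(1) by (simp add: nat_pow_pow mult.commute)
  ultimately show thesis
    using that by blast
qed

text \<open>For odd \<open>q\<close> the number (q+1)/2 inverts 2 modulo \<open>q\<close>. This
  provides square roots in groups of odd order, as powers of the given element.\<close>

lemma (in group) odd_exponent_sqrt:
  assumes "x \<in> carrier G" "x [^] (q::nat) = \<one>" "odd q"
  shows "(x \<otimes> x) [^] (Suc q div 2) = x" "x [^] (Suc q div 2) \<otimes> x [^] (Suc q div 2) = x"
proof -
  have q: "Suc q div 2 + Suc q div 2 = Suc q"
    using assms(3) by presburger
  show sq: "x [^] (Suc q div 2) \<otimes> x [^] (Suc q div 2) = x"
    using assms(1,2) by (simp add: nat_pow_mult q)
  show "(x \<otimes> x) [^] (Suc q div 2) = x"
    using assms(1) sq pow_mult_distrib[of x x "Suc q div 2"] by simp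
qed

text \<open>\<open>B\<close> is the direct product of \<open>A\<close> and the cyclic group of
  \<open>y\<close>. The explicit form of its elements is kept because the rank arguments later split
  elements of \<open>B\<close> into components.\<close>

lemma (in group) elementary_abelian_extend:
  assumes p: "prime p" and A: "subgroup A G" "elementary_abelian p (G\<lparr>carrier := A\<rparr>)" "card A = p ^ k"
    and y: "y \<in> carrier G" "y \<notin> A" "y [^] p = \<one>" "\<And>a. a \<in> A \<Longrightarrow> a \<otimes> y = y \<otimes> a"
  shows "\<exists>B. subgroup B G \<and> elementary_abelian p (G\<lparr>carrier := B\<rparr>) \<and> card B = p ^ Suc k \<and>
    (\<forall>b \<in> B. \<exists>a \<in> A. \<exists>i::nat. b = a \<otimes> y [^] i)"
proof -
  interpret A: subgroup A G by fact
  have A_comm: "a \<otimes> b = b \<otimes> a" if "a \<in> A" "b \<in> A" for a b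
    using A(2) that by (simp add: elementary_abelian_subgroup_iff[OF A(1)])
  have A_exp: "a [^] p = \<one>" if "a \<in> A" for a
    using A(2) that by (simp add: elementary_abelian_subgroup_iff[OF A(1)])
  have carr: "a \<in> carrier G" if "a \<in> A" for a
    using that by simp
  have ypow: "a \<otimes> y [^] (i::nat) = y [^] i \<otimes> a" if "a \<in> A" for a i
    using group_commutes_pow[of y a i] y that by simp
  have ymod: "y [^] (i mod p) = y [^] i" for i :: nat
  proof -
    have "y [^] i = y [^] (p * (i div p) + i mod p)"
      by simp
    also have "\<dots> = (y [^] p) [^] (i div p) \<otimes> y [^] (i mod p)"
      using y(1) by (simp only: nat_pow_mult nat_pow_pow)
    finally show ?thesis
      using y by simp
  qed
  \<comment> \<open>An inverse of \<open>i\<close> modulo \<open>p\<close> recovers \<open>y\<close>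
    from \<open>y [^] i\<close>.\<close>
  have inA: "y \<in> A" if "y [^] i \<in> A" "0 < i" "i < p" for i :: nat
  proof -
    have "coprime i p"
      using that p by (metis coprime_commute nat_dvd_not_less prime_imp_coprime)
    then obtain j where "[i * j = 1] (mod p)"
      using cong_solve_coprime_nat by auto
    then have "y [^] (i * j) = y [^] (1::nat)"
      using ymod[of "i * j"] ymod[of 1] by (simp add: cong_def)
    then have "(y [^] i) [^] j = y"
      using y(1) by (simp add: nat_pow_pow)
    then show ?thesis
      using subgroup_nat_pow_closed[OF A(1) that(1), of j] by simp
  qed
  define f where "f = (\<lambda>(a, i::nat). a \<otimes> y [^] i)"
  define B where "B = f ` (A \<times> {..<p})"
  have p0: "p > 0"
    using p prime_gt_0_nat by blast
  have B: "a \<otimes> y [^] i \<in> B" if "a \<in> A" for a and i :: nat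
    unfolding B_def using that p0 by (intro image_eqI[of _ _ "(a, i mod p)"]) (auto simp: f_def ymod)
  have BE: "\<exists>a \<in> A. \<exists>i::nat. b = a \<otimes> y [^] i" if "b \<in> B" for b
    using that by (auto simp: B_def f_def)
  have mult: "a \<otimes> y [^] i \<otimes> (b \<otimes> y [^] j) = (a \<otimes> b) \<otimes> y [^] (i + j)"
    if "a \<in> A" "b \<in> A" for a b and i j :: nat
  proof -
    have "a \<otimes> y [^] i \<otimes> (b \<otimes> y [^] j) = a \<otimes> (y [^] i \<otimes> b) \<otimes> y [^] j"
      using that y(1) by (simp add: m_assoc)
    also have "\<dots> = (a \<otimes> b) \<otimes> (y [^] i \<otimes> y [^] j)"
      using that y(1) by (simp add: ypow[symmetric] m_assoc)
    finally show ?thesis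
      using y(1) by (simp add: nat_pow_mult)
  qed
  have comm: "b \<otimes> c = c \<otimes> b" if bc: "b \<in> B" "c \<in> B" for b c
  proof -
    obtain a i a' j where *: "a \<in> A" "b = a \<otimes> y [^] (i::nat)" "a' \<in> A" "c = a' \<otimes> y [^] (j::nat)"
      using BE[OF bc(1)] BE[OF bc(2)] by blast
    show ?thesis
      using *(1,3) by (simp add: * mult A_comm[OF *(1,3)] add.commute)
  qed
  have exp: "b [^] p = \<one>" if b: "b \<in> B" for b
  proof -
    obtain a i where *: "a \<in> A" "b = a \<otimes> y [^] (i::nat)"
      using BE[OF b] by blast
    have "b [^] p = a [^] p \<otimes> (y [^] i) [^] p"
      unfolding *(2) by (intro pow_mult_distrib ypow) (use *(1) y(1) in auto)
    also have "(y [^] i) [^] p = (y [^] p) [^] i"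
      using y(1) by (simp add: nat_pow_pow mult.commute)
    finally show ?thesis
      using A_exp[OF *(1)] y(3) by simp
  qed
  have Bc: "B \<subseteq> carrier G"
    using y(1) by (auto simp: B_def f_def)
  have subB: "subgroup B G"
  proof (rule subgroupI)
    fix b c assume bc: "b \<in> B" "c \<in> B"
    obtain a i a' j where *: "a \<in> A" "b = a \<otimes> y [^] (i::nat)" "a' \<in> A" "c = a' \<otimes> y [^] (j::nat)"
      using BE[OF bc(1)] BE[OF bc(2)] by blast
    show "b \<otimes> c \<in> B"
      using *(1,3) by (simp add: * mult B)
  next
    fix b assume b: "b \<in> B"
    obtain a i where *: "a \<in> A" "b = a \<otimes> y [^] (i::nat)"
      using BE[OF b] by blast
    have "inv b = b [^] (p - 1)"
    proof (rule inv_equality)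
      have "b [^] (p - 1) \<otimes> b = b [^] Suc (p - 1)"
        by simp
      also have "Suc (p - 1) = p"
        using p0 by simp
      finally show "b [^] (p - 1) \<otimes> b = \<one>"
        using exp[OF b] by simp
    qed (use b Bc in auto)
    also have "\<dots> = a [^] (p - 1) \<otimes> (y [^] i) [^] (p - 1)"
      unfolding *(2) by (intro pow_mult_distrib ypow) (use *(1) y(1) in auto)
    also have "\<dots> \<in> B"
      using B[OF subgroup_nat_pow_closed[OF A(1) *(1)]] y(1) by (simp add: nat_pow_pow)
    finally show "inv b \<in> B" .
  next
    show "B \<noteq> {}"
      using B[OF A.one_closed] by blast
  qed (use Bc in auto)
  have inj: "i = j" if "a \<in> A" "b \<in> A" "i < p" "j \<le> i" "a \<otimes> y [^] i = b \<otimes> y [^] j" for a b and i j :: nat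
  proof (rule ccontr)
    assume "i \<noteq> j"
    have "a \<otimes> y [^] (i - j) \<otimes> y [^] j = b \<otimes> y [^] j"
      using that y(1) by (simp add: m_assoc nat_pow_mult)
    then have "a \<otimes> y [^] (i - j) = b"
      using that y(1) by simp
    then have "y [^] (i - j) = inv a \<otimes> b"
      using that(1) y(1) by auto
    then have "y [^] (i - j) \<in> A"
      using that(1,2) by simp
    moreover have "0 < i - j" "i - j < p"
      using \<open>i \<noteq> j\<close> that(3,4) by auto
    ultimately show False
      using inA y(2) by blast
  qed
  have "inj_on f (A \<times> {..<p})"
  proof (rule inj_onI, clarsimp simp: f_def)
    fix a b and i j :: nat
    assume *: "a \<in> A" "b \<in> A" "i < p" "j < p" "a \<otimes> y [^] i = b \<otimes> y [^] j"
    then have "i = j"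
      using inj[of a b i j] inj[of b a j i] by (cases "j \<le> i") auto
    with * y(1) show "a = b \<and> i = j" by simp
  qed
  then have "card B = card A * p"
    unfolding B_def by (simp add: card_image card_cartesian_product)
  then have "card B = p ^ Suc k"
    using A(3) by simp
  then show ?thesis
    using subB comm exp BE by (intro exI[of _ B]) (simp add: elementary_abelian_subgroup_iff)
qed

text \<open>The \<open>p\<close>-group generated by \<open>g\<close> fixes a nontrivial element of
  \<open>Z\<close>, and a nontrivial subgroup of a group of order \<open>p\<close> is
  everything.\<close>

lemma (in group) p_element_centralizes_normal_of_prime_order:
  assumes fin: "finite (carrier G)" and p: "prime p" and Z: "Z \<lhd> G" "card Z = p"
    and g: "g \<in> carrier G" "g [^] (p ^ k :: nat) = \<one>" and z: "z \<in> Z"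
  shows "g \<otimes> z = z \<otimes> g"
proof -
  interpret Z: normal Z G by (rule Z(1))
  let ?P = "generate G {g}" and ?C = "{z \<in> Z. g \<otimes> z = z \<otimes> g}"
  have P: "subgroup ?P G"
    using g(1) by (intro generate_is_subgroup) simp
  interpret P: subgroup ?P G by (rule P)
  obtain j where j: "card ?P = p ^ j"
    using g divides_primepow_nat[OF p] by (auto simp: pow_eq_id generate_pow_card[symmetric])
  have "{\<one>} \<subset> Z"
    using Z(2) p by (auto simp: prime_nat_iff) 
  then have "\<exists>d \<in> Z - {\<one>}. \<forall>s \<in> ?P. commutator s d \<in> {\<one>}"
    by (intro p_subgroup_fixes_coset[OF fin p P j Z.subgroup_axioms _ triv_subgroup, of 1])
      (auto simp: Z.inv_op_closed2 Z(2) P.subset)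
  then obtain d where d: "d \<in> Z" "d \<noteq> \<one>" "commutator g d = \<one>"
    using generate.incl[of g "{g}" G] by blast
  have "subgroup (Z \<inter> {x \<in> carrier G. \<forall>s \<in> {g}. s \<otimes> x = x \<otimes> s}) G"
    using g(1) by (intro subgroups_Inter_pair Z.subgroup_axioms subgroup_centralizer) simp
  also have "Z \<inter> {x \<in> carrier G. \<forall>s \<in> {g}. s \<otimes> x = x \<otimes> s} = ?C"
    by auto
  finally have C: "subgroup ?C G" .
  obtain m where m: "card ?C = p ^ m"
    by (rule card_subgroup_prime_power[OF fin p Z.subgroup_axioms _ C, of 1]) (auto simp: Z(2))
  have finZ: "finite Z"
    using fin Z.subset finite_subset by blast
  have sub: "{\<one>, d} \<subseteq> ?C"
    using d g(1) commutator_eq_one_iff[of g d] by simp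
  have "m \<noteq> 0"
  proof
    assume "m = 0"
    then have "card ?C = 1"
      using m by simp
    then obtain c where "?C = {c}"
      by (rule card_1_singletonE)
    with sub have "{\<one>, d} \<subseteq> {c}"
      by (simp only:)
    with d(2) show False by simp
  qed
  then have "card Z \<le> card ?C"
    using m Z(2) self_le_power[of p m] prime_ge_1_nat[OF p] by simp
  then have "?C = Z"
    using finZ by (intro card_seteq) auto
  with z show ?thesis by blast
qed

section \<open>Unipotent endomorphisms of abelian groups\<close>

lemma (in comm_group) nat_pow_choose_Suc:
  assumes "x \<in> carrier G"
  shows "x [^] (k choose i) \<otimes> x [^] (k choose Suc i) = x [^] (Suc k choose Suc i)"
  using assms by (simp add: nat_pow_mult)

text \<open>A binomial expansion of \<open>f\<^sup>k\<close> with \<open>f = 1 + \<nu>\<close>: the elements \<open>b\<close>, \<open>c\<close>, \<open>d\<close>, \<open>e\<close> are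
  the images of \<open>a\<close> under the powers of \<open>\<nu>\<close>, and the terms from \<open>e\<close> on are absorbed by \<open>q\<close>-th powers.\<close>

lemma (in comm_group) iterate_hom_expansion:
  assumes f: "f \<in> hom G G"
    and carr: "a \<in> carrier G" "b \<in> carrier G" "c \<in> carrier G" "d \<in> carrier G" "e \<in> carrier G"
    and fs: "f a = a \<otimes> b" "f b = b \<otimes> c" "f c = c \<otimes> d" "f d = d \<otimes> e [^] (q::nat)"
  shows "\<exists>w \<in> carrier G. (f ^^ k) a =
    a \<otimes> b [^] k \<otimes> c [^] (k choose 2) \<otimes> d [^] (k choose 3) \<otimes> w [^] q"
proof (induction k)
  case 0
  show ?case
    using carr by (intro bexI[of _ \<one>]) (simp_all add: numeral_2_eq_2 numeral_3_eq_3)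
next
  case (Suc k)
  interpret group_hom G G f
    by unfold_locales (rule f)
  obtain w where w: "w \<in> carrier G"
    "(f ^^ k) a = a \<otimes> b [^] k \<otimes> c [^] (k choose 2) \<otimes> d [^] (k choose 3) \<otimes> w [^] q"
    using Suc by blast
  have "(f ^^ Suc k) a = f a \<otimes> f b [^] k \<otimes> f c [^] (k choose 2) \<otimes> f d [^] (k choose 3) \<otimes> f w [^] q"
    using carr w by (simp add: hom_nat_pow)
  also have "\<dots> = a \<otimes> (b \<otimes> b [^] k) \<otimes> (c [^] k \<otimes> c [^] (k choose 2)) \<otimes>
      (d [^] (k choose 2) \<otimes> d [^] (k choose 3)) \<otimes> (e [^] (k choose 3) \<otimes> f w) [^] q"
    using carr w(1) by (simp add: fs nat_pow_distrib nat_pow_pow mult.commute[of q] m_ac)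
  also have "b \<otimes> b [^] k = b [^] Suc k"
    using carr by (simp add: m_comm)
  also have "c [^] k \<otimes> c [^] (k choose 2) = c [^] (Suc k choose 2)"
    using nat_pow_choose_Suc[OF carr(3), of k 1] by (simp add: numeral_2_eq_2)
  also have "d [^] (k choose 2) \<otimes> d [^] (k choose 3) = d [^] (Suc k choose 3)"
    using nat_pow_choose_Suc[OF carr(4), of k 2] by (simp add: numeral_3_eq_3 numeral_2_eq_2)
  finally show ?case
    using carr w(1) by (intro bexI[of _ "e [^] (k choose 3) \<otimes> f w"]) simp_all
qed

text \<open>Additively, with \<nu> = f - 1, the square of \<nu> vanishes modulo \<open>p\<close>. In
  the expansion of (1 + \<nu>)^p = 1 at \<open>a\<close>, every term after p \<nu>(a) is divisible
  by p^2, because p > 3 makes both \<open>p choose 2\<close> and \<open>p choose 3\<close> multiples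
  of \<open>p\<close>. Hence p (\<nu>(a) + p s) = 0 for some \<open>s\<close>, and the torsion
  hypothesis puts \<nu>(a) into the \<open>p\<close>-th multiples.\<close>

lemma (in comm_group) unipotent_trivial_mod_powers:
  assumes p: "prime p" "p > 3"
    and f: "f \<in> hom G G" "\<And>x. x \<in> carrier G \<Longrightarrow> (f ^^ p) x = x"
    and unipotent: "\<And>x. x \<in> carrier G \<Longrightarrow>
      \<exists>y \<in> carrier G. f (f x \<otimes> inv x) \<otimes> inv (f x \<otimes> inv x) = y [^] p"
    and torsion: "\<And>x. \<lbrakk>x \<in> carrier G; x [^] p = \<one>\<rbrakk> \<Longrightarrow> \<exists>y \<in> carrier G. x = y [^] p"
    and a: "a \<in> carrier G"
  shows "\<exists>y \<in> carrier G. f a \<otimes> inv a = y [^] p"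
proof -
  interpret group_hom G G f
    by unfold_locales (rule f)
  define \<nu> where "\<nu> x = f x \<otimes> inv x" for x
  have \<nu>: "\<nu> x \<in> carrier G" "f x = x \<otimes> \<nu> x" if "x \<in> carrier G" for x
    using that m_lcomm[of x "f x" "inv x"] by (simp_all add: \<nu>_def)
  have \<nu>_pow: "\<nu> (x [^] p) = \<nu> x [^] p" if "x \<in> carrier G" for x
    using that by (simp add: \<nu>_def hom_nat_pow nat_pow_distrib nat_pow_inv)
  have \<nu>\<nu>: "\<exists>y \<in> carrier G. \<nu> (\<nu> x) = y [^] p" if "x \<in> carrier G" for x
    using unipotent[OF that] by (simp add: \<nu>_def)
  define b where "b = \<nu> a"
  have b: "b \<in> carrier G"
    using \<nu>(1) a by (simp add: b_def)
  obtain c where c: "c \<in> carrier G" "\<nu> b = c [^] p"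
    using \<nu>\<nu>[OF a] by (auto simp: b_def)
  obtain e where e: "e \<in> carrier G" "\<nu> (\<nu> c) = e [^] p"
    using \<nu>\<nu>[OF c(1)] by auto
  \<comment> \<open>The successive images of \<open>a\<close> under \<nu> are \<open>b\<close>,
    \<open>c [^] p\<close>, \<open>\<nu> c [^] p\<close> and \<open>e [^] (p * p)\<close>, since two
    applications of \<nu> gain a factor \<open>p\<close>.\<close>
  have "f a = a \<otimes> b" "f b = b \<otimes> c [^] p" "f (c [^] p) = c [^] p \<otimes> \<nu> c [^] p"
    "f (\<nu> c [^] p) = \<nu> c [^] p \<otimes> e [^] (p * p)"
    using \<nu>(2)[OF a] \<nu>(2)[OF b] \<nu>(2)[of "c [^] p"] \<nu>(2)[of "\<nu> c [^] p"] \<nu>_pow c e \<nu>(1)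
    by (simp_all add: b_def nat_pow_pow)
  then obtain w where w: "w \<in> carrier G" and
    "(f ^^ p) a = a \<otimes> b [^] p \<otimes> (c [^] p) [^] (p choose 2) \<otimes> (\<nu> c [^] p) [^] (p choose 3) \<otimes> w [^] (p * p)"
    using iterate_hom_expansion[OF f(1) a b, of "c [^] p" "\<nu> c [^] p" e "p * p" p] c(1) e(1) \<nu>(1)
    by auto
  moreover obtain m where "p choose 2 = p * m"
    using dvd_choose_prime[of 2 p] p by (auto elim: dvdE)
  moreover obtain n where "p choose 3 = p * n"
    using dvd_choose_prime[of 3 p] p by (auto elim: dvdE)
  moreover define s where "s = c [^] m \<otimes> \<nu> c [^] n \<otimes> w"
  have s: "s \<in> carrier G"
    using c(1) \<nu>(1) w by (simp add: s_def)
  ultimately have "a = a \<otimes> b [^] p \<otimes> (s [^] p) [^] p"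
    using f(2)[OF a] a b c(1) w \<nu>(1)
    by (simp add: s_def nat_pow_distrib nat_pow_pow m_assoc mult_ac)
  then have "b [^] p \<otimes> (s [^] p) [^] p = \<one>"
    using a b s by (simp add: m_assoc)
  then have "(b \<otimes> s [^] p) [^] p = \<one>"
    using b s by (simp add: nat_pow_distrib)
  then obtain y where y: "y \<in> carrier G" "b \<otimes> s [^] p = y [^] p"
    using torsion[of "b \<otimes> s [^] p"] b s by auto
  then have "b = y [^] p \<otimes> inv (s [^] p)"
    using b s inv_solve_right by simp
  also have "\<dots> = (y \<otimes> inv s) [^] p"
    using y(1) s by (simp add: nat_pow_distrib nat_pow_inv)
  finally show ?thesis
    using y(1) s unfolding b_def \<nu>_def by blast
qed

section \<open>Extensions of \<open>Qd(p)\<close> by \<open>p\<close>-groups\<close>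

text \<open>The data extracted from an epimorphism of \<open>G\<close> onto \<open>Qd(p)\<close> whose kernel \<open>Q\<close> is a nontrivial \<open>p\<close>-group: \<open>V\<close> and \<open>P\<close> are
  the preimages of the translations and of the group of translations and upper unitriangular matrices, and \<open>t\<close>, \<open>u\<close>, \<open>h\<close> lift \<open>-1\<close>, the
  transvection with entries \<open>1, 1, 0, 1\<close> and \<open>diag(2, 1/2)\<close>.\<close>

locale Qd_extension = group +
  fixes p n m :: nat and V Q P and t u h
  assumes fin: "finite (carrier G)"
    and p: "prime p" "p > 3"
    and V: "V \<lhd> G" "card V = p ^ n"
    and Q: "Q \<lhd> G" "Q \<subseteq> V" "Q \<noteq> {\<one>}" "card V = p\<^sup>2 * card Q"
    and V_pow: "\<forall>v \<in> V. v [^] p \<in> Q"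
    and P: "subgroup P G" "V \<subseteq> P" "card P = p ^ m"
    and hP: "\<forall>g \<in> P. h \<otimes> g \<otimes> inv h \<in> P"
    and t: "t \<in> carrier G" "t \<otimes> t = \<one>"
    and tV: "\<forall>g \<in> carrier G. commutator t g \<in> V"
    and tQ: "\<forall>v \<in> V. t \<otimes> v \<otimes> t \<otimes> v \<in> Q"
    and u: "u \<in> P" "u [^] p \<in> V"
    and uQ: "\<forall>v \<in> V. commutator u (commutator u v) \<in> Q" "\<exists>v \<in> V. commutator u v \<notin> Q"
    and h: "h \<in> carrier G" "h [^] p \<otimes> inv h \<in> V" "commutator h u \<notin> V"
    and p_generated: "\<forall>K. subgroup K G \<and> (\<forall>g \<in> carrier G. (\<exists>k. g [^] (p ^ k :: nat) = \<one>) \<longrightarrow> g \<in> K)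
      \<longrightarrow> h \<in> K \<and> t \<in> K"
    and rank_le_two: "\<nexists>A. subgroup A G \<and> elementary_abelian p (G\<lparr>carrier := A\<rparr>) \<and> card A = p ^ 3"
begin

sublocale V: normal V G by (rule V(1))

sublocale Q: normal Q G by (rule Q(1))

sublocale P: subgroup P G by (rule P(1))

section \<open>The action of the involution and of the torus element\<close>

lemma odd_p: "odd p"
  using p prime_odd_nat[of p] by simp

lemma inv_t: "inv t = t"
  using t by (simp add: inv_equality)

lemma tt_cancel: "x \<in> carrier G \<Longrightarrow> t \<otimes> (t \<otimes> x) = x"
  using t by (simp flip: m_assoc)

lemma pow_card_V: "v \<in> V \<Longrightarrow> v [^] (p ^ n) = \<one>"
  using pow_card_subgroup[OF V.subgroup_axioms] V(2) by simp

lemma V_carrier: "v \<in> V \<Longrightarrow> v \<in> carrier G"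
  by simp

lemma eq_one_of_inverted:
  assumes "v \<in> V" "t \<otimes> v \<otimes> t = inv v" "t \<otimes> v = v \<otimes> t"
  shows "v = \<one>"
proof -
  have "inv v = v"
    using assms t by (simp add: m_assoc)
  then have "v \<otimes> v = \<one>"
    using assms(1) r_inv[of v] by simp
  then show ?thesis
    using odd_exponent_sqrt(1)[of v "p ^ n"] pow_card_V[OF assms(1)] odd_p assms(1) by simp
qed

text \<open>Since \<open>t\<close> is central modulo \<open>V\<close>, it differs from its conjugate
  \<open>s\<close> by an element \<open>v\<close> of \<open>V\<close>, which \<open>t\<close>
  inverts. The square root \<open>w\<close> of \<open>v\<close> conjugates \<open>t\<close> to
  \<open>s\<close>, and \<open>inv w\<close> is the correction of \<open>g\<close> sought. Thus the
  centralizer of \<open>t\<close> covers the quotient by \<open>V\<close>.\<close>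

lemma lift_to_centralizer:
  assumes g: "g \<in> carrier G"
  obtains v where "v \<in> V" "t \<otimes> (g \<otimes> v) = (g \<otimes> v) \<otimes> t"
proof -
  define s where "s = inv g \<otimes> t \<otimes> g"
  define v where "v = t \<otimes> s"
  define w where "w = v [^] (Suc (p ^ n) div 2)"
  have s: "s \<in> carrier G" "s \<otimes> s = \<one>"
    using g t by (simp_all add: s_def m_assoc tt_cancel)
  have "commutator t (inv g) = v"
    using g t by (simp add: v_def s_def m_assoc inv_t)
  then have v: "v \<in> V"
    using tV g by (metis inv_closed)
  then have w: "w \<in> V" "w \<otimes> w = v"
    unfolding w_def using odd_exponent_sqrt(2)[of v "p ^ n"] pow_card_V[OF v] odd_p
      subgroup_nat_pow_closed[OF V.subgroup_axioms v] by simp_all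
  have "t \<otimes> v \<otimes> t = s \<otimes> t"
    using s t by (simp add: v_def m_assoc tt_cancel)
  also have "\<dots> = inv v"
    using s t inv_equality[of s s] by (simp add: v_def inv_mult_group inv_t)
  finally have tvt: "t \<otimes> v \<otimes> t = inv v" .
  have "t \<otimes> w \<otimes> t = (t \<otimes> v \<otimes> inv t) [^] (Suc (p ^ n) div 2)"
    using v t by (simp only: w_def conj_nat_pow V_carrier) (simp add: inv_t)
  also have "\<dots> = inv w"
    using v by (simp add: inv_t tvt nat_pow_inv w_def)
  finally have twt: "t \<otimes> w \<otimes> t = inv w" .
  have "t \<otimes> g \<otimes> inv w = g \<otimes> (s \<otimes> inv w)"
    using g t w(1) by (simp add: s_def m_assoc)
  also have "s = t \<otimes> w \<otimes> w"
    using s w t by (simp add: m_assoc v_def tt_cancel)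
  also have "t \<otimes> w \<otimes> w \<otimes> inv w = t \<otimes> w \<otimes> t \<otimes> t"
    using w(1) t by (simp add: m_assoc)
  also have "\<dots> = inv w \<otimes> t"
    using twt by simp
  finally have "t \<otimes> (g \<otimes> inv w) = (g \<otimes> inv w) \<otimes> t"
    using g t w(1) by (simp add: m_assoc)
  with w(1) that show thesis by blast
qed

text \<open>All \<open>p\<close>-elements centralize a normal subgroup of order \<open>p\<close>,
  and \<open>p_generated\<close> puts \<open>h\<close> and \<open>t\<close> into every subgroup
  containing all \<open>p\<close>-elements.\<close>

lemma torus_and_involution_centralize:
  assumes M: "M \<lhd> G" "card M = p" and z: "z \<in> M"
  shows "h \<otimes> z = z \<otimes> h" "t \<otimes> z = z \<otimes> t"
proof -
  interpret M: normal M G by (rule M(1))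
  let ?K = "{x \<in> carrier G. \<forall>s \<in> M. s \<otimes> x = x \<otimes> s}"
  have "subgroup ?K G"
    by (rule subgroup_centralizer[OF M.subset])
  moreover have "\<forall>g \<in> carrier G. (\<exists>k. g [^] (p ^ k :: nat) = \<one>) \<longrightarrow> g \<in> ?K"
    using p_element_centralizes_normal_of_prime_order[OF fin p(1) M] by force
  ultimately have "h \<in> ?K \<and> t \<in> ?K"
    using p_generated by blast
  with z show "h \<otimes> z = z \<otimes> h" "t \<otimes> z = z \<otimes> t"
    by auto
qed

text \<open>Otherwise \<open>t \<otimes> v \<otimes> t \<otimes> v\<close> is the square of
  \<open>v\<close>, so all squares of \<open>V\<close> lie in \<open>Q\<close>. In odd order this
  gives \<open>V = Q\<close>, against the index p^2.\<close>

lemma ex_noncentral: "\<exists>x \<in> V. t \<otimes> x \<noteq> x \<otimes> t"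
proof (rule ccontr)
  assume "\<not> ?thesis"
  then have comm: "t \<otimes> x = x \<otimes> t" if "x \<in> V" for x
    using that by blast
  have "v \<in> Q" if v: "v \<in> V" for v
  proof -
    have "t \<otimes> v \<otimes> t \<otimes> v = v \<otimes> v"
      unfolding comm[OF v] using v t by (simp add: m_assoc tt_cancel)
    then have "v \<otimes> v \<in> Q"
      using tQ v by metis
    then have "(v \<otimes> v) [^] (Suc (p ^ n) div 2) \<in> Q"
      by (rule subgroup_nat_pow_closed[OF Q.subgroup_axioms])
    then show ?thesis
      using odd_exponent_sqrt(1)[of v "p ^ n"] pow_card_V[OF v] odd_p v by simp
  qed
  then have "V = Q"
    using Q(2) by blast
  moreover have "card V > 0"
    using V(2) p by simp
  ultimately show False
    using Q(4) p by (auto simp: power2_eq_square)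
qed

lemma coprime_ord_t: "coprime (ord t) p"
proof -
  have "ord t dvd 2"
    using t pow_eq_id[of t 2] by (simp add: numeral_2_eq_2)
  then show ?thesis
    using odd_p by (metis coprime_divisors coprime_left_2_iff_odd dvd_refl)
qed

end

text \<open>The pair comes from \<open>coprime_critical_pair\<close> for \<open>t\<close> acting on
  \<open>V\<close>; the role of the element called \<open>h\<close> there is played by
  \<open>t\<close>, not by the torus element.\<close>

locale Qd_extension_pair = Qd_extension +
  fixes D Z
  assumes D: "D \<lhd> G" "D \<subseteq> V" "\<exists>d \<in> D. t \<otimes> d \<noteq> d \<otimes> t"
    and Z: "Z \<lhd> G" "Z \<subset> D"
    and Z_max: "\<forall>M. M \<lhd> G \<and> Z \<subseteq> M \<and> M \<subseteq> D \<longrightarrow> M = Z \<or> M = D"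
    and D_min: "\<forall>M. M \<lhd> G \<and> M \<subset> D \<longrightarrow> (\<forall>z \<in> M. t \<otimes> z = z \<otimes> t)"
    and Z_central: "\<forall>z \<in> Z. \<forall>d \<in> D. z \<otimes> d = d \<otimes> z"
    and VD: "\<forall>g \<in> V. \<forall>d \<in> D. commutator g d \<in> Z"
    and D_pow: "\<forall>d \<in> D. d [^] p \<in> Z"
begin

sublocale D: normal D G by (rule D(1))

sublocale Z: normal Z G by (rule Z(1))

section \<open>Fixed points of the involution on \<open>D\<close>, and the case of trivial
  \<open>Z\<close>\<close>

lemma tZ: "z \<in> Z \<Longrightarrow> t \<otimes> z = z \<otimes> t"
  using D_min Z by blast

text \<open>The centralizer of \<open>t\<close> in \<open>D / Z\<close> is invariant under
  \<open>G\<close>, so its preimage is \<open>Z\<close> or \<open>D\<close>. It is not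
  \<open>D\<close>, since \<open>t\<close> centralizes \<open>Z\<close> and would then centralize
  \<open>D\<close> by coprimality.\<close>

lemma fixed_in_Z:
  assumes d: "d \<in> D" "t \<otimes> d = d \<otimes> t"
  shows "d \<in> Z"
proof -
  \<comment> \<open>The coset of \<open>t\<close> modulo \<open>V\<close> is invariant under
    conjugation, and it imposes the same condition as \<open>t\<close> because \<open>V\<close>
    centralizes \<open>D / Z\<close>.\<close>
  let ?S = "(\<lambda>v. t \<otimes> v) ` V"
  let ?C = "{d \<in> D. \<forall>s \<in> ?S. commutator s d \<in> Z}"
  have C: "?C \<lhd> G"
  proof (rule normal_commutator_preimage[OF D(1) Z(1)])
    fix g s assume g: "g \<in> carrier G" and "s \<in> ?S"
    then obtain v where v: "v \<in> V" "s = t \<otimes> v"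
      by blast
    have "g \<otimes> s \<otimes> inv g = t \<otimes> (commutator t g \<otimes> (g \<otimes> v \<otimes> inv g))"
      using g t v by (simp add: m_assoc inv_t tt_cancel)
    moreover have "commutator t g \<otimes> (g \<otimes> v \<otimes> inv g) \<in> V"
      using tV g v V.inv_op_closed2 by simp
    ultimately show "g \<otimes> s \<otimes> inv g \<in> ?S"
      by blast
  qed (use t in auto)
  have in_C: "d \<in> ?C" if d: "d \<in> D" "commutator t d \<in> Z" for d
  proof -
    have "commutator (t \<otimes> v) d \<in> Z" if v: "v \<in> V" for v
    proof -
      have "commutator (t \<otimes> v) d = t \<otimes> commutator v d \<otimes> inv t \<otimes> commutator t d"
        using t v d by (simp add: m_assoc inv_mult_group)
      moreover have "t \<otimes> commutator v d \<otimes> inv t \<in> Z"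
        using VD v d t Z.inv_op_closed2 by simp
      ultimately show ?thesis
        using d by simp
    qed
    with d show ?thesis by blast
  qed
  have "Z \<subseteq> ?C"
  proof
    fix z assume z: "z \<in> Z"
    then have "commutator t z = \<one>"
      using tZ t commutator_eq_one_iff[of t z] by simp
    then show "z \<in> ?C"
      using in_C[of z] z Z(2) by auto
  qed
  moreover have "?C \<noteq> D"
  proof
    assume eq: "?C = D"
    have "t \<otimes> d = d \<otimes> t" if d: "d \<in> D" for d
    proof (rule coprime_commutator_trivial[OF t(1) _ coprime_ord_t])
      have "d \<in> ?C"
        unfolding eq by (rule d)
      then have "\<forall>s \<in> ?S. commutator s d \<in> Z"
        unfolding mem_Collect_eq by (rule conjunct2)
      from bspec[OF this imageI[OF V.one_closed]] have "commutator (t \<otimes> \<one>) d \<in> Z" .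
      then have c: "commutator t d \<in> Z"
        by (simp only: r_one[OF t(1)])
      then have "commutator t d \<in> V"
        using Z(2) D(2) by blast
      then show "commutator t d [^] (p ^ n) = \<one>"
        by (rule pow_card_V)
      show "t \<otimes> commutator t d = commutator t d \<otimes> t"
        using c by (rule tZ)
    qed (use d in simp)
    with D(3) show False by blast
  qed
  ultimately have "?C = Z"
    using C Z_max by blast
  moreover have "commutator t d = \<one>"
    using d t commutator_eq_one_iff[of t d] by simp
  ultimately show ?thesis
    using in_C[of d] d by auto
qed

lemma not_trivial_Z:
  assumes Z1: "Z = {\<one>}"
  shows False
proof -
  have VD': "g \<otimes> d = d \<otimes> g" if "g \<in> V" "d \<in> D" for g d
    using VD that Z1 commutator_eq_one_iff[of g d] by simp
  have D_elem: "elementary_abelian p (G\<lparr>carrier := D\<rparr>)"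
    using VD' D(2) D_pow Z1 by (auto simp: elementary_abelian_subgroup_iff[OF D.subgroup_axioms])
  have sub_elem: "elementary_abelian p (G\<lparr>carrier := A\<rparr>)" if "subgroup A G" "A \<subseteq> D" for A
    using D_elem that by (auto simp: elementary_abelian_subgroup_iff[OF that(1)]
        elementary_abelian_subgroup_iff[OF D.subgroup_axioms])
  obtain j where j: "card D = p ^ j"
    by (rule card_subgroup_prime_power[OF fin p(1) V.subgroup_axioms V(2) D.subgroup_axioms D(2)])
  \<comment> \<open>A larger \<open>D\<close> would contain a subgroup of order p^3, elementary
    abelian like \<open>D\<close>.\<close>
  have "j < 3"
  proof (rule ccontr)
    assume "\<not> j < 3"
    then have "order (G\<lparr>carrier := D\<rparr>) = p ^ 3 * p ^ (j - 3)"
      using j by (simp add: order_def flip: power_add)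
    from sylow_thm[OF p(1) subgroup_imp_group[OF D.subgroup_axioms] this]
    obtain A where A: "subgroup A (G\<lparr>carrier := D\<rparr>)" "card A = p ^ 3"
      using finite_subset[OF D.subset fin] by auto
    have "subgroup A G"
      using D.subgroup_axioms A(1) by (rule incl_subgroup)
    moreover have "A \<subseteq> D"
      using subgroup.subset[OF A(1)] by simp
    ultimately have "elementary_abelian p (G\<lparr>carrier := A\<rparr>)"
      by (rule sub_elem)
    with \<open>subgroup A G\<close> A(2) rank_le_two show False
      by blast
  qed
  moreover have "j \<noteq> 0"
  proof
    assume "j = 0"
    then have "card D = 1"
      using j by simp
    then obtain c where "D = {c}"
      by (rule card_1_singletonE)
    then show False
      using Z(2) Z1 D.one_closed by blast
  qed
  moreover have "j \<noteq> 1"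
  proof
    assume "j = 1"
    then show False
      using torus_and_involution_centralize(2)[OF D(1)] j D(3) by auto
  qed
  ultimately have card_D: "card D = p ^ 2"
    using j by (cases j rule: nat.exhaust) (auto simp: less_Suc_eq numeral_3_eq_3 numeral_2_eq_2)
  \<comment> \<open>\<open>V\<close> centralizes \<open>D\<close>, so such a \<open>y\<close>
    outside \<open>D\<close> would extend \<open>D\<close> to an elementary abelian group of order
    p^3.\<close>
  have torsion: "y \<in> D" if y: "y \<in> V" "y [^] p = \<one>" for y
  proof (rule ccontr)
    assume "y \<notin> D"
    then have "\<exists>B. subgroup B G \<and> elementary_abelian p (G\<lparr>carrier := B\<rparr>) \<and> card B = p ^ Suc 2 \<and>
        (\<forall>b \<in> B. \<exists>a \<in> D. \<exists>i::nat. b = a \<otimes> y [^] i)"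
      using y VD' by (intro elementary_abelian_extend[OF p(1) D.subgroup_axioms D_elem card_D]) auto
    with rank_le_two show False
      by (auto simp: numeral_3_eq_3 numeral_2_eq_2)
  qed
  have fixed_trivial: "v = \<one>" if v: "v \<in> V" "t \<otimes> v = v \<otimes> t" for v
  proof (rule ccontr)
    assume "v \<noteq> \<one>"
    then obtain k :: nat where k: "v [^] k \<noteq> \<one>" "(v [^] k) [^] p = \<one>"
      using ex_power_of_prime_order[of v p n] pow_card_V v by auto
    have "v [^] k \<in> D"
      using k torsion subgroup_nat_pow_closed[OF V.subgroup_axioms v(1)] by blast
    moreover have "t \<otimes> v [^] k = v [^] k \<otimes> t"
      using group_commutes_pow[of v t k] v t by simp
    ultimately show False
      using fixed_in_Z Z1 k(1) by blast
  qed
  have finV: "finite V"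
    using fin V.subset finite_subset by blast
  have inverted: "t \<otimes> x \<otimes> t = inv x" if x: "x \<in> V" for x
  proof -
    \<comment> \<open>With only trivial fixed points of \<open>t\<close>, this map is injective on
      the finite set \<open>V\<close>, hence onto. Its values are inverted by
      \<open>t\<close>.\<close>
    let ?f = "\<lambda>v. inv v \<otimes> (t \<otimes> v \<otimes> t)"
    have tVt: "t \<otimes> v \<otimes> t \<in> V" if "v \<in> V" for v
      using V.inv_op_closed2[OF t(1) that] by (simp add: inv_t)
    have "inj_on ?f V"
    proof (rule inj_onI)
      fix v w assume vw: "v \<in> V" "w \<in> V" "?f v = ?f w"
      have "w \<otimes> inv v = w \<otimes> ?f v \<otimes> (t \<otimes> inv v \<otimes> t)"
        using vw(1,2) t by (simp add: m_assoc tt_cancel)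
      also have "\<dots> = t \<otimes> (w \<otimes> inv v) \<otimes> t"
        unfolding vw(3) using vw(1,2) t by (simp add: m_assoc tt_cancel)
      finally have eq: "w \<otimes> inv v = t \<otimes> (w \<otimes> inv v) \<otimes> t" .
      have "t \<otimes> (w \<otimes> inv v) = t \<otimes> (w \<otimes> inv v) \<otimes> t \<otimes> t"
        using vw(1,2) t by (simp add: m_assoc)
      also have "\<dots> = (w \<otimes> inv v) \<otimes> t"
        unfolding eq[symmetric] ..
      finally have "w \<otimes> inv v = \<one>"
        using fixed_trivial[of "w \<otimes> inv v"] vw(1,2) by blast
      then show "v = w"
        using vw(1,2) inv_equality[of w "inv v"] by simp
    qed
    moreover have "?f ` V \<subseteq> V"
      using tVt by auto
    ultimately have "x \<in> ?f ` V"
      using endo_inj_surj[OF finV] x by blast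
    then obtain v where v: "v \<in> V" "x = ?f v" by blast
    have "t \<otimes> x \<otimes> t = t \<otimes> inv v \<otimes> t \<otimes> v"
      using v t by (simp add: m_assoc tt_cancel)
    also have "\<dots> = inv x"
      using v t by (simp add: inv_mult_group m_assoc inv_t)
    finally show ?thesis .
  qed
  \<comment> \<open>Inversion on \<open>V\<close> is conjugation by \<open>t\<close>, hence a
    homomorphism, which forces commutativity.\<close>
  have abelian: "x \<otimes> y = y \<otimes> x" if xy: "x \<in> V" "y \<in> V" for x y
  proof -
    have "inv (y \<otimes> x) = inv x \<otimes> inv y"
      using xy by (simp add: inv_mult_group)
    also have "\<dots> = t \<otimes> x \<otimes> t \<otimes> (t \<otimes> y \<otimes> t)"
      using xy by (simp add: inverted)
    also have "\<dots> = t \<otimes> (x \<otimes> y) \<otimes> t"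
      using xy t by (simp add: m_assoc tt_cancel)
    also have "\<dots> = inv (x \<otimes> y)"
      using xy by (simp add: inverted)
    finally show ?thesis
      using xy inv_inv by (metis V.m_closed V_carrier)
  qed
  let ?V = "G\<lparr>carrier := V\<rparr>"
  interpret VG: group ?V
    using V.subgroup_axioms by (rule subgroup_imp_group)
  interpret VG: comm_group ?V
    by (rule VG.group_comm_groupI) (simp add: abelian)
  have pow_V: "x [^]\<^bsub>?V\<^esub> (k::nat) = x [^] k" for x k
    by (rule nat_pow_consistent[symmetric])
  have "(\<lambda>v. v [^] p) \<in> hom ?V ?V"
  proof (rule homI)
    fix x y assume "x \<in> carrier ?V" "y \<in> carrier ?V"
    then show "(x \<otimes>\<^bsub>?V\<^esub> y) [^] p = x [^] p \<otimes>\<^bsub>?V\<^esub> y [^] p"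
      using pow_mult_distrib[of x y p] abelian by simp
  qed (use subgroup_nat_pow_closed[OF V.subgroup_axioms] in simp)
  then interpret pw: group_hom ?V ?V "\<lambda>v. v [^] p"
    by unfold_locales
  have "kernel ?V ?V (\<lambda>v. v [^] p) = D"
  proof -
    have "x [^] p = \<one> \<longleftrightarrow> x \<in> D" if "x \<in> V" for x
      using torsion[OF that] D_pow Z1 by blast
    then show ?thesis
      using D(2) by (auto simp: kernel_def)
  qed
  \<comment> \<open>The kernel \<open>D\<close> of the \<open>p\<close>-th power map has order p^2,
    which is also the index of \<open>Q\<close> in \<open>V\<close>; so its image, contained in
    \<open>Q\<close>, is all of \<open>Q\<close>.\<close>
  then have "card ((\<lambda>v. v [^] p) ` V) * p\<^sup>2 = card V"
    using pw.card_image_mult_card_kernel finV card_D by (simp add: order_def)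
  then have "card ((\<lambda>v. v [^] p) ` V) = card Q"
    using Q(4) p by simp
  moreover have "finite Q"
    using finV Q(2) finite_subset by blast
  moreover have "(\<lambda>v. v [^] p) ` V \<subseteq> Q"
    using V_pow by blast
  ultimately have Q_pow: "(\<lambda>v. v [^] p) ` V = Q"
    by (simp add: card_subset_eq)
  \<comment> \<open>Otherwise \<open>D \<inter> Q\<close> is centralized by \<open>t\<close> by the
    minimality of \<open>D\<close>, and therefore trivial. But the nontrivial \<open>Q\<close>
    contains an element of order \<open>p\<close>, which lies in \<open>D\<close>.\<close>
  have DQ: "D \<subseteq> Q"
  proof (rule ccontr)
    assume "\<not> D \<subseteq> Q"
    then have "D \<inter> Q \<subset> D" by blast
    moreover have "D \<inter> Q \<lhd> G"
      using D(1) Q(1) by (rule normal_subgroup_intersect)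
    ultimately have *: "t \<otimes> z = z \<otimes> t" if "z \<in> D \<inter> Q" for z
      using D_min that by blast
    obtain y where y: "y \<in> Q" "y \<noteq> \<one>"
      using Q(3) Q.one_closed by blast
    then have yV: "y \<in> V"
      using Q(2) by blast
    then obtain k :: nat where k: "y [^] k \<noteq> \<one>" "(y [^] k) [^] p = \<one>"
      using ex_power_of_prime_order[of y p n] pow_card_V y(2) by auto
    have "y [^] k \<in> V" "y [^] k \<in> Q"
      using subgroup_nat_pow_closed yV y(1) V.subgroup_axioms Q.subgroup_axioms by auto
    then have "y [^] k \<in> D \<inter> Q"
      using torsion k(2) by blast
    then show False
      using fixed_trivial[of "y [^] k"] * \<open>y [^] k \<in> V\<close> k(1) by blast
  qed
  have uG: "u \<in> carrier G"
    using u(1) by simp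
  define f where "f x = u \<otimes> x \<otimes> inv u" for x
  have fV: "f x \<in> V" if "x \<in> V" for x
    unfolding f_def using V.inv_op_closed2[OF uG that] .
  have inv_V: "inv\<^bsub>?V\<^esub> x = inv x" if "x \<in> V" for x
    using that V.subgroup_axioms by simp
  have f_comm: "f x \<otimes>\<^bsub>?V\<^esub> inv\<^bsub>?V\<^esub> x = commutator u x" if "x \<in> V" for x
    using that by (simp add: inv_V f_def)
  have comm_V: "commutator u x \<in> V" if "x \<in> V" for x
    using fV[OF that] that by (simp add: f_def)
  have f_iter: "(f ^^ k) x = u [^] k \<otimes> x \<otimes> inv (u [^] k)" if "x \<in> V" for x and k :: nat
  proof (induction k)
    case (Suc k)
    have "(f ^^ Suc k) x = (u \<otimes> u [^] k) \<otimes> x \<otimes> inv (u \<otimes> u [^] k)"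
      using that uG by (simp add: Suc.IH f_def m_assoc inv_mult_group)
    then show ?case
      by (simp only: nat_pow_Suc2[OF uG])
  qed (use that in simp)
  have "\<exists>y \<in> V. commutator u a = y [^] p" if a: "a \<in> V" for a
  proof -
    have "\<exists>y \<in> carrier ?V. f a \<otimes>\<^bsub>?V\<^esub> inv\<^bsub>?V\<^esub> a = y [^]\<^bsub>?V\<^esub> p"
    proof (rule VG.unipotent_trivial_mod_powers[OF p])
      show "f \<in> hom ?V ?V"
        using fV uG by (auto intro!: homI simp: f_def m_assoc)
      \<comment> \<open>The \<open>p\<close>-th iterate is conjugation by \<open>u [^] p\<close>, an
        element of the abelian group \<open>V\<close>.\<close>
      show "(f ^^ p) x = x" if "x \<in> carrier ?V" for x
        using that abelian[OF u(2)] u(2) by (simp add: f_iter m_assoc)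
      show "\<exists>y \<in> carrier ?V. f (f x \<otimes>\<^bsub>?V\<^esub> inv\<^bsub>?V\<^esub> x) \<otimes>\<^bsub>?V\<^esub> inv\<^bsub>?V\<^esub> (f x \<otimes>\<^bsub>?V\<^esub> inv\<^bsub>?V\<^esub> x) = y [^]\<^bsub>?V\<^esub> p"
        if "x \<in> carrier ?V" for x
      proof -
        have x: "x \<in> V"
          using that by simp
        then have "commutator u (commutator u x) \<in> (\<lambda>v. v [^] p) ` V"
          unfolding Q_pow using uQ(1) by simp
        then show ?thesis
          unfolding f_comm[OF x] f_comm[OF comm_V[OF x]] pow_V by (simp add: image_iff)
      qed
      show "\<exists>y \<in> carrier ?V. x = y [^]\<^bsub>?V\<^esub> p"
        if "x \<in> carrier ?V" "x [^]\<^bsub>?V\<^esub> p = \<one>\<^bsub>?V\<^esub>" for x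
      proof -
        have "x \<in> (\<lambda>v. v [^] p) ` V"
          unfolding Q_pow using torsion[of x] that DQ by (auto simp: pow_V)
        then show ?thesis
          by (auto simp: pow_V)
      qed
    qed (use a in simp)
    then show ?thesis
      unfolding f_comm[OF a] pow_V by simp
  qed
  then have "commutator u a \<in> Q" if "a \<in> V" for a
    using Q_pow that by (metis image_eqI)
  with uQ(2) show False
    by blast
qed

end

section \<open>The case of nontrivial \<open>Z\<close>\<close>

context Qd_extension_pair
begin

text \<open>The aim is that \<open>h\<close> and \<open>u\<close> commute modulo \<open>V\<close>.
  Both are corrected by elements of \<open>V\<close> to commute with \<open>t\<close>; a
  \<open>p\<close>-power of the corrected \<open>h\<close> centralizes \<open>R\<close>, which
  contains the corrected \<open>u\<close>, and this power agrees with \<open>h\<close> modulo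
  \<open>V\<close>.\<close>

lemma not_nontrivial_Z:
  assumes Z1: "Z \<noteq> {\<one>}"
  shows False
proof -
  define R where "R = {g \<in> P. t \<otimes> g = g \<otimes> t}"
  have RP: "R \<subseteq> P" and Rt: "\<And>g. g \<in> R \<Longrightarrow> t \<otimes> g = g \<otimes> t"
    by (auto simp: R_def)
  have R_carrier: "g \<in> carrier G" if "g \<in> R" for g
    using that RP by auto
  have "subgroup (P \<inter> {x \<in> carrier G. \<forall>s \<in> {t}. s \<otimes> x = x \<otimes> s}) G"
    using t(1) by (intro subgroups_Inter_pair P(1) subgroup_centralizer) simp
  also have "P \<inter> {x \<in> carrier G. \<forall>s \<in> {t}. s \<otimes> x = x \<otimes> s} = R"
    by (auto simp: R_def)
  finally have R: "subgroup R G" .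
  obtain r where card_R: "card R = p ^ r"
    by (rule card_subgroup_prime_power[OF fin p(1) P(1,3) R RP])
  obtain j where j: "card D = p ^ j"
    by (rule card_subgroup_prime_power[OF fin p(1) V.subgroup_axioms V(2) D.subgroup_axioms D(2)])
  have "\<exists>d \<in> D - Z. \<forall>g \<in> P. commutator g d \<in> Z"
    by (rule p_subgroup_fixes_coset[OF fin p(1) P(1,3) D.subgroup_axioms j Z.subgroup_axioms Z(2)])
      (simp_all add: D.inv_op_closed2 Z.inv_op_closed2)
  then obtain d where d: "d \<in> D" "d \<notin> Z" and Pd: "\<And>g. g \<in> P \<Longrightarrow> commutator g d \<in> Z"
    by blast
  \<comment> \<open>As a commutator with an involution, \<open>x0\<close> is inverted by
    \<open>t\<close>; it is nontrivial because elements of \<open>D\<close> fixed by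
    \<open>t\<close> lie in \<open>Z\<close>.\<close>
  define x0 where "x0 = commutator t d"
  have dG: "d \<in> carrier G"
    using d by simp
  have x0D: "x0 \<in> D"
    unfolding x0_def using D.inv_op_closed2[OF t(1) d(1)] d(1) by simp
  have x0V: "x0 \<in> V"
    using x0D D(2) by blast
  have "x0 \<noteq> \<one>"
    using fixed_in_Z[OF d(1)] d(2) commutator_eq_one_iff[of t d] t dG by (auto simp: x0_def)
  have x0_inv: "t \<otimes> x0 \<otimes> t = inv x0"
    using t dG by (simp add: x0_def m_assoc inv_mult_group inv_t tt_cancel)
  \<comment> \<open>Conjugation by \<open>g\<close> in \<open>R\<close> fixes \<open>t\<close> and
    multiplies \<open>d\<close> by some \<open>z\<close> in \<open>Z\<close>. Since \<open>z\<close>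
    commutes with \<open>t\<close> and with \<open>D\<close>, it cancels in [t, d].\<close>
  have x0_R: "g \<otimes> x0 = x0 \<otimes> g" if g: "g \<in> R" for g
  proof -
    define z where "z = commutator g d"
    have z: "z \<in> Z" "z \<in> carrier G" and gG: "g \<in> carrier G"
      using Pd RP g R_carrier by (auto simp: z_def intro: Z.mem_carrier)
    have gd: "g \<otimes> d = z \<otimes> d \<otimes> g"
      using gG dG by (simp add: z_def m_assoc)
    have "z \<otimes> x0 = x0 \<otimes> z"
      using Z_central z(1) x0D by blast
    have "g \<otimes> x0 = t \<otimes> (g \<otimes> d) \<otimes> t \<otimes> inv d"
      using gG dG t Rt[OF g] by (simp add: x0_def inv_t m_assoc[symmetric])
    also have "\<dots> = t \<otimes> z \<otimes> d \<otimes> (g \<otimes> t) \<otimes> inv d"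
      unfolding gd using gG dG z t by (simp add: m_assoc)
    also have "\<dots> = (t \<otimes> z) \<otimes> d \<otimes> t \<otimes> (g \<otimes> inv d)"
      unfolding Rt[OF g, symmetric] using gG dG z t by (simp add: m_assoc)
    also have "t \<otimes> z = z \<otimes> t"
      by (rule tZ[OF z(1)])
    also have "g \<otimes> inv d = inv d \<otimes> inv z \<otimes> g"
    proof -
      have "inv d \<otimes> inv z \<otimes> (g \<otimes> d) \<otimes> inv d = g \<otimes> inv d"
        unfolding gd using gG dG z by (simp add: m_assoc)
      then show ?thesis
        using gG dG z by (simp add: m_assoc)
    qed
    also have "z \<otimes> t \<otimes> d \<otimes> t \<otimes> (inv d \<otimes> inv z \<otimes> g) = z \<otimes> x0 \<otimes> inv z \<otimes> g"
      using gG dG z t by (simp add: x0_def inv_t m_assoc)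
    also have "\<dots> = x0 \<otimes> g"
      unfolding \<open>z \<otimes> x0 = x0 \<otimes> z\<close> using gG z x0D by (simp add: m_assoc)
    finally show ?thesis .
  qed
  obtain k :: nat where k: "x0 [^] k \<noteq> \<one>" "(x0 [^] k) [^] p = \<one>"
    using ex_power_of_prime_order[of x0 p n] pow_card_V[OF x0V] \<open>x0 \<noteq> \<one>\<close> x0V by auto
  define x where "x = x0 [^] k"
  have x: "x \<noteq> \<one>" "x [^] p = \<one>" "x \<in> D" "x \<in> V" "x \<in> carrier G"
    using k subgroup_nat_pow_closed[OF D.subgroup_axioms x0D, of k] D(2) by (auto simp: x_def)
  have x_inv: "t \<otimes> x \<otimes> t = inv x"
  proof -
    have "t \<otimes> x \<otimes> inv t = (t \<otimes> x0 \<otimes> inv t) [^] k"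
      unfolding x_def using t x0V by (intro conj_nat_pow[symmetric]) auto
    then show ?thesis
      using x0V by (simp add: inv_t x0_inv nat_pow_inv x_def)
  qed
  have x_R: "g \<otimes> x = x \<otimes> g" if "g \<in> R" for g
    unfolding x_def using x0_R[OF that] R_carrier[OF that] x0V by (intro commutes_nat_pow) auto
  have x_Z: "z \<otimes> x = x \<otimes> z" if "z \<in> Z" for z
    using Z_central that x(3) by blast
  have xpow: "x [^] i = \<one>" if "t \<otimes> x [^] (i::nat) = x [^] i \<otimes> t" for i
  proof (rule eq_one_of_inverted[OF _ _ that])
    show "x [^] i \<in> V"
      using subgroup_nat_pow_closed[OF V.subgroup_axioms x(4)] .
    have "t \<otimes> x [^] i \<otimes> inv t = (t \<otimes> x \<otimes> inv t) [^] i"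
      using t x by (intro conj_nat_pow[symmetric]) auto
    then show "t \<otimes> x [^] i \<otimes> t = inv (x [^] i)"
      using x by (simp add: inv_t x_inv nat_pow_inv)
  qed
  obtain z0 where z0: "z0 \<in> Z" "z0 \<noteq> \<one>"
    using Z1 Z.one_closed by blast
  then obtain l :: nat where l: "z0 [^] l \<noteq> \<one>" "(z0 [^] l) [^] p = \<one>"
    using ex_power_of_prime_order[of z0 p n] pow_card_V[of z0] Z(2) D(2) by auto
  define z where "z = z0 [^] l"
  have z: "z \<noteq> \<one>" "z [^] p = \<one>" "z \<in> Z" "z \<in> carrier G"
    using l subgroup_nat_pow_closed[OF Z.subgroup_axioms z0(1), of l] by (auto simp: z_def)
  have triv: "elementary_abelian p (G\<lparr>carrier := {\<one>}\<rparr>)"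
    by (simp add: elementary_abelian_subgroup_iff[OF triv_subgroup])
  \<comment> \<open>Extending the trivial group produces the cyclic group of \<open>z\<close>
    together with the form of its elements.\<close>
  have "\<exists>B. subgroup B G \<and> elementary_abelian p (G\<lparr>carrier := B\<rparr>) \<and> card B = p ^ Suc 0 \<and>
      (\<forall>b \<in> B. \<exists>a \<in> {\<one>}. \<exists>i::nat. b = a \<otimes> z [^] i)"
    using z by (intro elementary_abelian_extend[OF p(1) triv_subgroup triv]) auto
  then obtain A where A: "subgroup A G" "elementary_abelian p (G\<lparr>carrier := A\<rparr>)" "card A = p ^ Suc 0"
    and A_pow: "\<And>b. b \<in> A \<Longrightarrow> \<exists>i::nat. b = z [^] i"
    using z(4) by fastforce
  have AZ: "A \<subseteq> Z"
    using A_pow subgroup_nat_pow_closed[OF Z.subgroup_axioms z(3)] by blast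
  have "x \<notin> A"
    using tZ[of x] AZ xpow[of 1] x by auto
  then have "\<exists>B. subgroup B G \<and> elementary_abelian p (G\<lparr>carrier := B\<rparr>) \<and> card B = p ^ Suc (Suc 0) \<and>
      (\<forall>b \<in> B. \<exists>a \<in> A. \<exists>i::nat. b = a \<otimes> x [^] i)"
    using x x_Z AZ by (intro elementary_abelian_extend[OF p(1) A]) auto
  then obtain B where B: "subgroup B G" "elementary_abelian p (G\<lparr>carrier := B\<rparr>)" "card B = p ^ Suc (Suc 0)"
    and B_pow: "\<And>b. b \<in> B \<Longrightarrow> \<exists>a \<in> A. \<exists>i::nat. b = a \<otimes> x [^] i"
    by blast
  \<comment> \<open>By the rank bound \<open>y\<close> lies in the group \<open>B\<close> of order
    p^2 spanned by \<open>A\<close> and \<open>x\<close>. Its \<open>x\<close>-component is fixed by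
    \<open>t\<close> as well as inverted, hence trivial.\<close>
  have in_A: "y \<in> A" if y: "y \<in> carrier G" "y [^] p = \<one>" "t \<otimes> y = y \<otimes> t" "y \<otimes> x = x \<otimes> y"
    "\<And>a. a \<in> A \<Longrightarrow> y \<otimes> a = a \<otimes> y" for y
  proof -
    have yB: "b \<otimes> y = y \<otimes> b" if "b \<in> B" for b
    proof -
      obtain a i where ai: "a \<in> A" "b = a \<otimes> x [^] (i::nat)"
        using B_pow[OF \<open>b \<in> B\<close>] by blast
      have "y \<otimes> x [^] i = x [^] i \<otimes> y"
        using commutes_nat_pow y(1,4) x(5) by blast
      then have "y \<otimes> (a \<otimes> x [^] i) = (a \<otimes> x [^] i) \<otimes> y"
        using y(1,5) ai(1) x(5) AZ by (intro commutes_mult) auto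
      then show ?thesis
        using ai by simp
    qed
    have "y \<in> B"
    proof (rule ccontr)
      assume "y \<notin> B"
      then have "\<exists>C. subgroup C G \<and> elementary_abelian p (G\<lparr>carrier := C\<rparr>) \<and> card C = p ^ Suc (Suc (Suc 0)) \<and>
          (\<forall>c \<in> C. \<exists>b \<in> B. \<exists>i::nat. c = b \<otimes> y [^] i)"
        using y(1,2) yB by (intro elementary_abelian_extend[OF p(1) B]) auto
      with rank_le_two show False
        by (auto simp: numeral_3_eq_3)
    qed
    then obtain a i where ai: "a \<in> A" "y = a \<otimes> x [^] (i::nat)"
      using B_pow by blast
    have carr: "a \<in> carrier G"
      using ai AZ by auto
    have "a \<otimes> (t \<otimes> x [^] i) = t \<otimes> y"
      using tZ[of a] ai AZ carr t x by (auto simp: m_assoc[symmetric])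
    also have "t \<otimes> y = a \<otimes> (x [^] i \<otimes> t)"
      unfolding y(3) using carr t x by (simp add: ai(2) m_assoc)
    finally have "x [^] i = \<one>"
      using carr t x by (intro xpow) simp
    then show ?thesis
      using ai carr by simp
  qed
  \<comment> \<open>Thus \<open>A\<close> consists of all solutions of
    \<open>y [^] p = \<one>\<close> in \<open>Z\<close>, and this description makes it normal in
    \<open>G\<close>.\<close>
  have A_iff: "y \<in> A \<longleftrightarrow> y \<in> Z \<and> y [^] p = \<one>" for y
  proof
    assume "y \<in> A"
    with A(2) AZ show "y \<in> Z \<and> y [^] p = \<one>"
      by (auto simp: elementary_abelian_subgroup_iff[OF A(1)])
  next
    assume y: "y \<in> Z \<and> y [^] p = \<one>"
    have "y \<otimes> a = a \<otimes> y" if "a \<in> A" for a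
      using Z_central y that AZ Z(2) by blast
    with y tZ x_Z show "y \<in> A"
      by (intro in_A) auto
  qed
  have A_normal: "A \<lhd> G"
    unfolding normal_inv_iff using A(1) by (auto simp: A_iff conj_nat_pow Z.inv_op_closed2)
  have card_A: "card A = p"
    using A(3) by simp
  obtain v where v: "v \<in> V" "t \<otimes> (h \<otimes> v) = (h \<otimes> v) \<otimes> t"
    by (rule lift_to_centralizer[OF h(1)])
  obtain w where w: "w \<in> V" "t \<otimes> (u \<otimes> w) = (u \<otimes> w) \<otimes> t"
    using lift_to_centralizer[of u] u(1) by auto
  define h1 where "h1 = h \<otimes> v"
  have h1: "h1 \<in> carrier G" "t \<otimes> h1 = h1 \<otimes> t"
    using h(1) v by (auto simp: h1_def)
  have "\<exists>i. \<forall>g \<in> R. h1 [^] (p ^ i :: nat) \<otimes> g = g \<otimes> h1 [^] (p ^ i)"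
  proof (rule power_centralizes_p_subgroup[OF fin p(1) _ R card_R h1(1)])
    show "p > 2"
      using p(2) by simp
    show "h1 \<otimes> g \<otimes> inv h1 \<in> R" if g: "g \<in> R" for g
    proof -
      have "v \<otimes> g \<otimes> inv v \<in> P"
        using g RP v P(2) by blast
      moreover have "h1 \<otimes> g \<otimes> inv h1 = h \<otimes> (v \<otimes> g \<otimes> inv v) \<otimes> inv h"
        using h v R_carrier[OF g] by (simp add: h1_def m_assoc inv_mult_group)
      ultimately have "h1 \<otimes> g \<otimes> inv h1 \<in> P"
        using hP by simp
      moreover have "t \<otimes> (h1 \<otimes> g \<otimes> inv h1) = h1 \<otimes> g \<otimes> inv h1 \<otimes> t"
        using h1 t(1) R_carrier[OF g] Rt[OF g] by (intro commutes_mult commutes_inv) auto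
      ultimately show ?thesis
        by (simp add: R_def)
    qed
    \<comment> \<open>An element of order \<open>p\<close> in \<open>R\<close> centralizes the
      normal subgroup \<open>A\<close> of order \<open>p\<close>, so it lies in \<open>A\<close>;
      there both \<open>h\<close> and the \<open>p\<close>-element \<open>v\<close> act
      trivially.\<close>
    show "h1 \<otimes> y = y \<otimes> h1" if y: "y \<in> R" "y [^] p = \<one>" for y
    proof -
      have "y \<otimes> a = a \<otimes> y" if "a \<in> A" for a
        using p_element_centralizes_normal_of_prime_order[OF fin p(1) A_normal card_A R_carrier[OF y(1)], of 1 a]
          y(2) that by simp
      then have yA: "y \<in> A"
        using y x_R Rt R_carrier by (intro in_A) auto
      have "h \<otimes> y = y \<otimes> h"
        by (rule torus_and_involution_centralize(1)[OF A_normal card_A yA])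
      moreover have "v \<otimes> y = y \<otimes> v"
        by (rule p_element_centralizes_normal_of_prime_order[OF fin p(1) A_normal card_A _ _ yA])
          (use v pow_card_V in auto)
      ultimately have "y \<otimes> (h \<otimes> v) = (h \<otimes> v) \<otimes> y"
        using h v R_carrier[OF y(1)] by (intro commutes_mult) auto
      then show ?thesis
        by (simp add: h1_def)
    qed
  qed
  then obtain i where i: "\<And>g. g \<in> R \<Longrightarrow> h1 [^] (p ^ i :: nat) \<otimes> g = g \<otimes> h1 [^] (p ^ i)"
    by blast
  have uw: "u \<otimes> w \<in> R"
    using u(1) w P(2) by (auto simp: R_def)
  define M where "M = G Mod V"
  define \<pi> where "\<pi> = (\<lambda>a. V #> a)"
  interpret q: group_hom G M \<pi>
    unfolding group_hom_def group_hom_axioms_def M_def \<pi>_def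
    using V.r_coset_hom_Mod V.factorgroup_is_group is_group by blast
  have qV: "\<pi> a = \<one>\<^bsub>M\<^esub> \<longleftrightarrow> a \<in> V" if "a \<in> carrier G" for a
    unfolding \<pi>_def M_def using that coset_join1[OF _ _ V.subgroup_axioms] coset_join2[OF _ V.subgroup_axioms] V.subset by auto
  have uG: "u \<in> carrier G" and vG: "v \<in> carrier G" and wG: "w \<in> carrier G"
    using u(1) v(1) w(1) by auto
  have q_u: "\<pi> (u \<otimes> w) = \<pi> u"
    using q.hom_mult[OF uG wG] qV[OF wG] w(1) q.hom_closed[OF uG] by simp
  have q_h1: "\<pi> h1 = \<pi> h"
    unfolding h1_def using q.hom_mult[OF h(1) vG] qV[OF vG] v(1) q.hom_closed[OF h(1)] by simp
  \<comment> \<open>Modulo \<open>V\<close> the \<open>p\<close>-th power fixes \<open>h\<close>, so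
    passing to a \<open>p\<close>-power of \<open>h1\<close> loses nothing in the quotient.\<close>
  have hp: "\<pi> (h [^] p) = \<pi> h"
  proof -
    have "(\<pi> (h [^] p)) \<otimes>\<^bsub>M\<^esub> inv\<^bsub>M\<^esub> (\<pi> h) = \<one>\<^bsub>M\<^esub>"
      using h qV[of "h [^] p \<otimes> inv h"] q.hom_mult[of "h [^] p" "inv h"] by simp
    from q.H.inv_equality[OF this] show ?thesis
      using h(1) q.H.inv_inv[of "\<pi> h"] q.hom_closed by simp
  qed
  have hpi: "\<pi> (h [^] (p ^ i :: nat)) = \<pi> h" for i
  proof (induction i)
    case (Suc i)
    have "\<pi> (h [^] (p ^ Suc i)) = (\<pi> (h [^] (p ^ i))) [^]\<^bsub>M\<^esub> p"
      using h(1) q.hom_nat_pow[of "h [^] (p ^ i)" p] by (simp add: nat_pow_pow mult.commute)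
    also have "\<dots> = \<pi> (h [^] p)"
      using h(1) q.hom_nat_pow[of h p] by (simp add: Suc.IH)
    finally show ?case
      using hp by simp
  qed (use h in simp)
  have q_pow: "\<pi> (h1 [^] (p ^ i)) = \<pi> h"
    using q.hom_nat_pow[OF h1(1), of "p ^ i"] q.hom_nat_pow[OF h(1), of "p ^ i"] hpi[of i] by (simp add: q_h1)
  have "(\<pi> h) \<otimes>\<^bsub>M\<^esub> (\<pi> u) = \<pi> (h1 [^] (p ^ i) \<otimes> (u \<otimes> w))"
    using q.hom_mult[of "h1 [^] (p ^ i)" "u \<otimes> w"] h1 uG wG by (simp only: q_pow q_u) auto
  also have "\<dots> = (\<pi> u) \<otimes>\<^bsub>M\<^esub> (\<pi> h)"
    unfolding i[OF uw] using q.hom_mult[of "u \<otimes> w" "h1 [^] (p ^ i)"] h1 uG wG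
    by (simp only: q_pow q_u) auto
  finally have "(\<pi> h) \<otimes>\<^bsub>M\<^esub> (\<pi> u) \<otimes>\<^bsub>M\<^esub> inv\<^bsub>M\<^esub> (\<pi> h) \<otimes>\<^bsub>M\<^esub> inv\<^bsub>M\<^esub> (\<pi> u) = \<one>\<^bsub>M\<^esub>"
    using q.H.commutator_eq_one_iff q.hom_closed h(1) uG by blast
  then have "\<pi> (commutator h u) = \<one>\<^bsub>M\<^esub>"
    using h(1) uG q.hom_mult q.hom_inv by simp
  then show False
    using qV[of "commutator h u"] h uG by simp
qed

end

lemma (in Qd_extension) contradiction: False
proof -
  from coprime_critical_pair[OF fin p(1) V t(1) coprime_ord_t ex_noncentral]
  obtain D Z where "D \<lhd> G" "Z \<lhd> G" "D \<subseteq> V" "Z \<subset> D" "\<exists>d \<in> D. t \<otimes> d \<noteq> d \<otimes> t"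
    "\<forall>M. M \<lhd> G \<and> Z \<subseteq> M \<and> M \<subseteq> D \<longrightarrow> M = Z \<or> M = D"
    "\<forall>M. M \<lhd> G \<and> M \<subset> D \<longrightarrow> (\<forall>z \<in> M. t \<otimes> z = z \<otimes> t)"
    "\<forall>z \<in> Z. \<forall>d \<in> D. z \<otimes> d = d \<otimes> z" "\<forall>g \<in> V. \<forall>d \<in> D. commutator g d \<in> Z"
    "\<forall>d \<in> D. d [^] p \<in> Z"
    by (elim exE conjE) simp
  then have "Qd_extension_pair G p n m V Q P t u h D Z"
    unfolding Qd_extension_pair_def Qd_extension_pair_axioms_def using Qd_extension_axioms by simp
  then interpret Qd_extension_pair G p n m V Q P t u h D Z .
  show False
    using not_trivial_Z not_nontrivial_Z by blast
qed

section \<open>Computations in \<open>Qd(p)\<close>\<close>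

text \<open>Integer representatives reduce calculations in \<open>Qd(p)\<close> to congruences.\<close>

definition Qd_elem :: "nat \<Rightarrow> int \<Rightarrow> int \<Rightarrow> int \<Rightarrow> int \<Rightarrow> int \<Rightarrow> int \<Rightarrow> (int \<times> int) \<times> int mat2" where
  "Qd_elem p x y a b c d =
    ((x mod int p, y mod int p), ((a mod int p, b mod int p), (c mod int p, d mod int p)))"

lemma Qd_elem_eq_iff:
  "Qd_elem p x y a b c d = Qd_elem p x' y' a' b' c' d' \<longleftrightarrow>
    [x = x'] (mod int p) \<and> [y = y'] (mod int p) \<and> [a = a'] (mod int p) \<and> [b = b'] (mod int p) \<and>
    [c = c'] (mod int p) \<and> [d = d'] (mod int p)"
  by (auto simp: Qd_elem_def cong_def)

lemma Qd_elem_mult: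
  "Qd_elem p x y a b c d \<otimes>\<^bsub>Qd p\<^esub> Qd_elem p x' y' a' b' c' d' =
    Qd_elem p (x + (a * x' + b * y')) (y + (c * x' + d * y'))
      (a * a' + b * c') (a * b' + b * d') (c * a' + d * c') (c * b' + d * d')"
  by (simp add: Qd_def Let_def semidirect_product_def Qd_elem_def SL2_def mat2_mult_def mat2_vec_def
      residue_ring_def mod_simps)
    (intro conjI mod_add_cong mod_mult_cong; simp)

lemma Qd_one: "prime p \<Longrightarrow> \<one>\<^bsub>Qd p\<^esub> = Qd_elem p 0 0 1 0 0 1"
  using prime_gt_1_nat[of p]
  by (simp add: Qd_def Let_def semidirect_product_def Qd_elem_def SL2_def residue_ring_def)

lemma Qd_carrier:
  assumes "prime p"
  shows "carrier (Qd p) = {Qd_elem p x y a b c d | x y a b c d. [a * d - b * c = 1] (mod int p)}"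
proof -
  have p1: "int p > 1"
    using prime_gt_1_nat[OF assms] by simp
  define F where "F = residue_ring (int p)"
  interpret residues "int p" F
    by unfold_locales (use p1 in \<open>auto simp: F_def\<close>)
  have F: "carrier F = {0..int p - 1}"
    by (simp add: F_def residue_ring_def)
  have det: "det2 F ((a, b), (c, d)) = (a * d - b * c) mod int p" for a b c d
    by (simp add: det2_def a_minus_def res_neg_eq res_add_eq res_mult_eq mod_simps)
  have car: "carrier (Qd p) = {((x, y), ((a, b), (c, d))) | x y a b c d.
      {x, y, a, b, c, d} \<subseteq> {0..int p - 1} \<and> (a * d - b * c) mod int p = 1}"
    unfolding Qd_def Let_def F_def[symmetric]
    by (auto simp: semidirect_product_def SL2_def F det res_one_eq)
  show ?thesis
  proof (intro equalityI subsetI)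
    fix g assume "g \<in> carrier (Qd p)"
    then obtain x y a b c d where g: "g = ((x, y), ((a, b), (c, d)))"
      "{x, y, a, b, c, d} \<subseteq> {0..int p - 1}" "(a * d - b * c) mod int p = 1"
      unfolding car by auto
    then have "g = Qd_elem p x y a b c d"
      by (simp add: Qd_elem_def)
    moreover have "[a * d - b * c = 1] (mod int p)"
      using g(3) p1 by (simp add: cong_def)
    ultimately show "g \<in> {Qd_elem p x y a b c d | x y a b c d. [a * d - b * c = 1] (mod int p)}"
      by blast
  next
    fix g assume "g \<in> {Qd_elem p x y a b c d | x y a b c d. [a * d - b * c = 1] (mod int p)}"
    then obtain x y a b c d where g: "g = Qd_elem p x y a b c d" "(a * d - b * c) mod int p = 1"
      using p1 by (auto simp: cong_def)
    have "(a mod int p * (d mod int p) - b mod int p * (c mod int p)) mod int p = (a * d - b * c) mod int p"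
      by (intro mod_diff_cong mod_mult_cong) simp_all
    with g show "g \<in> carrier (Qd p)"
      unfolding car using p1 by (auto simp: Qd_elem_def)
  qed
qed

lemma Qd_elem_in_carrier:
  "\<lbrakk>prime p; [a * d - b * c = 1] (mod int p)\<rbrakk> \<Longrightarrow> Qd_elem p x y a b c d \<in> carrier (Qd p)"
  unfolding Qd_carrier by blast

section \<open>Preimages under homomorphisms\<close>

lemma (in group_hom) subgroup_vimage:
  assumes "subgroup S H"
  shows "subgroup {g \<in> carrier G. h g \<in> S} G"
proof -
  interpret S: subgroup S H by fact
  show ?thesis
    by (rule G.subgroupI) (auto intro!: exI[of _ "\<one>"])
qed

lemma (in group_hom) normal_vimage:
  assumes "S \<lhd> H"
  shows "{g \<in> carrier G. h g \<in> S} \<lhd> G"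
proof -
  interpret S: normal S H by fact
  show ?thesis
    unfolding G.normal_inv_iff using subgroup_vimage[OF S.subgroup_axioms] S.inv_op_closed2 by simp
qed

lemma (in group_hom) card_vimage:
  assumes "finite (carrier G)" "subgroup S H" "S \<subseteq> h ` carrier G"
  shows "card {g \<in> carrier G. h g \<in> S} = card S * card (kernel G H h)"
proof -
  let ?V = "{g \<in> carrier G. h g \<in> S}"
  interpret S: subgroup S H by fact
  have V: "subgroup ?V G"
    using assms(2) by (rule subgroup_vimage)
  have "group_hom (G\<lparr>carrier := ?V\<rparr>) H h"
    using G.subgroup_imp_group[OF V] by (simp add: group_hom_def group_hom_axioms_def hom_def)
  then interpret V: group_hom "G\<lparr>carrier := ?V\<rparr>" H h .
  have "h ` ?V = S"
    using assms(3) by blast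
  moreover have "kernel (G\<lparr>carrier := ?V\<rparr>) H h = kernel G H h"
    by (auto simp: kernel_def)
  ultimately show ?thesis
    using V.card_image_mult_card_kernel assms(1) by (simp add: order_def)
qed

text \<open>Commutators in \<open>Qd p\<close> are verified from products alone, without computing
  inverses there.\<close>

lemma (in group) commutator_eqI:
  assumes "x \<in> carrier G" "y \<in> carrier G" "z \<in> carrier G" "x \<otimes> y = z \<otimes> y \<otimes> x"
  shows "commutator x y = z"
  using assms by (simp add: m_assoc)

section \<open>Powers and distinguished subgroups of \<open>Qd p\<close>\<close>

lemma Qd_translation_pow:
  assumes "prime p"
  shows "Qd_elem p x y 1 0 0 1 [^]\<^bsub>Qd p\<^esub> (k::nat) = Qd_elem p (int k * x) (int k * y) 1 0 0 1"
  by (induction k) (simp_all add: Qd_one[OF assms] Qd_elem_mult algebra_simps)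

lemma Qd_upper_pow:
  assumes "prime p"
  shows "Qd_elem p 0 0 1 b 0 1 [^]\<^bsub>Qd p\<^esub> (k::nat) = Qd_elem p 0 0 1 (int k * b) 0 1"
  by (induction k) (simp_all add: Qd_one[OF assms] Qd_elem_mult algebra_simps)

lemma Qd_lower_pow:
  assumes "prime p"
  shows "Qd_elem p 0 0 1 0 c 1 [^]\<^bsub>Qd p\<^esub> (k::nat) = Qd_elem p 0 0 1 0 (int k * c) 1"
  by (induction k) (simp_all add: Qd_one[OF assms] Qd_elem_mult algebra_simps)

lemma Qd_diag_pow:
  assumes "prime p"
  shows "Qd_elem p 0 0 a 0 0 d [^]\<^bsub>Qd p\<^esub> (k::nat) = Qd_elem p 0 0 (a ^ k) 0 0 (d ^ k)"
  by (induction k) (simp_all add: Qd_one[OF assms] Qd_elem_mult mult.commute)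

definition Qd_translations :: "nat \<Rightarrow> ((int \<times> int) \<times> int mat2) set" where
  "Qd_translations p = {Qd_elem p x y 1 0 0 1 | x y. True}"

definition Qd_unitriangular :: "nat \<Rightarrow> ((int \<times> int) \<times> int mat2) set" where
  "Qd_unitriangular p = {Qd_elem p x y 1 b 0 1 | x y b. True}"

lemma Qd_translationsI: "Qd_elem p x y 1 0 0 1 \<in> Qd_translations p"
  by (auto simp: Qd_translations_def)

lemma Qd_unitriangularI: "Qd_elem p x y 1 b 0 1 \<in> Qd_unitriangular p"
  by (auto simp: Qd_unitriangular_def)

lemma card_Qd_translations:
  assumes "prime p"
  shows "card (Qd_translations p) = p\<^sup>2"
proof -
  let ?f = "\<lambda>(x, y). Qd_elem p x y 1 0 0 1" and ?I = "{0..<int p}"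
  have "Qd_elem p x y 1 0 0 1 \<in> ?f ` (?I \<times> ?I)" for x y
    using prime_gt_0_nat[OF assms]
    by (intro image_eqI[of _ _ "(x mod int p, y mod int p)"]) (auto simp: Qd_elem_eq_iff)
  then have "Qd_translations p = ?f ` (?I \<times> ?I)"
    by (auto simp: Qd_translations_def)
  moreover have "inj_on ?f (?I \<times> ?I)"
    by (auto simp: inj_on_def Qd_elem_def)
  ultimately show ?thesis
    by (simp add: card_image card_cartesian_product power2_eq_square)
qed

lemma card_Qd_unitriangular:
  assumes "prime p"
  shows "card (Qd_unitriangular p) = p ^ 3"
proof -
  let ?f = "\<lambda>(x, y, b). Qd_elem p x y 1 b 0 1" and ?I = "{0..<int p}"
  have "Qd_elem p x y 1 b 0 1 \<in> ?f ` (?I \<times> ?I \<times> ?I)" for x y b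
    using prime_gt_0_nat[OF assms]
    by (intro image_eqI[of _ _ "(x mod int p, y mod int p, b mod int p)"]) (auto simp: Qd_elem_eq_iff)
  then have "Qd_unitriangular p = ?f ` (?I \<times> ?I \<times> ?I)"
    by (auto simp: Qd_unitriangular_def)
  moreover have "inj_on ?f (?I \<times> ?I \<times> ?I)"
    by (auto simp: inj_on_def Qd_elem_def)
  ultimately show ?thesis
    by (simp add: card_image card_cartesian_product power3_eq_cube)
qed

lemma subgroup_Qd_unitriangular:
  assumes p: "prime p"
  shows "subgroup (Qd_unitriangular p) (Qd p)"
proof -
  interpret Qd: group "Qd p"
    using p by (rule group_Qd)
  show ?thesis
  proof (rule Qd.subgroupI)
    show "Qd_unitriangular p \<subseteq> carrier (Qd p)"
      by (auto simp: Qd_unitriangular_def intro!: Qd_elem_in_carrier[OF p])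
    show "Qd_unitriangular p \<noteq> {}"
      using Qd_unitriangularI by blast
  next
    fix g assume "g \<in> Qd_unitriangular p"
    then obtain x y b where g: "g = Qd_elem p x y 1 b 0 1"
      by (auto simp: Qd_unitriangular_def)
    \<comment> \<open>The inverse of (v, A) is (-A^-1 v, A^-1).\<close>
    have "inv\<^bsub>Qd p\<^esub> g = Qd_elem p (b * y - x) (- y) 1 (- b) 0 1"
      by (rule Qd.inv_equality)
        (auto simp: g Qd_elem_mult Qd_one[OF p] intro!: Qd_elem_in_carrier[OF p])
    then show "inv\<^bsub>Qd p\<^esub> g \<in> Qd_unitriangular p"
      by (simp add: Qd_unitriangularI)
  next
    fix g h assume "g \<in> Qd_unitriangular p" "h \<in> Qd_unitriangular p"
    then obtain x y b x' y' b' where "g = Qd_elem p x y 1 b 0 1" "h = Qd_elem p x' y' 1 b' 0 1"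
      by (auto simp: Qd_unitriangular_def)
    then show "g \<otimes>\<^bsub>Qd p\<^esub> h \<in> Qd_unitriangular p"
      by (simp add: Qd_elem_mult Qd_unitriangularI)
  qed
qed

lemma normal_Qd_translations:
  assumes p: "prime p"
  shows "Qd_translations p \<lhd> Qd p"
proof -
  interpret Qd: group "Qd p"
    using p by (rule group_Qd)
  have sub: "Qd_translations p \<subseteq> carrier (Qd p)"
    by (auto simp: Qd_translations_def intro!: Qd_elem_in_carrier[OF p])
  have "subgroup (Qd_translations p) (Qd p)"
  proof (rule Qd.subgroupI)
    show "Qd_translations p \<noteq> {}"
      using Qd_translationsI by blast
  next
    fix g assume "g \<in> Qd_translations p"
    then obtain x y where g: "g = Qd_elem p x y 1 0 0 1"
      by (auto simp: Qd_translations_def)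
    have "inv\<^bsub>Qd p\<^esub> g = Qd_elem p (- x) (- y) 1 0 0 1"
      by (rule Qd.inv_equality)
        (auto simp: g Qd_elem_mult Qd_one[OF p] intro!: Qd_elem_in_carrier[OF p])
    then show "inv\<^bsub>Qd p\<^esub> g \<in> Qd_translations p"
      by (simp add: Qd_translationsI)
  next
    fix g h assume "g \<in> Qd_translations p" "h \<in> Qd_translations p"
    then obtain x y x' y' where "g = Qd_elem p x y 1 0 0 1" "h = Qd_elem p x' y' 1 0 0 1"
      by (auto simp: Qd_translations_def)
    then show "g \<otimes>\<^bsub>Qd p\<^esub> h \<in> Qd_translations p"
      by (simp add: Qd_elem_mult Qd_translationsI)
  qed (rule sub)
  moreover have "g \<otimes>\<^bsub>Qd p\<^esub> v \<otimes>\<^bsub>Qd p\<^esub> inv\<^bsub>Qd p\<^esub> g \<in> Qd_translations p"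
    if "g \<in> carrier (Qd p)" "v \<in> Qd_translations p" for g v
  proof -
    obtain x y a b c d where g: "g = Qd_elem p x y a b c d"
      using \<open>g \<in> carrier (Qd p)\<close> by (auto simp: Qd_carrier[OF p])
    obtain x' y' where v: "v = Qd_elem p x' y' 1 0 0 1"
      using \<open>v \<in> Qd_translations p\<close> by (auto simp: Qd_translations_def)
    define w where "w = Qd_elem p (a * x' + b * y') (c * x' + d * y') 1 0 0 1"
    have w: "w \<in> carrier (Qd p)"
      using sub by (auto simp: w_def intro: Qd_translationsI)
    have "g \<otimes>\<^bsub>Qd p\<^esub> v = w \<otimes>\<^bsub>Qd p\<^esub> g"
      by (simp add: g v w_def Qd_elem_mult add.commute)
    then have "g \<otimes>\<^bsub>Qd p\<^esub> v \<otimes>\<^bsub>Qd p\<^esub> inv\<^bsub>Qd p\<^esub> g = w"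
      using that(1) w by (simp add: Qd.m_assoc)
    then show ?thesis
      by (simp add: w_def Qd_translationsI)
  qed
  ultimately show ?thesis
    by (simp add: Qd.normal_inv_iff)
qed

text \<open>If there were no such subgroup, suitable lifts to \<open>G\<close> would satisfy
  \<open>Qd_extension\<close>, which is contradictory; its conditions are mostly checked on images
  in \<open>Qd p\<close>.\<close>

lemma Qd_hom_p_kernel_imp_elementary_abelian:
  assumes "group G" and fin: "finite (carrier G)" and p: "prime p" "p > 3"
    and \<phi>: "\<phi> \<in> hom G (Qd p)" "\<phi> ` carrier G = carrier (Qd p)"
    and ker: "card (kernel G (Qd p) \<phi>) = p ^ a" "a \<noteq> 0"
  shows "\<exists>A. subgroup A G \<and> elementary_abelian p (G\<lparr>carrier := A\<rparr>) \<and> card A = p ^ 3"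
proof (rule ccontr)
  assume rank: "\<not> ?thesis"
  interpret G: group G by fact
  interpret Qd: group "Qd p"
    using p(1) by (rule group_Qd)
  interpret group_hom G "Qd p" \<phi>
    using \<phi>(1) by unfold_locales
  note in_Qd = Qd_elem_in_carrier[OF p(1)] and Qd_1 = Qd_one[OF p(1)]
  define V where "V = {g \<in> carrier G. \<phi> g \<in> Qd_translations p}"
  define Q where "Q = kernel G (Qd p) \<phi>"
  define P where "P = {g \<in> carrier G. \<phi> g \<in> Qd_unitriangular p}"
  have Q_iff: "g \<in> Q \<longleftrightarrow> \<phi> g = Qd_elem p 0 0 1 0 0 1" if "g \<in> carrier G" for g
    using that by (simp add: Q_def kernel_def Qd_1)
  have V_iff: "g \<in> V \<longleftrightarrow> (\<exists>x y. \<phi> g = Qd_elem p x y 1 0 0 1)" if "g \<in> carrier G" for g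
    using that by (simp add: V_def Qd_translations_def)
  have P_iff: "g \<in> P \<longleftrightarrow> (\<exists>x y b. \<phi> g = Qd_elem p x y 1 b 0 1)" if "g \<in> carrier G" for g
    using that by (simp add: P_def Qd_unitriangular_def)
  have Qd_rep: "\<exists>x y a b c d. \<phi> g = Qd_elem p x y a b c d" if "g \<in> carrier G" for g
    using hom_closed[OF that] unfolding Qd_carrier[OF p(1)] by blast
  have Q_pow: "g [^]\<^bsub>G\<^esub> (p ^ a) = \<one>\<^bsub>G\<^esub>" if "g \<in> Q" for g
    using G.pow_card_subgroup[OF subgroup_kernel, of g] that ker(1) by (simp add: Q_def)
  have surj: "\<exists>g \<in> carrier G. \<phi> g = Qd_elem p x y a b c d" if "[a * d - b * c = 1] (mod int p)"
    for x y a b c d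
    using in_Qd[OF that, of x y] unfolding \<phi>(2)[symmetric] by force
  have commI: "\<phi> (G.commutator x y) = z" if "x \<in> carrier G" "y \<in> carrier G" "z \<in> carrier (Qd p)"
    "\<phi> x \<otimes>\<^bsub>Qd p\<^esub> \<phi> y = z \<otimes>\<^bsub>Qd p\<^esub> \<phi> y \<otimes>\<^bsub>Qd p\<^esub> \<phi> x" for x y z
    using Qd.commutator_eqI[OF hom_closed[OF that(1)] hom_closed[OF that(2)] that(3,4)] that(1,2) by simp
  have odd: "odd p"
    using p prime_odd_nat[of p] by simp
  obtain t0 where t0: "t0 \<in> carrier G" "\<phi> t0 = Qd_elem p 0 0 (-1) 0 0 (-1)"
    using surj[of "-1" "-1" 0 0 0 0] by auto
  \<comment> \<open>The square of \<open>t0\<close> lies in the \<open>p\<close>-group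
    \<open>Q\<close>, so a high \<open>p\<close>-power of \<open>t0\<close> is a true involution;
    the exponent is odd and keeps the image -1.\<close>
  define t where "t = t0 [^]\<^bsub>G\<^esub> (p ^ a)"
  have t: "t \<in> carrier G" "\<phi> t = Qd_elem p 0 0 (-1) 0 0 (-1)"
    using t0 odd by (auto simp: t_def hom_nat_pow Qd_diag_pow[OF p(1)])
  have tt: "t \<otimes>\<^bsub>G\<^esub> t = \<one>\<^bsub>G\<^esub>"
  proof -
    have "t0 \<otimes>\<^bsub>G\<^esub> t0 \<in> Q"
      using t0 by (simp add: Q_iff Qd_elem_mult)
    from Q_pow[OF this] show ?thesis
      using t0(1) by (simp add: t_def G.pow_mult_distrib)
  qed
  obtain u where u: "u \<in> carrier G" "\<phi> u = Qd_elem p 0 0 1 1 0 1"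
    using surj[of 1 1 1 0 0 0] by auto
  obtain y where y: "y \<in> carrier G" "\<phi> y = Qd_elem p 0 0 1 0 1 1"
    using surj[of 1 1 0 1 0 0] by auto
  define r where "r = (p - 1) div 2"
  have r: "int p = 2 * int r + 1"
    using odd p(2) by (auto simp: r_def elim!: oddE)
  \<comment> \<open>with \<open>-2 r \<equiv> 1\<close>, so that \<open>h\<close> is \<open>diag(2, 1/2)\<close> written as a product of transvections\<close>
  define h where "h = y [^]\<^bsub>G\<^esub> r \<otimes>\<^bsub>G\<^esub> u \<otimes>\<^bsub>G\<^esub> y \<otimes>\<^bsub>G\<^esub> u [^]\<^bsub>G\<^esub> r"
  have h: "h \<in> carrier G"
    using u y by (simp add: h_def)
  have "\<phi> h = Qd_elem p 0 0 2 (2 * int r + 1) (2 * int r + 1) (int r * (2 * int r + 1) + int r + 1)"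
    using u y by (simp add: h_def hom_nat_pow Qd_upper_pow[OF p(1)] Qd_lower_pow[OF p(1)] Qd_elem_mult algebra_simps)
  \<comment> \<open>As \<open>2 * r + 1 = p\<close>, the off-diagonal entries vanish and
    \<open>r + 1\<close> is the inverse of 2 modulo \<open>p\<close>.\<close>
  also have "\<dots> = Qd_elem p 0 0 2 0 0 (int r + 1)"
    unfolding r[symmetric] by (simp add: Qd_elem_eq_iff cong_iff_dvd_diff)
  finally have \<phi>h: "\<phi> h = Qd_elem p 0 0 2 0 0 (int r + 1)" .
  have two_r: "[2 * (int r + 1) = 1] (mod int p)"
    by (simp add: cong_iff_dvd_diff r add.commute)
  have two_r': "[4 * b * (int r + 1) = 2 * b] (mod int p)" for b
    using cong_scalar_left[OF two_r, of "2 * b"] by (simp add: mult_ac)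
  have fermat: "[int x ^ p = int x] (mod int p)" if "0 < x" "x < p" for x
  proof -
    have "[x ^ (p - 1) = 1] (mod p)"
      using that p(1) by (intro fermat_theorem) (auto dest: dvd_imp_le)
    then have "[x ^ (p - 1) * x = 1 * x] (mod p)"
      by (rule cong_scalar_right)
    moreover have "x ^ (p - 1) * x = x ^ p"
      using p(2) by (simp flip: power_Suc2)
    ultimately have "[x ^ p = x] (mod p)"
      by (simp only: mult_1)
    then show ?thesis
      by (simp flip: cong_int_iff)
  qed
  have p_elem: "\<exists>k. g [^]\<^bsub>G\<^esub> (p ^ k) = \<one>\<^bsub>G\<^esub>" if "g \<in> carrier G" "g [^]\<^bsub>G\<^esub> p \<in> Q" for g
    using Q_pow[OF that(2)] that(1) by (intro exI[of _ "Suc a"]) (simp add: G.nat_pow_pow)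
  have uQ: "u [^]\<^bsub>G\<^esub> p \<in> Q" and yQ: "y [^]\<^bsub>G\<^esub> p \<in> Q"
    using u y by (auto simp: Q_iff hom_nat_pow Qd_upper_pow[OF p(1)] Qd_lower_pow[OF p(1)]
        Qd_elem_eq_iff cong_def)
  have card_V: "card V = p\<^sup>2 * card Q"
    unfolding V_def Q_def using card_vimage[OF fin normal_imp_subgroup[OF normal_Qd_translations[OF p(1)]]]
      \<phi>(2) normal_imp_subgroup[OF normal_Qd_translations[OF p(1)], THEN subgroup.subset]
    by (simp add: card_Qd_translations[OF p(1)])
  have card_P: "card P = p ^ 3 * card Q"
    unfolding P_def Q_def using card_vimage[OF fin subgroup_Qd_unitriangular[OF p(1)]]
      \<phi>(2) subgroup.subset[OF subgroup_Qd_unitriangular[OF p(1)]]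
    by (simp add: card_Qd_unitriangular[OF p(1)])
  have V_normal: "V \<lhd> G"
    unfolding V_def by (rule normal_vimage[OF normal_Qd_translations[OF p(1)]])
  have VG: "v \<in> carrier G" if "v \<in> V" for v
    using that by (simp add: V_def)
  \<comment> \<open>The transvection sends (x, y) to (x + y, y), so [u, v] is the translation by (y,
    0) and a second commutator with \<open>u\<close> is trivial modulo \<open>Q\<close>.\<close>
  have u_comm: "\<phi> (G.commutator u v) = Qd_elem p y 0 1 0 0 1"
    if "v \<in> V" "\<phi> v = Qd_elem p x y 1 0 0 1" for v x y
    using that u VG by (intro commI) (auto simp: Qd_elem_mult add.commute intro: in_Qd)
  have "Qd_extension G p (2 + a) (3 + a) V Q P t u h"
    unfolding Qd_extension_def Qd_extension_axioms_def
  proof (intro conjI)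
    show "V \<lhd> G" by (rule V_normal)
    show "card V = p ^ (2 + a)" "card P = p ^ (3 + a)" "card V = p\<^sup>2 * card Q"
      unfolding power_add using card_V card_P ker(1) by (simp_all only: Q_def)
    show "Q \<lhd> G"
      unfolding Q_def by (rule normal_kernel)
    show "Q \<subseteq> V"
      by (auto simp: Q_def kernel_def V_def Qd_1 Qd_translationsI)
    show "Q \<noteq> {\<one>\<^bsub>G\<^esub>}"
      using ker p(2) one_less_power[of p a] by (auto simp: Q_def)
    show "\<forall>v \<in> V. v [^]\<^bsub>G\<^esub> p \<in> Q"
    proof
      fix v assume v: "v \<in> V"
      then obtain x y where "\<phi> v = Qd_elem p x y 1 0 0 1"
        using V_iff VG by blast
      then show "v [^]\<^bsub>G\<^esub> p \<in> Q"
        using VG[OF v] by (simp add: Q_iff hom_nat_pow Qd_translation_pow[OF p(1)] Qd_elem_eq_iff cong_def)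
    qed
    show "subgroup P G"
      unfolding P_def by (rule subgroup_vimage[OF subgroup_Qd_unitriangular[OF p(1)]])
    show "V \<subseteq> P"
    proof
      fix v assume "v \<in> V"
      then obtain x y where "v \<in> carrier G" "\<phi> v = Qd_elem p x y 1 0 0 1"
        by (auto simp: V_def Qd_translations_def)
      then show "v \<in> P"
        by (simp add: P_def Qd_unitriangularI)
    qed
    show "\<forall>g \<in> P. h \<otimes>\<^bsub>G\<^esub> g \<otimes>\<^bsub>G\<^esub> inv\<^bsub>G\<^esub> h \<in> P"
    proof
      fix g assume "g \<in> P"
      then obtain x y b where g: "g \<in> carrier G" "\<phi> g = Qd_elem p x y 1 b 0 1"
        by (auto simp: P_def Qd_unitriangular_def)
      \<comment> \<open>Conjugation by diag(2, 1/2) multiplies the upper right entry by 4.\<close>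
      define w where "w = Qd_elem p (2 * x) ((int r + 1) * y) 1 (4 * b) 0 1"
      have w: "w \<in> carrier (Qd p)"
        unfolding w_def by (intro in_Qd) simp
      have "\<phi> h \<otimes>\<^bsub>Qd p\<^esub> \<phi> g = w \<otimes>\<^bsub>Qd p\<^esub> \<phi> h"
        using two_r'[of b] by (simp add: \<phi>h g w_def Qd_elem_mult Qd_elem_eq_iff cong_sym)
      then have "\<phi> (h \<otimes>\<^bsub>G\<^esub> g \<otimes>\<^bsub>G\<^esub> inv\<^bsub>G\<^esub> h) = w"
        using h g w hom_closed[OF h] by (simp add: Qd.m_assoc)
      then show "h \<otimes>\<^bsub>G\<^esub> g \<otimes>\<^bsub>G\<^esub> inv\<^bsub>G\<^esub> h \<in> P"
        using h g by (simp add: P_def w_def Qd_unitriangularI)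
    qed
    show "\<forall>g \<in> carrier G. G.commutator t g \<in> V"
    proof
      fix g assume g: "g \<in> carrier G"
      then obtain x y a b c d where "\<phi> g = Qd_elem p x y a b c d"
        using Qd_rep by blast
      then have "\<phi> (G.commutator t g) = Qd_elem p (- 2 * x) (- 2 * y) 1 0 0 1"
        using g t by (intro commI) (auto simp: Qd_elem_mult intro: in_Qd)
      then show "G.commutator t g \<in> V"
        using g t by (simp add: V_def Qd_translationsI)
    qed
    show "\<forall>v \<in> V. t \<otimes>\<^bsub>G\<^esub> v \<otimes>\<^bsub>G\<^esub> t \<otimes>\<^bsub>G\<^esub> v \<in> Q"
    proof
      fix v assume v: "v \<in> V"
      then obtain x y where "\<phi> v = Qd_elem p x y 1 0 0 1"
        using V_iff VG by blast
      then show "t \<otimes>\<^bsub>G\<^esub> v \<otimes>\<^bsub>G\<^esub> t \<otimes>\<^bsub>G\<^esub> v \<in> Q"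
        using VG[OF v] t by (simp add: Q_iff Qd_elem_mult)
    qed
    show "u \<in> P"
      using u by (simp add: P_def Qd_unitriangularI)
    show "u [^]\<^bsub>G\<^esub> p \<in> V"
      using uQ by (auto simp: Q_def kernel_def V_def Qd_1 Qd_translationsI)
    show "\<forall>v \<in> V. G.commutator u (G.commutator u v) \<in> Q"
    proof
      fix v assume v: "v \<in> V"
      then obtain x y where "\<phi> v = Qd_elem p x y 1 0 0 1"
        using V_iff VG by blast
      then have c: "\<phi> (G.commutator u v) = Qd_elem p y 0 1 0 0 1"
        by (rule u_comm[OF v])
      then have "G.commutator u v \<in> V"
        using u VG[OF v] by (simp add: V_def Qd_translationsI)
      from u_comm[OF this c] show "G.commutator u (G.commutator u v) \<in> Q"
        using u VG[OF v] by (simp add: Q_iff del: hom_mult)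
    qed
    show "\<exists>v \<in> V. G.commutator u v \<notin> Q"
    proof -
      obtain v where v: "v \<in> carrier G" "\<phi> v = Qd_elem p 0 1 1 0 0 1"
        using surj[of 1 1 0 0 0 1] by auto
      then have "v \<in> V"
        by (simp add: V_def Qd_translationsI)
      moreover have "G.commutator u v \<notin> Q"
        using u_comm[OF \<open>v \<in> V\<close> v(2)] u v p(2) by (simp add: Q_iff Qd_elem_eq_iff cong_def del: hom_mult)
      ultimately show ?thesis by blast
    qed
    show "h [^]\<^bsub>G\<^esub> p \<otimes>\<^bsub>G\<^esub> inv\<^bsub>G\<^esub> h \<in> V"
    proof -
      have "\<phi> h [^]\<^bsub>Qd p\<^esub> p = \<phi> h"
        using fermat[of 2] fermat[of "Suc r"] p(2) r
        by (simp add: \<phi>h Qd_diag_pow[OF p(1)] Qd_elem_eq_iff add.commute)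
      then have "\<phi> (h [^]\<^bsub>G\<^esub> p \<otimes>\<^bsub>G\<^esub> inv\<^bsub>G\<^esub> h) = \<one>\<^bsub>Qd p\<^esub>"
        using h hom_closed[OF h] by (simp add: hom_nat_pow)
      then show ?thesis
        using h Qd_translationsI[of p 0 0] by (simp add: V_def Qd_1)
    qed
    show "G.commutator h u \<notin> V"
    proof
      assume "G.commutator h u \<in> V"
      then obtain x y where c: "\<phi> (G.commutator h u) = Qd_elem p x y 1 0 0 1"
        using V_iff h u by (auto simp: V_def Qd_translations_def)
      have "h \<otimes>\<^bsub>G\<^esub> u = G.commutator h u \<otimes>\<^bsub>G\<^esub> u \<otimes>\<^bsub>G\<^esub> h"
        using h u by (simp add: G.m_assoc)
      then have "\<phi> (h \<otimes>\<^bsub>G\<^esub> u) = \<phi> (G.commutator h u \<otimes>\<^bsub>G\<^esub> u \<otimes>\<^bsub>G\<^esub> h)"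
        by simp
      also have "\<dots> = \<phi> (G.commutator h u) \<otimes>\<^bsub>Qd p\<^esub> \<phi> u \<otimes>\<^bsub>Qd p\<^esub> \<phi> h"
        using h u by (simp only: hom_mult G.m_closed G.inv_closed)
      finally have "\<phi> h \<otimes>\<^bsub>Qd p\<^esub> \<phi> u = Qd_elem p x y 1 0 0 1 \<otimes>\<^bsub>Qd p\<^esub> \<phi> u \<otimes>\<^bsub>Qd p\<^esub> \<phi> h"
        unfolding c using h u by simp
      \<comment> \<open>The upper right entries are compared. Doubling gives 4 = 1 modulo
        \<open>p\<close>, excluded by p > 3.\<close>
      then have "[2 = int r + 1] (mod int p)"
        by (simp add: \<phi>h u Qd_elem_mult Qd_elem_eq_iff)
      then have "[2 * 2 = 2 * (int r + 1)] (mod int p)"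
        by (rule cong_scalar_left)
      from cong_trans[OF this two_r] have "int p dvd 3"
        by (simp add: cong_iff_dvd_diff)
      then have "p \<le> 3"
        using zdvd_imp_le[of "int p" 3] by simp
      with p(2) show False by simp
    qed
    show "\<forall>K. subgroup K G \<and> (\<forall>g \<in> carrier G. (\<exists>k. g [^]\<^bsub>G\<^esub> (p ^ k :: nat) = \<one>\<^bsub>G\<^esub>) \<longrightarrow> g \<in> K) \<longrightarrow>
        h \<in> K \<and> t \<in> K"
    proof (intro allI impI)
      fix K assume K: "subgroup K G \<and> (\<forall>g \<in> carrier G. (\<exists>k. g [^]\<^bsub>G\<^esub> (p ^ k) = \<one>\<^bsub>G\<^esub>) \<longrightarrow> g \<in> K)"
      then interpret K: subgroup K G by blast
      have uK: "u \<in> K" and yK: "y \<in> K"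
        using K p_elem u y uQ yQ by blast+
      have QK: "g \<in> K" if "g \<in> Q" for g
        using K Q_pow[OF that] that by (auto simp: Q_def kernel_def)
      note K_pow = G.subgroup_nat_pow_closed[OF K.subgroup_axioms]
      have "h \<in> K"
        unfolding h_def using K_pow uK yK by simp
      \<comment> \<open>Modulo \<open>Q\<close> the power \<open>y [^] (p - 1)\<close> is the
        inverse of \<open>y\<close>, so \<open>s\<close> lifts the matrix with rows (0, 1) and (-1,
        0), whose square is -1. Hence \<open>t\<close> is the square of \<open>s\<close> up to an
        element of \<open>Q\<close>.\<close>
      define s where "s = u \<otimes>\<^bsub>G\<^esub> y [^]\<^bsub>G\<^esub> (p - 1) \<otimes>\<^bsub>G\<^esub> u"
      have s: "s \<in> K"
        unfolding s_def using K_pow uK yK by simp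
      have "\<phi> s = Qd_elem p 0 0 (int p) (int p + 1) (int p - 1) (int p)"
        using u y p(2) by (simp add: s_def hom_nat_pow Qd_lower_pow[OF p(1)] Qd_elem_mult of_nat_diff)
      also have "\<dots> = Qd_elem p 0 0 0 1 (- 1) 0"
        by (simp add: Qd_elem_eq_iff cong_iff_dvd_diff)
      finally have "\<phi> (s \<otimes>\<^bsub>G\<^esub> s) = \<phi> t"
        using s by (simp add: t Qd_elem_mult)
      moreover define q where "q = inv\<^bsub>G\<^esub> (s \<otimes>\<^bsub>G\<^esub> s) \<otimes>\<^bsub>G\<^esub> t"
      ultimately have "q \<in> Q"
        using s t(1) hom_closed[OF t(1)] by (simp add: Q_def kernel_def)
      then have "s \<otimes>\<^bsub>G\<^esub> s \<otimes>\<^bsub>G\<^esub> q \<in> K"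
        using s QK by simp
      then have "t \<in> K"
        using s t(1) by (simp add: q_def G.inv_mult_group G.m_assoc)
      with \<open>h \<in> K\<close> show "h \<in> K \<and> t \<in> K" by simp
    qed
  qed (use p h t tt rank fin in auto)
  then show False
    by (rule Qd_extension.contradiction)
qed

section \<open>Reduction to kernels of \<open>p\<close>-power order\<close>

text \<open>\<open>A\<close> acts by right translation on the right cosets of \<open>P\<close>.
  Their number is prime to \<open>p\<close>, so some coset \<open>P #> x\<close> is fixed, and
  conjugation by \<open>x\<close> takes \<open>A\<close> into \<open>P\<close>.\<close>

lemma (in group) p_subgroup_conj_into_sylow:
  assumes fin: "finite (carrier G)" and p: "prime p" and P: "sylow_subgroup p P G"
    and A: "subgroup A G" "card A = p ^ k"
  obtains x where "x \<in> carrier G" "\<And>a. a \<in> A \<Longrightarrow> x \<otimes> a \<otimes> inv x \<in> P"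
proof -
  have P': "subgroup P G" "card P = p ^ multiplicity p (order G)"
    using P by (auto simp: sylow_subgroup_def)
  interpret P: subgroup P G by (rule P'(1))
  interpret A: subgroup A G by (rule A(1))
  \<comment> \<open>The inverse turns right translation into a left action.\<close>
  define f where "f a C = C #> inv a" for a C
  have f: "f a (P #> x) = P #> (x \<otimes> inv a)" if "a \<in> A" "x \<in> carrier G" for a x
    using that by (simp add: f_def coset_mult_assoc P.subset)
  let ?E = "(\<lambda>x. P #> x) ` carrier G"
  have "[card ?E = card {C \<in> ?E. \<forall>a \<in> carrier (G\<lparr>carrier := A\<rparr>). f a C = C}] (mod p)"
  proof (rule group.p_group_fixed_points)
    show "group (G\<lparr>carrier := A\<rparr>)"
      using A(1) by (rule subgroup_imp_group)
    show "order (G\<lparr>carrier := A\<rparr>) = p ^ k"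
      using A(2) by (simp add: order_def)
    show "f a C \<in> ?E" if "a \<in> carrier (G\<lparr>carrier := A\<rparr>)" "C \<in> ?E" for a C
      using that by (auto simp: f)
    show "f \<one>\<^bsub>G\<lparr>carrier := A\<rparr>\<^esub> C = C" if "C \<in> ?E" for C
      using that by (auto simp: f)
    show "f (a \<otimes>\<^bsub>G\<lparr>carrier := A\<rparr>\<^esub> b) C = f a (f b C)"
      if "a \<in> carrier (G\<lparr>carrier := A\<rparr>)" "b \<in> carrier (G\<lparr>carrier := A\<rparr>)" "C \<in> ?E" for a b C
      using that by (auto simp: f inv_mult_group m_assoc)
  qed (use fin p in auto)
  moreover have "\<not> p dvd card ?E"
  proof
    assume dvd: "p dvd card ?E"
    have "rcosets P = ?E"
      by (auto simp: RCOSETS_def)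
    then have "card ?E * card P = order G"
      using lagrange[OF P'(1)] by simp
    with mult_dvd_mono[OF dvd dvd_refl, of "card P"] have "p ^ Suc (multiplicity p (order G)) dvd order G"
      by (simp only: P'(2) power_Suc)
    moreover have "order G \<noteq> 0"
      using fin order_gt_0_iff_finite by simp
    moreover have "\<not> is_unit p"
      using p by auto
    ultimately show False
      by (simp add: power_dvd_iff_le_multiplicity del: power_Suc)
  qed
  moreover define F where "F = {C \<in> ?E. \<forall>a \<in> A. f a C = C}"
  ultimately have "\<not> p dvd card F"
    using cong_dvd_iff[of "card ?E" "card F" p] by simp
  then have "F \<noteq> {}"
    by (intro notI) simp
  then obtain C where "C \<in> F"
    by blast
  then obtain x where x: "x \<in> carrier G" "\<And>a. a \<in> A \<Longrightarrow> f a (P #> x) = P #> x"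
    by (auto simp: F_def)
  show thesis
  proof (rule that[OF x(1)])
    fix a assume a: "a \<in> A"
    have "P #> (x \<otimes> inv (inv a)) = P #> x"
      using x(2)[of "inv a"] f[of "inv a" x] a x(1) by simp
    then have "x \<otimes> a \<in> P #> x"
      using a x(1) rcos_self[OF _ P'(1), of "x \<otimes> a"] by simp
    then show "x \<otimes> a \<otimes> inv x \<in> P"
      using P.rcos_module_imp[OF is_group x(1)] by simp
  qed
qed

section \<open>Quotient maps and lifting through kernels of order prime to \<open>p\<close>\<close>

lemma hom_factors_through_surjection:
  assumes "group_hom G M \<pi>" "\<pi> ` carrier G = carrier M" "group_hom G H \<phi>"
    and "\<And>a. \<lbrakk>a \<in> carrier G; \<pi> a = \<one>\<^bsub>M\<^esub>\<rbrakk> \<Longrightarrow> \<phi> a = \<one>\<^bsub>H\<^esub>"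
  obtains \<psi> where "\<psi> \<in> hom M H" "\<And>x. x \<in> carrier G \<Longrightarrow> \<psi> (\<pi> x) = \<phi> x"
proof -
  interpret \<pi>: group_hom G M \<pi> by fact
  interpret \<phi>: group_hom G H \<phi> by fact
  have eq: "\<phi> x = \<phi> y" if "x \<in> carrier G" "y \<in> carrier G" "\<pi> x = \<pi> y" for x y
  proof -
    have "\<phi> (x \<otimes>\<^bsub>G\<^esub> inv\<^bsub>G\<^esub> y) = \<one>\<^bsub>H\<^esub>"
      using that by (intro assms(4)) simp_all
    then have "\<phi> x \<otimes>\<^bsub>H\<^esub> inv\<^bsub>H\<^esub> \<phi> y = \<one>\<^bsub>H\<^esub>"
      using that by simp
    from \<phi>.H.inv_equality[OF this] show ?thesis
      using that by simp
  qed
  define \<psi> where "\<psi> m = \<phi> (SOME x. x \<in> carrier G \<and> \<pi> x = m)" for m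
  have \<psi>: "\<psi> (\<pi> x) = \<phi> x" if "x \<in> carrier G" for x
    unfolding \<psi>_def
    using someI[of "\<lambda>y. y \<in> carrier G \<and> \<pi> y = \<pi> x" x] that by (intro eq) auto
  have "\<psi> \<in> hom M H"
  proof (rule homI)
    fix m assume "m \<in> carrier M"
    then obtain x where "x \<in> carrier G" "m = \<pi> x"
      using assms(2) by blast
    then show "\<psi> m \<in> carrier H"
      by (simp add: \<psi>)
  next
    fix m m' assume "m \<in> carrier M" "m' \<in> carrier M"
    then obtain x y where xy: "x \<in> carrier G" "m = \<pi> x" "y \<in> carrier G" "m' = \<pi> y"
      using assms(2) by blast
    have "m \<otimes>\<^bsub>M\<^esub> m' = \<pi> (x \<otimes>\<^bsub>G\<^esub> y)"
      using xy by simp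
    then show "\<psi> (m \<otimes>\<^bsub>M\<^esub> m') = \<psi> m \<otimes>\<^bsub>H\<^esub> \<psi> m'"
      using xy by (simp only: \<psi> \<pi>.G.m_closed \<phi>.hom_mult)
  qed
  with \<psi> that show thesis by blast
qed

lemma (in group) quotient_hom:
  assumes "N \<lhd> G"
  obtains M :: "'a set monoid" and \<pi> where "group_hom G M \<pi>" "\<pi> ` carrier G = carrier M" "kernel G M \<pi> = N"
proof -
  interpret N: normal N G by fact
  have "group_hom G (G Mod N) (\<lambda>a. N #> a)"
    unfolding group_hom_def group_hom_axioms_def
    using N.r_coset_hom_Mod N.factorgroup_is_group is_group by blast
  moreover have "(\<lambda>a. N #> a) ` carrier G = carrier (G Mod N)"
    by (simp add: carrier_FactGroup)
  moreover have "kernel G (G Mod N) (\<lambda>a. N #> a) = N"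
    using coset_join1[OF _ _ N.subgroup_axioms] coset_join2[OF _ N.subgroup_axioms] N.subset
    by (auto simp: kernel_def)
  ultimately show thesis
    by (rule that)
qed

lemma (in group_hom) image_eq_iff:
  assumes "x \<in> carrier G" "y \<in> carrier G"
  shows "h x = h y \<longleftrightarrow> x \<otimes> inv y \<in> kernel G H h"
proof -
  have "h x = h y \<longleftrightarrow> h x \<otimes>\<^bsub>H\<^esub> inv\<^bsub>H\<^esub> h y = \<one>\<^bsub>H\<^esub>"
    using assms by (metis H.inv_solve_right H.l_one H.one_closed H.r_inv hom_closed)
  then show ?thesis
    using assms by (simp add: kernel_def)
qed

text \<open>A subgroup of order p^k in the preimage of \<open>B\<close> exists by Sylow. It meets
  the kernel trivially, so the relations of \<open>B\<close> hold in it.\<close>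

lemma (in group_hom) elementary_abelian_lift:
  assumes fin: "finite (carrier G)" and surj: "h ` carrier G = carrier H" and p: "prime p"
    and ker: "coprime (card (kernel G H h)) p"
    and B: "subgroup B H" "elementary_abelian p (H\<lparr>carrier := B\<rparr>)" "card B = p ^ k"
  shows "\<exists>A. subgroup A G \<and> elementary_abelian p (G\<lparr>carrier := A\<rparr>) \<and> card A = p ^ k"
proof -
  let ?K = "kernel G H h" and ?B = "{g \<in> carrier G. h g \<in> B}"
  interpret B: subgroup B H by (rule B(1))
  have sub: "subgroup ?B G"
    using B(1) by (rule subgroup_vimage)
  have "card ?B = p ^ k * card ?K"
    using card_vimage[OF fin B(1)] B(3) B.subset surj by simp
  then have "order (G\<lparr>carrier := ?B\<rparr>) = p ^ k * card ?K"
    by (simp add: order_def)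
  from sylow_thm[OF p G.subgroup_imp_group[OF sub] this]
  obtain A where A: "subgroup A (G\<lparr>carrier := ?B\<rparr>)" "card A = p ^ k"
    using fin by auto
  have AG: "subgroup A G"
    using sub A(1) by (rule G.incl_subgroup)
  interpret A: subgroup A G by (rule AG)
  have hA: "h x \<in> B" if "x \<in> A" for x
    using subgroup.subset[OF A(1)] that by auto
  have triv: "x = \<one>" if "x \<in> A" "h x = \<one>\<^bsub>H\<^esub>" for x
  proof -
    have "x \<in> ?K"
      using that by (simp add: kernel_def)
    then have "x [^] card ?K = \<one>" "x [^] (p ^ k) = \<one>"
      using G.pow_card_subgroup[OF subgroup_kernel] G.pow_card_subgroup[OF AG that(1)] A(2) by auto
    then have "G.ord x dvd card ?K" "G.ord x dvd p ^ k"
      using that(1) by (simp_all add: G.pow_eq_id)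
    then have "G.ord x = 1"
      using coprime_divisors[of "G.ord x" "card ?K" "G.ord x" "p ^ k"] ker by simp
    then show ?thesis
      using that(1) G.ord_eq_1 by simp
  qed
  have "x \<otimes> y = y \<otimes> x" if "x \<in> A" "y \<in> A" for x y
  proof -
    have "h x \<otimes>\<^bsub>H\<^esub> h y = h y \<otimes>\<^bsub>H\<^esub> h x"
      using B(2) hA that by (simp add: H.elementary_abelian_subgroup_iff[OF B(1)])
    then have "H.commutator (h x) (h y) = \<one>\<^bsub>H\<^esub>"
      using that H.commutator_eq_one_iff[of "h x" "h y"] by simp
    then have "G.commutator x y = \<one>"
      using that by (intro triv) simp_all
    then show ?thesis
      using that G.commutator_eq_one_iff[of x y] by simp
  qed
  moreover have "x [^] p = \<one>" if "x \<in> A" for x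
  proof (rule triv)
    show "x [^] p \<in> A"
      using G.subgroup_nat_pow_closed[OF AG that] .
    show "h (x [^] p) = \<one>\<^bsub>H\<^esub>"
      using B(2) hA[OF that] that by (simp add: H.elementary_abelian_subgroup_iff[OF B(1)] hom_nat_pow)
  qed
  ultimately have "elementary_abelian p (G\<lparr>carrier := A\<rparr>)"
    by (simp add: G.elementary_abelian_subgroup_iff[OF AG])
  with AG A(2) show ?thesis by blast
qed

section \<open>Frattini's argument and the kernel of a minimal epimorphism\<close>

lemma (in group) frattini_argument:
  assumes fin: "finite (carrier G)" and q: "prime q" and N: "N \<lhd> G"
    and S: "sylow_subgroup q S (G\<lparr>carrier := N\<rparr>)" and g: "g \<in> carrier G"
  shows "\<exists>n \<in> N. (\<lambda>s. n \<otimes> g \<otimes> s \<otimes> inv (n \<otimes> g)) ` S = S"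
proof -
  interpret N: normal N G by (rule N)
  have S': "subgroup S (G\<lparr>carrier := N\<rparr>)" "card S = q ^ multiplicity q (card N)"
    using S by (auto simp: sylow_subgroup_def order_def)
  have SG: "subgroup S G"
    using N.subgroup_axioms S'(1) by (rule incl_subgroup)
  interpret S: subgroup S G by (rule SG)
  have SN: "S \<subseteq> N"
    using subgroup.subset[OF S'(1)] by simp
  \<comment> \<open>Both \<open>S\<close> and its conjugate \<open>T\<close> are Sylow in
    \<open>N\<close>, so an element \<open>n\<close> of \<open>N\<close> takes \<open>T\<close> back
    to \<open>S\<close>.\<close>
  define T where "T = (\<lambda>s. g \<otimes> s \<otimes> inv g) ` S"
  have inj: "inj_on (\<lambda>s. x \<otimes> s \<otimes> inv x) S" if "x \<in> carrier G" for x
    using that by (auto intro!: inj_onI)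
  have "group_hom G G (\<lambda>s. g \<otimes> s \<otimes> inv g)"
    unfolding group_hom_def group_hom_axioms_def using g is_group
    by (auto intro!: homI simp: m_assoc)
  then have T: "subgroup T G"
    unfolding T_def by (rule group_hom.subgroup_img_is_subgroup) (rule SG)
  have "T \<subseteq> N"
    using SN N.inv_op_closed2[OF g] by (auto simp: T_def)
  then have TN: "subgroup T (G\<lparr>carrier := N\<rparr>)"
    using T N.subgroup_axioms by (intro subgroup_incl)
  have "card T = q ^ multiplicity q (card N)"
    using card_image[OF inj[OF g]] S'(2) by (simp add: T_def)
  moreover have "finite (carrier (G\<lparr>carrier := N\<rparr>))"
    using fin N.subset finite_subset by auto
  ultimately obtain n where n: "n \<in> N"
    "\<And>a. a \<in> T \<Longrightarrow> n \<otimes>\<^bsub>G\<lparr>carrier := N\<rparr>\<^esub> a \<otimes>\<^bsub>G\<lparr>carrier := N\<rparr>\<^esub> inv\<^bsub>G\<lparr>carrier := N\<rparr>\<^esub> n \<in> S"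
    using group.p_subgroup_conj_into_sylow[OF subgroup_imp_group[OF N.subgroup_axioms] _ q S TN] by auto
  have "(\<lambda>s. n \<otimes> g \<otimes> s \<otimes> inv (n \<otimes> g)) ` S \<subseteq> S"
  proof safe
    fix s assume s: "s \<in> S"
    have "n \<otimes> (g \<otimes> s \<otimes> inv g) \<otimes> inv n \<in> S"
      using n(2)[of "g \<otimes> s \<otimes> inv g"] s n(1) N.subgroup_axioms by (simp add: T_def)
    moreover have "n \<otimes> (g \<otimes> s \<otimes> inv g) \<otimes> inv n = n \<otimes> g \<otimes> s \<otimes> inv (n \<otimes> g)"
      using s g n(1) by (simp add: m_assoc inv_mult_group)
    ultimately show "n \<otimes> g \<otimes> s \<otimes> inv (n \<otimes> g) \<in> S"
      by simp
  qed
  moreover have "finite S"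
    using fin S.subset finite_subset by blast
  moreover have "n \<otimes> g \<in> carrier G"
    using g n(1) by simp
  ultimately have "(\<lambda>s. n \<otimes> g \<otimes> s \<otimes> inv (n \<otimes> g)) ` S = S"
    using endo_inj_surj inj by blast
  with n(1) show ?thesis by blast
qed

text \<open>By Frattini's argument the normalizer of \<open>S\<close> still maps onto
  \<open>H\<close>, so minimality makes it all of \<open>G\<close>.\<close>

lemma (in group_hom) sylow_of_kernel_normal:
  assumes fin: "finite (carrier G)" and surj: "h ` carrier G = carrier H"
    and minimal: "\<And>L. \<lbrakk>subgroup L G; h ` L = carrier H\<rbrakk> \<Longrightarrow> L = carrier G"
    and q: "prime q" and S: "sylow_subgroup q S (G\<lparr>carrier := kernel G H h\<rparr>)"
  shows "S \<lhd> G"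
proof -
  define L where "L = {g \<in> carrier G. (\<lambda>s. g \<otimes> s \<otimes> inv g) ` S = S}"
  have "subgroup S (G\<lparr>carrier := kernel G H h\<rparr>)"
    using S by (simp add: sylow_subgroup_def)
  then have SG: "subgroup S G"
    by (rule G.incl_subgroup[OF subgroup_kernel])
  have L: "subgroup L G" "S \<lhd> G\<lparr>carrier := L\<rparr>"
    unfolding L_def using G.subgroup_set_stabilizer[OF SG] by auto
  have "h g \<in> h ` L" if g: "g \<in> carrier G" for g
  proof -
    obtain n where n: "n \<in> kernel G H h" "(\<lambda>s. n \<otimes> g \<otimes> s \<otimes> inv (n \<otimes> g)) ` S = S"
      using G.frattini_argument[OF fin q normal_kernel S g] by blast
    have "n \<otimes> g \<in> L" "h (n \<otimes> g) = h g"
      using n g by (auto simp: L_def kernel_def)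
    then show ?thesis
      by (metis image_eqI)
  qed
  then have "h ` carrier G \<subseteq> h ` L"
    by (rule image_subsetI)
  moreover have "h ` L \<subseteq> h ` carrier G"
    by (rule image_mono) (auto simp: L_def)
  ultimately have "h ` L = carrier H"
    using surj by simp
  then have "L = carrier G"
    by (rule minimal[OF L(1)])
  with L(2) show ?thesis
    by simp
qed

text \<open>The product is the preimage of the image of \<open>S\<close> modulo \<open>C\<close>,
  which yields normality and the order at once.\<close>

lemma (in group) normal_set_mult:
  assumes fin: "finite (carrier G)" and N: "C \<lhd> G" "S \<lhd> G"
  shows "C <#> S \<lhd> G" "card (C <#> S) dvd card C * card S"
proof -
  interpret C: normal C G by (rule N(1))
  interpret S: normal S G by (rule N(2))
  obtain M :: "'a set monoid" and \<pi> where \<pi>: "group_hom G M \<pi>" "\<pi> ` carrier G = carrier M" "kernel G M \<pi> = C"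
    by (rule quotient_hom[OF N(1)])
  interpret \<pi>: group_hom G M \<pi> by (rule \<pi>(1))
  have eq: "C <#> S = {g \<in> carrier G. \<pi> g \<in> \<pi> ` S}"
  proof (intro equalityI subsetI)
    fix g assume "g \<in> C <#> S"
    then obtain c s where cs: "c \<in> C" "s \<in> S" "g = c \<otimes> s"
      by (auto simp: set_mult_def)
    then have "\<pi> c = \<one>\<^bsub>M\<^esub>"
      unfolding \<pi>(3)[symmetric] by (simp add: kernel_def)
    then have "\<pi> g = \<pi> s"
      using cs by simp
    with cs show "g \<in> {g \<in> carrier G. \<pi> g \<in> \<pi> ` S}"
      by auto
  next
    fix g assume "g \<in> {g \<in> carrier G. \<pi> g \<in> \<pi> ` S}"
    then obtain s where s: "g \<in> carrier G" "s \<in> S" "\<pi> g = \<pi> s"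
      by blast
    then have "g \<otimes> inv s \<in> C"
      using \<pi>.image_eq_iff[of g s] \<pi>(3) by simp
    moreover have "g = g \<otimes> inv s \<otimes> s"
      using s by (simp add: m_assoc)
    ultimately show "g \<in> C <#> S"
      using s(2) unfolding set_mult_def by blast
  qed
  have \<pi>S: "subgroup (\<pi> ` S) M"
    by (rule \<pi>.subgroup_img_is_subgroup[OF S.subgroup_axioms])
  have "subgroup (C <#> S) G"
    unfolding eq by (rule \<pi>.subgroup_vimage[OF \<pi>S])
  moreover have "g \<otimes> x \<otimes> inv g \<in> C <#> S" if gx: "g \<in> carrier G" "x \<in> C <#> S" for g x
  proof -
    obtain s where s: "x \<in> carrier G" "s \<in> S" "\<pi> x = \<pi> s"
      using gx(2) unfolding eq by blast
    have "\<pi> (g \<otimes> x \<otimes> inv g) = \<pi> (g \<otimes> s \<otimes> inv g)"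
      using s gx(1) by simp
    then have "\<pi> (g \<otimes> x \<otimes> inv g) \<in> \<pi> ` S"
      using S.inv_op_closed2[OF gx(1) s(2)] by (simp only: imageI)
    then show ?thesis
      unfolding eq using s(1) gx(1) by simp
  qed
  ultimately show "C <#> S \<lhd> G"
    by (simp add: normal_inv_iff)
  have "card (C <#> S) = card (\<pi> ` S) * card C"
    using \<pi>.card_vimage[OF fin \<pi>S image_mono[OF S.subset]] by (simp only: eq \<pi>(3))
  moreover have "group_hom (G\<lparr>carrier := S\<rparr>) M \<pi>"
    using subgroup_imp_group[OF S.subgroup_axioms] \<pi>(1)
    by (auto simp: group_hom_def group_hom_axioms_def hom_def)
  then have "card (\<pi> ` S) * card (kernel (G\<lparr>carrier := S\<rparr>) M \<pi>) = card S"
    using group_hom.card_image_mult_card_kernel[of "G\<lparr>carrier := S\<rparr>" M \<pi>] finite_subset[OF S.subset fin]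
    by (simp add: order_def)
  then have "card (\<pi> ` S) dvd card S"
    by (metis dvd_triv_left)
  ultimately show "card (C <#> S) dvd card C * card S"
    by (simp add: mult.commute mult_dvd_mono)
qed

text \<open>By Frattini's argument and minimality the kernel is nilpotent, hence it becomes a \<open>p\<close>-group after
  factoring out its largest normal subgroup \<open>C\<close> of order prime to \<open>p\<close>.\<close>

lemma (in group_hom) normal_p'_subgroup_of_kernel:
  assumes fin: "finite (carrier G)" and surj: "h ` carrier G = carrier H"
    and minimal: "\<And>L. \<lbrakk>subgroup L G; h ` L = carrier H\<rbrakk> \<Longrightarrow> L = carrier G"
    and p: "prime p"
  obtains C a where "C \<lhd> G" "C \<subseteq> kernel G H h" "coprime (card C) p"
    "card (kernel G H h) = p ^ a * card C"
proof -
  let ?K = "kernel G H h"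
  interpret K: normal ?K G by (rule normal_kernel)
  have finK: "finite ?K"
    using fin K.subset finite_subset by blast
  define cand where "cand C \<longleftrightarrow> C \<lhd> G \<and> C \<subseteq> ?K \<and> coprime (card C) p" for C
  have "cand {\<one>}"
    using G.one_is_normal K.one_closed by (simp add: cand_def)
  moreover have "\<forall>C. cand C \<longrightarrow> card C < Suc (card ?K)"
    using card_mono[OF finK] by (auto simp: cand_def less_Suc_eq_le)
  ultimately have "\<exists>C. cand C \<and> (\<forall>C'. cand C' \<longrightarrow> card C' \<le> card C)"
    by (rule ex_has_greatest_nat[where f = card])
  then obtain C where C: "cand C" and max: "\<And>C'. cand C' \<Longrightarrow> card C' \<le> card C"
    by blast
  have CN: "C \<lhd> G" and CK: "C \<subseteq> ?K" and Cp: "coprime (card C) p"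
    using C by (auto simp: cand_def)
  interpret C: normal C G by (rule CN)
  let ?GK = "G\<lparr>carrier := ?K\<rparr>"
  have "subgroup C ?GK"
    using C.subgroup_axioms K.subgroup_axioms CK by (rule G.subgroup_incl)
  from group.lagrange[OF G.subgroup_imp_group[OF K.subgroup_axioms] this]
  have "card (rcosets\<^bsub>?GK\<^esub> C) * card C = card ?K"
    by (simp add: order_def)
  then obtain e where e: "card ?K = e * card C"
    by metis
  have K0: "card ?K \<noteq> 0"
    using K.finite_imp_card_positive[OF fin] by simp
  \<comment> \<open>For a prime \<open>q\<close> other than \<open>p\<close>, the product of
    \<open>C\<close> with a Sylow \<open>q\<close>-subgroup \<open>S\<close> of the kernel is again
    a candidate, so \<open>S\<close> lies in \<open>C\<close>. Then \<open>C\<close> absorbs the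
    full \<open>q\<close>-part of the order, and \<open>q\<close> cannot divide the index
    \<open>e\<close>.\<close>
  have e_prime: "q = p" if q: "prime q" "q dvd e" for q
  proof (rule ccontr)
    assume "q \<noteq> p"
    obtain S where S: "sylow_subgroup q S ?GK"
      using ex_sylow_subgroup[OF G.subgroup_imp_group[OF K.subgroup_axioms] _ q(1)] finK by auto
    have card_S: "card S = q ^ multiplicity q (card ?K)" and "subgroup S ?GK"
      using S by (auto simp: sylow_subgroup_def order_def)
    then have SK: "S \<subseteq> ?K"
      using subgroup.subset by force
    have SN: "S \<lhd> G"
      by (rule sylow_of_kernel_normal[OF fin surj minimal q(1) S])
    interpret S: normal S G by (rule SN)
    have "coprime (card S) p"
      using card_S q(1) p \<open>q \<noteq> p\<close> by (simp add: primes_coprime)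
    then have "coprime (card C * card S) p"
      using Cp by simp
    then have "coprime (card (C <#> S)) p"
      using G.normal_set_mult(2)[OF fin CN SN] by (meson coprime_divisors dvd_refl)
    moreover have "C <#> S \<subseteq> ?K"
      using CK SK by (auto simp: set_mult_def)
    ultimately have "cand (C <#> S)"
      using G.normal_set_mult(1)[OF fin CN SN] by (simp add: cand_def)
    then have le: "card (C <#> S) \<le> card C"
      by (rule max)
    have "C \<subseteq> C <#> S"
    proof
      fix x assume x: "x \<in> C"
      then have "x \<otimes> \<one> \<in> C <#> S"
        using S.one_closed unfolding set_mult_def by blast
      with x show "x \<in> C <#> S" by simp
    qed
    moreover have SCS: "S \<subseteq> C <#> S"
    proof
      fix x assume x: "x \<in> S"
      then have "\<one> \<otimes> x \<in> C <#> S"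
        using C.one_closed unfolding set_mult_def by blast
      with x show "x \<in> C <#> S" by simp
    qed
    moreover have "finite (C <#> S)"
      using finK \<open>C <#> S \<subseteq> ?K\<close> finite_subset by blast
    ultimately have "C = C <#> S"
      using card_seteq[of "C <#> S" C] le by simp
    with SCS have "S \<subseteq> C"
      by simp
    then have "subgroup S (G\<lparr>carrier := C\<rparr>)"
      using S.subgroup_axioms C.subgroup_axioms by (intro G.subgroup_incl)
    from group.lagrange[OF G.subgroup_imp_group[OF C.subgroup_axioms] this]
    have "card (rcosets\<^bsub>G\<lparr>carrier := C\<rparr>\<^esub> S) * card S = card C"
      by (simp add: order_def)
    then have "card S dvd card C"
      by (metis dvd_triv_right)
    with q(2) have "q * q ^ multiplicity q (card ?K) dvd e * card C"
      unfolding card_S by (rule mult_dvd_mono)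
    then have "q ^ Suc (multiplicity q (card ?K)) dvd card ?K"
      by (simp only: e power_Suc)
    moreover have "\<not> is_unit q"
      using q(1) by auto
    ultimately show False
      using K0 by (simp add: power_dvd_iff_le_multiplicity del: power_Suc)
  qed
  have "e > 0"
    using e K0 by (auto intro: gr0I)
  then obtain n a where na: "\<not> p dvd n" "e = n * p ^ a"
    using prime_power_canonical[OF p] by blast
  have "n = 1"
  proof (rule ccontr)
    assume "n \<noteq> 1"
    then obtain q where "prime q" "q dvd n"
      using prime_factor_nat by blast
    then show False
      using e_prime[of q] na by auto
  qed
  with na e have "card ?K = p ^ a * card C"
    by simp
  with CN CK Cp that show thesis by blast
qed

text \<open>Modulo the normal subgroup \<open>C\<close> of order prime to \<open>p\<close> the
  kernel becomes a nontrivial \<open>p\<close>-group. The subgroup of order p^3 found in the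
  quotient lifts back to \<open>G\<close>.\<close>

lemma Qd_hom_minimal_imp_elementary_abelian:
  assumes "group G" and fin: "finite (carrier G)" and p: "prime p" "p > 3"
    and \<phi>: "\<phi> \<in> hom G (Qd p)" "\<phi> ` carrier G = carrier (Qd p)"
    and minimal: "\<And>L. \<lbrakk>subgroup L G; \<phi> ` L = carrier (Qd p)\<rbrakk> \<Longrightarrow> L = carrier G"
    and ker: "\<not> coprime (card (kernel G (Qd p) \<phi>)) p"
  shows "\<exists>A. subgroup A G \<and> elementary_abelian p (G\<lparr>carrier := A\<rparr>) \<and> card A = p ^ 3"
proof -
  interpret G: group G by fact
  interpret Qd: group "Qd p"
    using p(1) by (rule group_Qd)
  interpret \<phi>: group_hom G "Qd p" \<phi>
    using \<phi>(1) by unfold_locales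
  let ?K = "kernel G (Qd p) \<phi>"
  obtain C a where C: "C \<lhd> G" "C \<subseteq> ?K" "coprime (card C) p" and card_K: "card ?K = p ^ a * card C"
    by (rule \<phi>.normal_p'_subgroup_of_kernel[OF fin \<phi>(2) minimal p(1)])
  obtain M :: "'a set monoid" and \<pi> where \<pi>: "group_hom G M \<pi>" "\<pi> ` carrier G = carrier M" "kernel G M \<pi> = C"
    by (rule G.quotient_hom[OF C(1)])
  interpret \<pi>: group_hom G M \<pi> by (rule \<pi>(1))
  have "\<phi> x = \<one>\<^bsub>Qd p\<^esub>" if "x \<in> carrier G" "\<pi> x = \<one>\<^bsub>M\<^esub>" for x
  proof -
    have "x \<in> C"
      unfolding \<pi>(3)[symmetric] using that by (simp add: kernel_def)
    then show ?thesis
      using C(2) by (auto simp: kernel_def)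
  qed
  then obtain \<psi> where \<psi>: "\<psi> \<in> hom M (Qd p)" "\<And>x. x \<in> carrier G \<Longrightarrow> \<psi> (\<pi> x) = \<phi> x"
    using hom_factors_through_surjection[OF \<pi>(1,2) \<phi>.group_hom_axioms] by blast
  have finM: "finite (carrier M)"
    using fin \<pi>(2) by (metis finite_imageI)
  have surj: "\<psi> ` carrier M = carrier (Qd p)"
    unfolding \<pi>(2)[symmetric] image_image using \<phi>(2) \<psi>(2) by (simp cong: image_cong)
  interpret \<psi>: group_hom M "Qd p" \<psi>
    using \<psi>(1) by unfold_locales
  have "{g \<in> carrier G. \<pi> g \<in> kernel M (Qd p) \<psi>} = ?K"
    by (auto simp: kernel_def \<psi>(2))
  moreover have "kernel M (Qd p) \<psi> \<subseteq> \<pi> ` carrier G"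
    using \<pi>(2) by (auto simp: kernel_def)
  ultimately have "card ?K = card (kernel M (Qd p) \<psi>) * card C"
    using \<pi>.card_vimage[OF fin \<psi>.subgroup_kernel] \<pi>(3) by simp
  moreover have "card C \<noteq> 0"
    using C(3) p(2) by (intro notI) simp
  ultimately have ker_\<psi>: "card (kernel M (Qd p) \<psi>) = p ^ a"
    using card_K by simp
  have "a \<noteq> 0"
    using ker card_K C(3) by (intro notI) simp
  then obtain B where B: "subgroup B M" "elementary_abelian p (M\<lparr>carrier := B\<rparr>)" "card B = p ^ 3"
    using Qd_hom_p_kernel_imp_elementary_abelian[OF \<pi>.H.is_group finM p \<psi>(1) surj ker_\<psi>] by blast
  show ?thesis
    using \<pi>.elementary_abelian_lift[OF fin \<pi>(2) p(1) _ B] C(3) \<pi>(3) by simp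
qed

section \<open>The bound by the \<open>p\<close>-rank and the choice of a minimal subgroup\<close>

lemma (in group) elementary_abelian_le_p_rank:
  assumes fin: "finite (carrier G)" and p: "prime p"
    and A: "subgroup A G" "elementary_abelian p (G\<lparr>carrier := A\<rparr>)" "card A = p ^ k"
  shows "k \<le> p_rank p G"
proof -
  define P where "P = (SOME P. sylow_subgroup p P G)"
  have sylow: "sylow_subgroup p P G"
    unfolding P_def using ex_sylow_subgroup[OF is_group fin p] by (rule someI_ex)
  then have P: "subgroup P G" "card P = p ^ multiplicity p (order G)"
    by (auto simp: sylow_subgroup_def)
  interpret P: subgroup P G by (rule P(1))
  interpret A: subgroup A G by (rule A(1))
  \<comment> \<open>\<open>p_rank\<close> refers to one chosen Sylow subgroup, so \<open>A\<close>
    is first conjugated into it.\<close>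
  obtain x where x: "x \<in> carrier G" "\<And>a. a \<in> A \<Longrightarrow> x \<otimes> a \<otimes> inv x \<in> P"
    using p_subgroup_conj_into_sylow[OF fin p sylow A(1,3)] by blast
  define f where "f a = x \<otimes> a \<otimes> inv x" for a
  interpret f: group_hom G G f
    unfolding group_hom_def group_hom_axioms_def f_def using x(1) is_group
    by (auto intro!: homI simp: m_assoc)
  have fA: "subgroup (f ` A) G"
    by (rule f.subgroup_img_is_subgroup[OF A(1)])
  have "elementary_abelian p (G\<lparr>carrier := f ` A\<rparr>)"
    using A(2) unfolding elementary_abelian_subgroup_iff[OF fA] elementary_abelian_subgroup_iff[OF A(1)]
    by (auto simp flip: f.hom_mult f.hom_nat_pow)
  moreover have "inj_on f A"
    using x(1) by (auto intro!: inj_onI simp: f_def)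
  then have "card (f ` A) = p ^ k"
    using A(3) by (simp add: card_image)
  moreover have "subgroup (f ` A) (G\<lparr>carrier := P\<rparr>)"
    using fA P(1) x(2) by (intro subgroup_incl) (auto simp: f_def)
  ultimately have "p ^ k \<in> elementary_abelian_orders p (G\<lparr>carrier := P\<rparr>)"
    unfolding elementary_abelian_orders_def by force
  moreover have "finite (elementary_abelian_orders p (G\<lparr>carrier := P\<rparr>))"
  proof (rule finite_subset)
    show "elementary_abelian_orders p (G\<lparr>carrier := P\<rparr>) \<subseteq> card ` Pow P"
      by (auto simp: elementary_abelian_orders_def dest!: subgroup.subset)
    show "finite (card ` Pow P)"
      using fin P.subset finite_subset by blast
  qed
  ultimately have "p ^ k \<le> Max (elementary_abelian_orders p (G\<lparr>carrier := P\<rparr>))"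
    by simp
  also have "\<dots> = p ^ p_rank p G"
    unfolding p_rank_def P_def[symmetric]
    using Max_elementary_abelian_orders[OF subgroup_imp_group[OF P(1)] p] P(2) by (simp add: order_def)
  finally show ?thesis
    using power_le_imp_le_exp prime_gt_1_nat[OF p] by blast
qed

theorem theorem1p1:
  fixes p :: nat and G :: "('a, 'b) monoid_scheme"
  assumes "prime p" and "p > 3"
    and "group G" and "finite (carrier G)"
    and "p_rank p G = 2"
  shows "involves_Qd p G \<longleftrightarrow> p'_involves_Qd p G"
proof
  assume "p'_involves_Qd p G"
  then show "involves_Qd p G"
    unfolding involves_Qd_def p'_involves_Qd_def by blast
next
  assume "involves_Qd p G"
  then obtain H K where HK: "subgroup H G" "K \<lhd> (G\<lparr>carrier := H\<rparr>)" "(G\<lparr>carrier := H\<rparr>) Mod K \<cong> Qd p"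
    unfolding involves_Qd_def by blast
  interpret G: group G by fact
  \<comment> \<open>A section isomorphic to \<open>Qd p\<close> is recorded as an epimorphism from a
    subgroup; one of least order is taken below.\<close>
  define cand where "cand L \<longleftrightarrow> subgroup L G \<and> (\<exists>\<phi> \<in> hom (G\<lparr>carrier := L\<rparr>) (Qd p). \<phi> ` L = carrier (Qd p))" for L
  obtain i where i: "i \<in> hom ((G\<lparr>carrier := H\<rparr>) Mod K) (Qd p)"
    "i ` carrier ((G\<lparr>carrier := H\<rparr>) Mod K) = carrier (Qd p)"
    using HK(3) by (auto simp: is_iso_def iso_def bij_betw_def)
  have "i \<circ> (\<lambda>x. K #>\<^bsub>G\<lparr>carrier := H\<rparr>\<^esub> x) \<in> hom (G\<lparr>carrier := H\<rparr>) (Qd p)"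
    by (rule hom_compose[OF normal.r_coset_hom_Mod[OF HK(2)] i(1)])
  moreover have "(i \<circ> (\<lambda>x. K #>\<^bsub>G\<lparr>carrier := H\<rparr>\<^esub> x)) ` H = carrier (Qd p)"
    using i(2) by (simp add: carrier_FactGroup image_image)
  ultimately have "cand H"
    unfolding cand_def using HK(1) by blast
  then obtain L where "cand L" and min: "\<And>L'. cand L' \<Longrightarrow> card L \<le> card L'"
    using ex_has_least_nat[of cand H card] by blast
  then obtain \<phi> where L: "subgroup L G" and \<phi>: "\<phi> \<in> hom (G\<lparr>carrier := L\<rparr>) (Qd p)" "\<phi> ` L = carrier (Qd p)"
    unfolding cand_def by blast
  let ?L = "G\<lparr>carrier := L\<rparr>"
  have group_L: "group ?L"
    using L by (rule G.subgroup_imp_group)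
  have finL: "finite (carrier ?L)"
    using assms(4) subgroup.subset[OF L] finite_subset by auto
  have hom_L: "group_hom ?L (Qd p) \<phi>"
    unfolding group_hom_def group_hom_axioms_def using group_L group_Qd[OF assms(1)] \<phi>(1) by blast
  have "coprime (card (kernel ?L (Qd p) \<phi>)) p"
  proof (rule ccontr)
    assume ncop: "\<not> ?thesis"
    \<comment> \<open>Restricting \<phi> to a subgroup of \<open>L\<close> that still maps onto
      \<open>Qd p\<close> gives another candidate.\<close>
    have minimal: "M = carrier ?L" if "subgroup M ?L" "\<phi> ` M = carrier (Qd p)" for M
    proof -
      have M_sub: "M \<subseteq> L"
        using subgroup.subset[OF that(1)] by simp
      have "subgroup M G"
        using L that(1) by (rule G.incl_subgroup)
      moreover have "\<phi> \<in> hom (G\<lparr>carrier := M\<rparr>) (Qd p)"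
        using \<phi>(1) M_sub by (auto simp: hom_def)
      ultimately have "card L \<le> card M"
        using that(2) by (intro min) (auto simp: cand_def)
      then show ?thesis
        using card_seteq[of L M] finL M_sub by simp
    qed
    obtain A where A: "subgroup A ?L" "elementary_abelian p (?L\<lparr>carrier := A\<rparr>)" "card A = p ^ 3"
    proof -
      have "\<exists>A. subgroup A ?L \<and> elementary_abelian p (?L\<lparr>carrier := A\<rparr>) \<and> card A = p ^ 3"
      proof (rule Qd_hom_minimal_imp_elementary_abelian[OF group_L finL assms(1,2) \<phi>(1) _ _ ncop])
        show "\<phi> ` carrier ?L = carrier (Qd p)"
          using \<phi>(2) by simp
      qed (rule minimal)
      with that show thesis by blast
    qed
    have "subgroup A G"
      using L A(1) by (rule G.incl_subgroup)
    then have "3 \<le> p_rank p G"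
      using A(2,3) by (intro G.elementary_abelian_le_p_rank[OF assms(4,1)]) simp_all
    with assms(5) show False by simp
  qed
  moreover have "kernel ?L (Qd p) \<phi> \<lhd> ?L"
    by (rule group_hom.normal_kernel[OF hom_L])
  moreover have "?L Mod kernel ?L (Qd p) \<phi> \<cong> Qd p"
    by (rule group_hom.FactGroup_iso[OF hom_L]) (simp add: \<phi>(2))
  ultimately show "p'_involves_Qd p G"
    unfolding p'_involves_Qd_def using L by blast
qed

end
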